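(* Let $\mathbb K$ be an algebraically closed field of characteristic $3$. Let $\mathfrak e_8=\mathfrak g(A)$ with purely even Cartan matrix $$A=\begin{pmatrix}2&0&-1&0&0&0&0&0\\0&2&0&-1&0&0&0&0\\-1&0&2&-1&0&0&0&0\\0&-1&-1&2&-1&0&0&0\\0&0&0&-1&2&-1&0&0\\0&0&0&0&-1&2&-1&0\\0&0&0&0&0&-1&2&-1\\0&0&0&0&0&0&-1&2\end{pmatrix}.$$ Let $\mathfrak g(8,6)=\mathfrak g(\widetilde A)$ be the Elduque and Cunha Lie superalgebra with Cartan matrix $$\widetilde A=\begin{pmatrix}2&0&-1&0&0&0&0\\0&0&-1&0&0&0&0\\-1&-1&2&-1&0&0&0\\0&0&-1&2&-1&0&0\\0&0&0&-1&2&-1&0\\0&0&0&0&-1&2&-1\\0&0&0&0&0&-1&2\end{pmatrix}$$ in which index $2$ is odd and the others are even. Then the semisimplification of $\mathfrak e_8$, as an object in $\mathrm{Rep}\,\alpha_3$ under the adjoint action of $e_1$, is (isomorphic as a Lie superalgebra to) $\mathfrak g(8,6)$.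
   Context: **Contragredient Lie superalgebras.** Lie superalgebras in characteristic $3$ are required to satisfy $[x,[x,x]]=0$ for odd $x$. Let $A=(a_{ij})$ be an $n\times n$ integer matrix (a Cartan matrix) with a parity $\mathrm{par}(i)\in\mathbb Z/2$ for each index; let $\overline A=(\overline a_{ij})$ be its reduction mod $3$, of rank $s$. Let $\widetilde{\mathfrak h}$ be a $\mathbb K$-vector space of dimension $2n-s$ with linearly independent $h_1,\dots,h_n\in\widetilde{\mathfrak h}$ and linearly independent $\alpha_1,\dots,\alpha_n\in\widetilde{\mathfrak h}^*$ such that $\alpha_j(h_i)=\overline a_{ij}$. $\widetilde{\mathfrak g}(A)$ is the Lie superalgebra generated by $\widetilde{\mathfrak h}$ (even) and $e_i,f_i$ ($1\le i\le n$) of parity $\mathrm{par}(i)$, with relations $[e_i,f_j]=\delta_{ij}h_i$, $[h,e_j]=\alpha_j(h)e_j$, $[h,f_j]=-\alpha_j(h)f_j$, $[\widetilde{\mathfrak h},\widetilde{\mathfrak h}]=0$. It is graded by the free abelian group $Q=\bigoplus_k\mathbb Z\alpha_k$ with $\deg e_i=\alpha_i$, $\deg f_i=-\alpha_i$, $\deg h=0$. $\mathfrak g(A)=\widetilde{\mathfrak g}(A)/\mathfrak r$, where $\mathfrak r$ is the largest $Q$-graded ideal meeting $\widetilde{\mathfrak h}$ trivially; images of $e_i,f_i,h_i$ keep their names. If all parities are $0$, $\mathfrak g(A)$ is a Lie algebra. **Semisimplification.** $\mathrm{Rep}\,\alpha_3$ (representations of the Frobenius kernel of $\mathbb G_a$)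 is the symmetric tensor category of finite-dimensional $\mathbb K[t]/(t^3)$-modules, with $t$ acting on $V\otimes W$ by $t\otimes1+1\otimes t$ and the flip as braiding. Its indecomposables are $J_1,J_2,J_3$, where $t$ acts on $J_n=\mathbb K^n$ as one nilpotent Jordan block. A Lie algebra $\mathfrak g$ with a derivation $d$, $d^3=0$, is a Lie algebra in $\mathrm{Rep}\,\alpha_3$ with $t$ acting by $d$; "under the adjoint action of $x$" means $d=\mathrm{ad}\,x$. The semisimplification functor $V\mapsto\overline V$ is the quotient of $\mathrm{Rep}\,\alpha_3$ by negligible morphisms ($u:V\to W$ with $\mathrm{tr}(u\circ v)=0$ for all $v:W\to V$), with target the Verlinde category $\mathrm{Ver}_3$, whose simple objects are $L_1=\overline{J_1}$, $L_2=\overline{J_2}$ ($\overline{J_3}=0$); $\mathrm{Ver}_3$ is identified with super vector spaces, $L_1$ being an even line and $L_2$ an odd line, so $\overline{\mathfrak g}$ is a Lie superalgebra. Explicitly, decompose $\mathfrak g$ into Jordan blocks $x_i$ ($i\le n_1$), $x_i\mapsto x_i'$ ($n_1<i\le n_1+n_2$), and blocks $x_i\mapsto x_i'\mapsto x_i''$ (arrows are the action of $d$). Then $\overline{\mathfrak g}$ has basis $y_i$ ($i\le n_1+n_2$), even for $i\le n_1$ and odd for $i>n_1$; the coefficient of $y_k$ in $[y_i,y_j]$ is the coefficient of $x_k$ in $[x_i,x_j]$ if the parities of $y_i,y_j,y_k$ are compatible and $y_i,y_j$ are not both odd; it is the coefficient of $x_k$ in $-[x_i,x_j']+[x_i',x_j]$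 if $i,j>n_1$, $k\le n_1$; and $0$ otherwise. *)

theory Defs
  imports
    "HOL-Analysis.Analysis"
    "HOL-Algebra.Algebraic_Closure_Type"
    "HOL-Library.Poly_Mapping"
    "HOL-Library.Numeral_Type"
    "HOL-Library.Z2"
begin

section \<open>Linear algebra over a field type on carrier sets\<close>

abbreviation scalars :: "'k::field ring" where
  "scalars \<equiv> ring_of_type_algebra"

definition lin_maps ::
  "('k::field, 'v, 'y) module_scheme \<Rightarrow> ('k, 'w, 'z) module_scheme \<Rightarrow> ('v \<Rightarrow> 'w) set" where
  "lin_maps V W = {u \<in> carrier V \<rightarrow> carrier W.
     (\<forall>x\<in>carrier V. \<forall>y\<in>carrier V. u (x \<oplus>\<^bsub>V\<^esub> y) = u x \<oplus>\<^bsub>W\<^esub> u y) \<and>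
     (\<forall>c. \<forall>x\<in>carrier V. u (c \<odot>\<^bsub>V\<^esub> x) = c \<odot>\<^bsub>W\<^esub> u x)}"

definition lin_span :: "('k::field, 'v, 'z) module_scheme \<Rightarrow> 'v set \<Rightarrow> 'v set" where
  "lin_span V S = \<Inter>{W. submodule W scalars V \<and> S \<subseteq> W}"

definition expansion ::
  "('k::field, 'v, 'z) module_scheme \<Rightarrow> 'v set \<Rightarrow> 'v \<Rightarrow> ('v \<Rightarrow> 'k) \<Rightarrow> bool" where
  "expansion V B x c \<longleftrightarrow> c \<in> B \<rightarrow>\<^sub>E UNIV \<and> x = (\<Oplus>\<^bsub>V\<^esub>b\<in>B. c b \<odot>\<^bsub>V\<^esub> b)"

definition fin_basis :: "('k::field, 'v, 'z) module_scheme \<Rightarrow> 'v set \<Rightarrow> bool" where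
  "fin_basis V B \<longleftrightarrow> finite B \<and> B \<subseteq> carrier V \<and> (\<forall>x\<in>carrier V. \<exists>!c. expansion V B x c)"

definition coord :: "('k::field, 'v, 'z) module_scheme \<Rightarrow> 'v set \<Rightarrow> 'v \<Rightarrow> 'v \<Rightarrow> 'k" where
  "coord V B x = (THE c. expansion V B x c)"

definition endo_trace :: "('k::field, 'v, 'z) module_scheme \<Rightarrow> ('v \<Rightarrow> 'v) \<Rightarrow> 'k" where
  "endo_trace V f = (THE c. \<exists>B. fin_basis V B \<and> c = (\<Sum>b\<in>B. coord V B (f b) b))"

section \<open>Superalgebras\<close>

text \<open>The bracket is the component \<open>mult\<close>; the component \<open>one\<close> inherited from
  the record \<open>ring\<close> carries no meaning and is ignored throughout.
  \<open>part L 0\<close> and \<open>part L 1\<close> are the even and odd subspaces.\<close>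

record ('k, 'v) superalgebra = "('k, 'v) module" + part :: "bit \<Rightarrow> 'v set"

definition bracket_ideal :: "('k::field, 'v, 'z) module_scheme \<Rightarrow> 'v set \<Rightarrow> bool" where
  "bracket_ideal L I \<longleftrightarrow> submodule I scalars L \<and>
     (\<forall>x\<in>carrier L. \<forall>y\<in>I. x \<otimes>\<^bsub>L\<^esub> y \<in> I \<and> y \<otimes>\<^bsub>L\<^esub> x \<in> I)"

definition ideal_generated :: "('k::field, 'v, 'z) module_scheme \<Rightarrow> 'v set \<Rightarrow> 'v set" where
  "ideal_generated L S = \<Inter>{I. bracket_ideal L I \<and> S \<subseteq> I}"

definition quotient_superalgebra ::
  "('k::field, 'v, 'z) superalgebra_scheme \<Rightarrow> 'v set \<Rightarrow> ('k, 'v set) superalgebra" where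
  "quotient_superalgebra L I =
    \<lparr>carrier = a_rcosets\<^bsub>L\<^esub> I, mult = rcoset_mult L I, one = undefined,
     zero = I, add = set_add L,
     smult = (\<lambda>c C. \<Union>x\<in>C. I +>\<^bsub>L\<^esub> (c \<odot>\<^bsub>L\<^esub> x)),
     part = (\<lambda>p. (\<lambda>x. I +>\<^bsub>L\<^esub> x) ` part L p)\<rparr>"

definition superalgebra_iso ::
  "('k::field, 'v, 'y) superalgebra_scheme \<Rightarrow> ('k, 'w, 'z) superalgebra_scheme \<Rightarrow> bool" where
  "superalgebra_iso L M \<longleftrightarrow> (\<exists>u\<in>lin_maps L M. bij_betw u (carrier L) (carrier M) \<and>
     (\<forall>x\<in>carrier L. \<forall>y\<in>carrier L. u (x \<otimes>\<^bsub>L\<^esub> y) = u x \<otimes>\<^bsub>M\<^esub> u y) \<and>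
     (\<forall>p. u ` part L p = part M p))"

definition koszul_sign :: "bit \<Rightarrow> bit \<Rightarrow> 'k::field" where
  "koszul_sign p q = (if p = 1 \<and> q = 1 then -1 else 1)"

text \<open>The elements that have to vanish in a Lie superalgebra. In characteristic different
  from 2 the first family contains \<open>2 [x, x]\<close>, hence forces \<open>[x, x] = 0\<close>, for even \<open>x\<close>.\<close>

definition lie_super_relators :: "('k::field, 'v, 'z) superalgebra_scheme \<Rightarrow> 'v set" where
  "lie_super_relators L =
     {(x \<otimes>\<^bsub>L\<^esub> y) \<oplus>\<^bsub>L\<^esub> koszul_sign p q \<odot>\<^bsub>L\<^esub> (y \<otimes>\<^bsub>L\<^esub> x) | x y p q. x \<in> part L p \<and> y \<in> part L q} \<union>
     {(x \<otimes>\<^bsub>L\<^esub> (y \<otimes>\<^bsub>L\<^esub> z)) \<ominus>\<^bsub>L\<^esub>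
        (((x \<otimes>\<^bsub>L\<^esub> y) \<otimes>\<^bsub>L\<^esub> z) \<oplus>\<^bsub>L\<^esub> koszul_sign p q \<odot>\<^bsub>L\<^esub> (y \<otimes>\<^bsub>L\<^esub> (x \<otimes>\<^bsub>L\<^esub> z)))
      | x y z p q r. x \<in> part L p \<and> y \<in> part L q \<and> z \<in> part L r} \<union>
     {x \<otimes>\<^bsub>L\<^esub> (x \<otimes>\<^bsub>L\<^esub> x) | x. x \<in> part L 1}"

section \<open>Free nonassociative superalgebras\<close>

datatype 'x word = Gen 'x | Br "'x word" "'x word"

primrec word_degree :: "('x \<Rightarrow> 'd::monoid_add) \<Rightarrow> 'x word \<Rightarrow> 'd" where
  "word_degree gr (Gen x) = gr x"
| "word_degree gr (Br v w) = word_degree gr v + word_degree gr w"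

definition free_part ::
  "('x \<Rightarrow> 'd::monoid_add) \<Rightarrow> 'd \<Rightarrow> ('x word \<Rightarrow>\<^sub>0 'k::field) set" where
  "free_part gr d = {a. \<forall>w\<in>Poly_Mapping.keys a. word_degree gr w = d}"

definition free_scale :: "'k::field \<Rightarrow> ('x word \<Rightarrow>\<^sub>0 'k) \<Rightarrow> ('x word \<Rightarrow>\<^sub>0 'k)" where
  "free_scale c a = Poly_Mapping.map (\<lambda>r. c * r) a"

definition free_bracket ::
  "('x word \<Rightarrow>\<^sub>0 'k::field) \<Rightarrow> ('x word \<Rightarrow>\<^sub>0 'k) \<Rightarrow> ('x word \<Rightarrow>\<^sub>0 'k)" where
  "free_bracket a b = (\<Sum>v\<in>Poly_Mapping.keys a. \<Sum>w\<in>Poly_Mapping.keys b.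
     Poly_Mapping.single (Br v w) (Poly_Mapping.lookup a v * Poly_Mapping.lookup b w))"

definition free_gen :: "'x \<Rightarrow> ('x word \<Rightarrow>\<^sub>0 'k::field)" where
  "free_gen x = Poly_Mapping.single (Gen x) 1"

definition free_superalgebra :: "('x \<Rightarrow> bit) \<Rightarrow> ('k::field, 'x word \<Rightarrow>\<^sub>0 'k) superalgebra" where
  "free_superalgebra par =
    \<lparr>carrier = UNIV, mult = free_bracket, one = undefined, zero = 0, add = (+),
     smult = free_scale, part = free_part par\<rparr>"

section \<open>Contragredient Lie superalgebras\<close>

text \<open>The vector space \<open>\<hh>~\<close> is the whole type \<open>'h\<close> with scalar multiplication \<open>hscale\<close>.\<close>

record ('k, 'n, 'h) cartan_data =
  hscale :: "'k \<Rightarrow> 'h \<Rightarrow> 'h"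
  coroot :: "'n \<Rightarrow> 'h"
  root :: "'n \<Rightarrow> 'h \<Rightarrow> 'k"

definition reduced_matrix :: "int^'n^'n \<Rightarrow> 'k::field^'n^'n" where
  "reduced_matrix A = (\<chi> i j. of_int (A $ i $ j))"

definition realizes ::
  "int^'n^'n \<Rightarrow> ('k::field, 'n::finite, 'h::ab_group_add) cartan_data \<Rightarrow> bool" where
  "realizes A R \<longleftrightarrow>
     vector_space (hscale R) \<and>
     (\<exists>B. finite B \<and> module.span (hscale R) B = UNIV) \<and>
     vector_space.dim (hscale R) UNIV = 2 * CARD('n) - rank (reduced_matrix A :: 'k^'n^'n) \<and>
     (\<forall>c. (\<Sum>i\<in>UNIV. hscale R (c i) (coroot R i)) = 0 \<longrightarrow> (\<forall>i. c i = 0)) \<and>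
     (\<forall>j. Vector_Spaces.linear (hscale R) (*) (root R j)) \<and>
     (\<forall>c. (\<forall>v. (\<Sum>j\<in>UNIV. c j * root R j v) = 0) \<longrightarrow> (\<forall>j. c j = 0)) \<and>
     (\<forall>i j. root R j (coroot R i) = reduced_matrix A $ i $ j)"

datatype ('n, 'h) cartan_gen = E 'n | F 'n | H 'h

primrec gen_parity :: "('n \<Rightarrow> bit) \<Rightarrow> ('n, 'h) cartan_gen \<Rightarrow> bit" where
  "gen_parity par (E i) = par i"
| "gen_parity par (F i) = par i"
| "gen_parity par (H v) = 0"

text \<open>The free abelian group on the simple roots is \<open>int^'n\<close>, the \<open>k\<close>-th simple root
  being \<open>axis k 1\<close>.\<close>

primrec gen_weight :: "('n::finite, 'h) cartan_gen \<Rightarrow> int^'n" where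
  "gen_weight (E i) = axis i 1"
| "gen_weight (F i) = - axis i 1"
| "gen_weight (H v) = 0"

definition cartan_relators ::
  "('k::field, 'n, 'h::ab_group_add) cartan_data \<Rightarrow> (('n, 'h) cartan_gen word \<Rightarrow>\<^sub>0 'k) set" where
  "cartan_relators R =
     {free_gen (H (v + w)) - (free_gen (H v) + free_gen (H w)) | v w. True} \<union>
     {free_gen (H (hscale R c v)) - free_scale c (free_gen (H v)) | c v. True} \<union>
     {free_bracket (free_gen (E i)) (free_gen (F j)) -
        (if i = j then free_gen (H (coroot R i)) else 0) | i j. True} \<union>
     {free_bracket (free_gen (H v)) (free_gen (E j)) -
        free_scale (root R j v) (free_gen (E j)) | v j. True} \<union>
     {free_bracket (free_gen (H v)) (free_gen (F j)) +
        free_scale (root R j v) (free_gen (F j)) | v j. True} \<union>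
     {free_bracket (free_gen (H v)) (free_gen (H w)) | v w. True}"

definition cartan_ideal ::
  "('n \<Rightarrow> bit) \<Rightarrow> ('k::field, 'n, 'h::ab_group_add) cartan_data \<Rightarrow>
    (('n, 'h) cartan_gen word \<Rightarrow>\<^sub>0 'k) set" where
  "cartan_ideal par R =
     ideal_generated (free_superalgebra (gen_parity par))
       (lie_super_relators (free_superalgebra (gen_parity par)) \<union> cartan_relators R)"

definition gtilde ::
  "('n \<Rightarrow> bit) \<Rightarrow> ('k::field, 'n, 'h::ab_group_add) cartan_data \<Rightarrow>
    ('k, (('n, 'h) cartan_gen word \<Rightarrow>\<^sub>0 'k) set) superalgebra" where
  "gtilde par R =
     quotient_superalgebra (free_superalgebra (gen_parity par)) (cartan_ideal par R)"

definition gtilde_class ::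
  "('n \<Rightarrow> bit) \<Rightarrow> ('k::field, 'n, 'h::ab_group_add) cartan_data \<Rightarrow>
    (('n, 'h) cartan_gen word \<Rightarrow>\<^sub>0 'k) \<Rightarrow> (('n, 'h) cartan_gen word \<Rightarrow>\<^sub>0 'k) set" where
  "gtilde_class par R a =
     cartan_ideal par R +>\<^bsub>free_superalgebra (gen_parity par) :: ('k, _) superalgebra\<^esub> a"

definition weight_space ::
  "('n::finite \<Rightarrow> bit) \<Rightarrow> ('k::field, 'n, 'h::ab_group_add) cartan_data \<Rightarrow> int^'n \<Rightarrow>
    (('n, 'h) cartan_gen word \<Rightarrow>\<^sub>0 'k) set set" where
  "weight_space par R d = gtilde_class par R ` free_part gen_weight d"

definition htilde ::
  "('n \<Rightarrow> bit) \<Rightarrow> ('k::field, 'n, 'h::ab_group_add) cartan_data \<Rightarrow>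
    (('n, 'h) cartan_gen word \<Rightarrow>\<^sub>0 'k) set set" where
  "htilde par R = range (\<lambda>v. gtilde_class par R (free_gen (H v)))"

definition graded_ideal ::
  "('n::finite \<Rightarrow> bit) \<Rightarrow> ('k::field, 'n, 'h::ab_group_add) cartan_data \<Rightarrow>
    (('n, 'h) cartan_gen word \<Rightarrow>\<^sub>0 'k) set set \<Rightarrow> bool" where
  "graded_ideal par R I \<longleftrightarrow> bracket_ideal (gtilde par R) I \<and>
     I = lin_span (gtilde par R) (\<Union>d. I \<inter> weight_space par R d)"

definition max_ideal ::
  "('n::finite \<Rightarrow> bit) \<Rightarrow> ('k::field, 'n, 'h::ab_group_add) cartan_data \<Rightarrow>
    (('n, 'h) cartan_gen word \<Rightarrow>\<^sub>0 'k) set set" where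
  "max_ideal par R = (GREATEST I. graded_ideal par R I \<and>
     I \<inter> htilde par R = {\<zero>\<^bsub>gtilde par R\<^esub>})"

type_synonym ('k, 'n, 'h) cartan_carrier =
  "(('n, 'h) cartan_gen word \<Rightarrow>\<^sub>0 'k) set set"

definition contragredient ::
  "('n::finite \<Rightarrow> bit) \<Rightarrow> ('k::field, 'n, 'h::ab_group_add) cartan_data \<Rightarrow>
    ('k, ('k, 'n, 'h) cartan_carrier) superalgebra" where
  "contragredient par R = quotient_superalgebra (gtilde par R) (max_ideal par R)"

definition contragredient_e ::
  "('n::finite \<Rightarrow> bit) \<Rightarrow> ('k::field, 'n, 'h::ab_group_add) cartan_data \<Rightarrow> 'n \<Rightarrow>
    ('k, 'n, 'h) cartan_carrier" where
  "contragredient_e par R i =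
     max_ideal par R +>\<^bsub>gtilde par R\<^esub> gtilde_class par R (free_gen (E i))"

section \<open>Lie algebras in \<open>Rep \<alpha>\<^sub>3\<close> and their semisimplification\<close>

text \<open>An object of \<open>Rep \<alpha>\<^sub>3\<close> is a finite-dimensional vector space together with an
  endomorphism whose cube vanishes, the action of \<open>t\<close>.\<close>

definition alpha3_rep :: "('k::field, 'v, 'z) module_scheme \<Rightarrow> ('v \<Rightarrow> 'v) \<Rightarrow> bool" where
  "alpha3_rep V t \<longleftrightarrow> module scalars V \<and> (\<exists>B. fin_basis V B) \<and> t \<in> lin_maps V V \<and>
     (\<forall>x\<in>carrier V. t (t (t x)) = \<zero>\<^bsub>V\<^esub>)"

definition alpha3_lie_algebra :: "('k::field, 'v, 'z) module_scheme \<Rightarrow> ('v \<Rightarrow> 'v) \<Rightarrow> bool" where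
  "alpha3_lie_algebra L d \<longleftrightarrow> alpha3_rep L d \<and>
     (\<forall>x\<in>carrier L. (\<lambda>y. x \<otimes>\<^bsub>L\<^esub> y) \<in> lin_maps L L \<and> (\<lambda>y. y \<otimes>\<^bsub>L\<^esub> x) \<in> lin_maps L L) \<and>
     (\<forall>x\<in>carrier L. x \<otimes>\<^bsub>L\<^esub> x = \<zero>\<^bsub>L\<^esub>) \<and>
     (\<forall>x\<in>carrier L. \<forall>y\<in>carrier L. \<forall>z\<in>carrier L.
        x \<otimes>\<^bsub>L\<^esub> (y \<otimes>\<^bsub>L\<^esub> z) = (x \<otimes>\<^bsub>L\<^esub> y) \<otimes>\<^bsub>L\<^esub> z \<oplus>\<^bsub>L\<^esub> y \<otimes>\<^bsub>L\<^esub> (x \<otimes>\<^bsub>L\<^esub> z)) \<and>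
     (\<forall>x\<in>carrier L. \<forall>y\<in>carrier L. d (x \<otimes>\<^bsub>L\<^esub> y) = d x \<otimes>\<^bsub>L\<^esub> y \<oplus>\<^bsub>L\<^esub> x \<otimes>\<^bsub>L\<^esub> d y)"

definition rep_homs ::
  "('k::field, 'v, 'y) module_scheme \<Rightarrow> ('v \<Rightarrow> 'v) \<Rightarrow>
   ('k, 'w, 'z) module_scheme \<Rightarrow> ('w \<Rightarrow> 'w) \<Rightarrow> ('v \<Rightarrow> 'w) set" where
  "rep_homs V t W s = {u \<in> lin_maps V W. \<forall>x\<in>carrier V. u (t x) = s (u x)}"

definition negligible_homs ::
  "('k::field, 'v, 'y) module_scheme \<Rightarrow> ('v \<Rightarrow> 'v) \<Rightarrow>
   ('k, 'w, 'z) module_scheme \<Rightarrow> ('w \<Rightarrow> 'w) \<Rightarrow> ('v \<Rightarrow> 'w) set" where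
  "negligible_homs V t W s =
     {u \<in> rep_homs V t W s. \<forall>v\<in>rep_homs W s V t. endo_trace W (u \<circ> v) = 0}"

text \<open>The blocks \<open>J\<^sub>1\<close> and \<open>J\<^sub>2\<close>; the latter has basis \<open>x = (1, 0)\<close>, \<open>x' = (0, 1)\<close> with
  \<open>t x = x'\<close> and \<open>t x' = 0\<close>.\<close>

definition J1 :: "('k::field, 'k) module" where
  "J1 = \<lparr>carrier = UNIV, mult = undefined, one = undefined, zero = 0, add = (+), smult = (*)\<rparr>"

definition J1_t :: "'k::field \<Rightarrow> 'k" where
  "J1_t a = 0"

definition J2 :: "('k::field, 'k \<times> 'k) module" where
  "J2 = \<lparr>carrier = UNIV, mult = undefined, one = undefined, zero = (0, 0),
     add = (\<lambda>a b. (fst a + fst b, snd a + snd b)), smult = (\<lambda>c a. (c * fst a, c * snd a))\<rparr>"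

definition J2_t :: "'k::field \<times> 'k \<Rightarrow> 'k \<times> 'k" where
  "J2_t a = (0, fst a)"

text \<open>The quotient category \<open>Ver\<^sub>3\<close> is identified with super vector spaces by
  \<open>X \<mapsto> Hom(L\<^sub>1, X) \<oplus> Hom(L\<^sub>2, X)\<close>. Its tensor structure comes from the maps
  \<open>J\<^sub>1 \<rightarrow> J\<^sub>1 \<otimes> J\<^sub>1\<close>, \<open>J\<^sub>2 \<rightarrow> J\<^sub>1 \<otimes> J\<^sub>2\<close>, \<open>J\<^sub>2 \<rightarrow> J\<^sub>2 \<otimes> J\<^sub>1\<close> (the unit constraints) and
  \<open>J\<^sub>1 \<rightarrow> J\<^sub>2 \<otimes> J\<^sub>2, 1 \<mapsto> x' \<otimes> x - x \<otimes> x'\<close>, the inclusion of the summand \<open>J\<^sub>1\<close> of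
  \<open>J\<^sub>2 \<otimes> J\<^sub>2 = J\<^sub>1 \<oplus> J\<^sub>3\<close>. The bracket of two morphisms \<open>u : J\<^sub>p \<rightarrow> L\<close> and \<open>v : J\<^sub>q \<rightarrow> L\<close> is the
  composition of the relevant one of these maps with \<open>u \<otimes> v\<close> and the bracket of \<open>L\<close>.\<close>

definition hom_superalgebra ::
  "('k::field, 'v, 'z) module_scheme \<Rightarrow> ('v \<Rightarrow> 'v) \<Rightarrow>
    ('k, ('k \<Rightarrow> 'v) \<times> ('k \<times> 'k \<Rightarrow> 'v)) superalgebra" where
  "hom_superalgebra L d =
    \<lparr>carrier = rep_homs J1 J1_t L d \<times> rep_homs J2 J2_t L d,
     mult = (\<lambda>(u0, u1) (v0, v1).
       (\<lambda>a. (u0 a \<otimes>\<^bsub>L\<^esub> v0 1) \<oplus>\<^bsub>L\<^esub>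
            a \<odot>\<^bsub>L\<^esub> ((\<ominus>\<^bsub>L\<^esub> (u1 (1, 0) \<otimes>\<^bsub>L\<^esub> v1 (0, 1))) \<oplus>\<^bsub>L\<^esub> (u1 (0, 1) \<otimes>\<^bsub>L\<^esub> v1 (1, 0))),
        \<lambda>a. (u0 1 \<otimes>\<^bsub>L\<^esub> v1 a) \<oplus>\<^bsub>L\<^esub> (u1 a \<otimes>\<^bsub>L\<^esub> v0 1))),
     one = undefined,
     zero = (\<lambda>a. \<zero>\<^bsub>L\<^esub>, \<lambda>a. \<zero>\<^bsub>L\<^esub>),
     add = (\<lambda>(u0, u1) (v0, v1). (\<lambda>a. u0 a \<oplus>\<^bsub>L\<^esub> v0 a, \<lambda>a. u1 a \<oplus>\<^bsub>L\<^esub> v1 a)),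
     smult = (\<lambda>c (u0, u1). (\<lambda>a. c \<odot>\<^bsub>L\<^esub> u0 a, \<lambda>a. c \<odot>\<^bsub>L\<^esub> u1 a)),
     part = (\<lambda>p. if p = 0 then rep_homs J1 J1_t L d \<times> {\<lambda>a. \<zero>\<^bsub>L\<^esub>}
                 else {\<lambda>a. \<zero>\<^bsub>L\<^esub>} \<times> rep_homs J2 J2_t L d)\<rparr>"

definition semisimplification ::
  "('k::field, 'v, 'z) module_scheme \<Rightarrow> ('v \<Rightarrow> 'v) \<Rightarrow>
    ('k, (('k \<Rightarrow> 'v) \<times> ('k \<times> 'k \<Rightarrow> 'v)) set) superalgebra" where
  "semisimplification L d = quotient_superalgebra (hom_superalgebra L d)
     (negligible_homs J1 J1_t L d \<times> negligible_homs J2 J2_t L d)"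

lemma scalars_simps [simp]:
  "carrier scalars = UNIV" "add scalars = (+)" "mult scalars = (*)"
  "one scalars = 1" "zero scalars = 0"
  by (simp_all add: ring_of_type_algebra_def)

definition functional :: "('k::field, 'v, 'z) module_scheme \<Rightarrow> ('v \<Rightarrow> 'k) \<Rightarrow> bool" where
  "functional V f \<longleftrightarrow>
     (\<forall>x\<in>carrier V. \<forall>y\<in>carrier V. f (x \<oplus>\<^bsub>V\<^esub> y) = f x + f y) \<and>
     (\<forall>c. \<forall>x\<in>carrier V. f (c \<odot>\<^bsub>V\<^esub> x) = c * f x)"

lemma functional_zero:
  assumes "module scalars V" "functional V f"
  shows "f \<zero>\<^bsub>V\<^esub> = 0"
proof -
  interpret module scalars V by fact
  have "f (\<zero>\<^bsub>V\<^esub> \<oplus>\<^bsub>V\<^esub> \<zero>\<^bsub>V\<^esub>) = f \<zero>\<^bsub>V\<^esub> + f \<zero>\<^bsub>V\<^esub>"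
    using assms(2) M.zero_closed unfolding functional_def by blast
  then have "f \<zero>\<^bsub>V\<^esub> = f \<zero>\<^bsub>V\<^esub> + f \<zero>\<^bsub>V\<^esub>"
    by (simp only: M.l_zero[OF M.zero_closed])
  then show ?thesis by (simp only: add_cancel_right_right)
qed

lemma functional_finsum:
  assumes "module scalars V" "functional V f" "finite B" "B \<subseteq> carrier V"
  shows "f (\<Oplus>\<^bsub>V\<^esub>b\<in>B. c b \<odot>\<^bsub>V\<^esub> b) = (\<Sum>b\<in>B. c b * f b)"
proof -
  interpret module scalars V by fact
  have cl: "r \<odot>\<^bsub>V\<^esub> x \<in> carrier V" if "x \<in> carrier V" for r x
    using smult_closed[of r x] that by simp
  show ?thesis
    using assms(3,4)
  proof (induction B rule: finite_induct)
    case empty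
    then show ?case using functional_zero[OF assms(1,2)] by simp
  next
    case (insert b B)
    have "(\<Oplus>\<^bsub>V\<^esub>b\<in>insert b B. c b \<odot>\<^bsub>V\<^esub> b) = c b \<odot>\<^bsub>V\<^esub> b \<oplus>\<^bsub>V\<^esub> (\<Oplus>\<^bsub>V\<^esub>b\<in>B. c b \<odot>\<^bsub>V\<^esub> b)"
      using insert cl by (intro M.finsum_insert) auto
    moreover have "(\<Oplus>\<^bsub>V\<^esub>b\<in>B. c b \<odot>\<^bsub>V\<^esub> b) \<in> carrier V"
      using insert cl by (intro M.finsum_closed) auto
    ultimately show ?case
      using insert cl assms(2) by (auto simp: functional_def)
  qed
qed

lemma coord_expansion:
  assumes "fin_basis V B" "x \<in> carrier V"
  shows "expansion V B x (coord V B x)"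
  using theI'[of "expansion V B x"] assms unfolding fin_basis_def coord_def by blast

lemma coord_unique:
  assumes "fin_basis V B" "x \<in> carrier V" "expansion V B x c"
  shows "coord V B x = c"
  using assms coord_expansion[OF assms(1,2)] unfolding fin_basis_def by blast

lemma functional_coord:
  assumes V: "module scalars V" and B: "fin_basis V B" and b: "b \<in> B"
  shows "functional V (\<lambda>x. coord V B x b)"
proof -
  interpret module scalars V by fact
  have BV: "finite B" "B \<subseteq> carrier V" using B by (auto simp: fin_basis_def)
  have cl: "r \<odot>\<^bsub>V\<^esub> x \<in> carrier V" if "x \<in> carrier V" for r x
    using smult_closed[of r x] that by simp
  have "coord V B (x \<oplus>\<^bsub>V\<^esub> y) = (\<lambda>b\<in>B. coord V B x b + coord V B y b)"
    if xy: "x \<in> carrier V" "y \<in> carrier V" for x y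
  proof (rule coord_unique[OF B])
    have "(\<Oplus>\<^bsub>V\<^esub>b\<in>B. (\<lambda>b\<in>B. coord V B x b + coord V B y b) b \<odot>\<^bsub>V\<^esub> b) =
          (\<Oplus>\<^bsub>V\<^esub>b\<in>B. coord V B x b \<odot>\<^bsub>V\<^esub> b \<oplus>\<^bsub>V\<^esub> coord V B y b \<odot>\<^bsub>V\<^esub> b)"
      using BV cl smult_l_distr by (intro M.finsum_cong') (auto simp: subset_iff)
    also have "\<dots> = (\<Oplus>\<^bsub>V\<^esub>b\<in>B. coord V B x b \<odot>\<^bsub>V\<^esub> b) \<oplus>\<^bsub>V\<^esub> (\<Oplus>\<^bsub>V\<^esub>b\<in>B. coord V B y b \<odot>\<^bsub>V\<^esub> b)"
      using BV cl by (intro M.finsum_addf) auto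
    also have "\<dots> = x \<oplus>\<^bsub>V\<^esub> y"
      using coord_expansion[OF B xy(1)] coord_expansion[OF B xy(2)] unfolding expansion_def by simp
    finally show "expansion V B (x \<oplus>\<^bsub>V\<^esub> y) (\<lambda>b\<in>B. coord V B x b + coord V B y b)"
      unfolding expansion_def by simp
  qed (use xy in simp)
  moreover have "coord V B (r \<odot>\<^bsub>V\<^esub> x) = (\<lambda>b\<in>B. r * coord V B x b)" if x: "x \<in> carrier V" for r x
  proof (rule coord_unique[OF B])
    have "(\<Oplus>\<^bsub>V\<^esub>b\<in>B. (\<lambda>b\<in>B. r * coord V B x b) b \<odot>\<^bsub>V\<^esub> b) =
          (\<Oplus>\<^bsub>V\<^esub>b\<in>B. r \<odot>\<^bsub>V\<^esub> (coord V B x b \<odot>\<^bsub>V\<^esub> b))"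
      using BV cl smult_assoc1 by (intro M.finsum_cong') (auto simp: subset_iff)
    also have "\<dots> = r \<odot>\<^bsub>V\<^esub> (\<Oplus>\<^bsub>V\<^esub>b\<in>B. coord V B x b \<odot>\<^bsub>V\<^esub> b)"
      using BV cl by (intro finsum_smult_ldistr[symmetric]) auto
    also have "\<dots> = r \<odot>\<^bsub>V\<^esub> x"
      using coord_expansion[OF B x] unfolding expansion_def by simp
    finally show "expansion V B (r \<odot>\<^bsub>V\<^esub> x) (\<lambda>b\<in>B. r * coord V B x b)"
      unfolding expansion_def by simp
  qed (use x cl in simp)
  ultimately show ?thesis using b unfolding functional_def by simp
qed

lemma coord_basis:
  assumes V: "module scalars V" and B: "fin_basis V B" and b: "b \<in> B"
  shows "coord V B b = (\<lambda>b'\<in>B. if b' = b then 1 else 0)"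
proof (rule coord_unique[OF B])
  interpret module scalars V by fact
  have BV: "finite B" "B \<subseteq> carrier V" using B by (auto simp: fin_basis_def)
  have one: "1 \<odot>\<^bsub>V\<^esub> x = x" if "x \<in> carrier V" for x
    using smult_one[OF that] by simp
  have zero: "0 \<odot>\<^bsub>V\<^esub> x = \<zero>\<^bsub>V\<^esub>" if "x \<in> carrier V" for x
    using smult_l_null[OF that] by simp
  show "b \<in> carrier V" using b BV by auto
  have "(\<Oplus>\<^bsub>V\<^esub>b'\<in>B. (\<lambda>b'\<in>B. if b' = b then 1 else 0) b' \<odot>\<^bsub>V\<^esub> b') =
        (\<Oplus>\<^bsub>V\<^esub>b'\<in>B. if b = b' then b' else \<zero>\<^bsub>V\<^esub>)"
    using BV one zero by (intro M.finsum_cong') auto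
  also have "\<dots> = b"
    using M.finsum_singleton[OF b BV(1), of "\<lambda>b. b"] BV by auto
  finally show "expansion V B b (\<lambda>b'\<in>B. if b' = b then 1 else 0)"
    unfolding expansion_def by simp
qed

lemma functional_expand:
  assumes V: "module scalars V" and B: "fin_basis V B" and f: "functional V f" and x: "x \<in> carrier V"
  shows "f x = (\<Sum>b\<in>B. coord V B x b * f b)"
proof -
  have "f x = f (\<Oplus>\<^bsub>V\<^esub>b\<in>B. coord V B x b \<odot>\<^bsub>V\<^esub> b)"
    using coord_expansion[OF B x] unfolding expansion_def by simp
  also have "\<dots> = (\<Sum>b\<in>B. coord V B x b * f b)"
    using B by (intro functional_finsum[OF V f]) (auto simp: fin_basis_def)
  finally show ?thesis .
qed

lemma functional_comp:
  assumes "functional W f" "u \<in> lin_maps V W"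
  shows "functional V (\<lambda>x. f (u x))"
  using assms unfolding functional_def lin_maps_def by (auto simp: Pi_iff)

lemma trace_basis_change:
  assumes V: "module scalars V" and B: "fin_basis V B" and C: "fin_basis V C"
    and f: "f \<in> lin_maps V V"
  shows "(\<Sum>b\<in>B. coord V B (f b) b) = (\<Sum>c\<in>C. coord V C (f c) c)"
proof -
  have BV: "finite B" "B \<subseteq> carrier V" and CV: "finite C" "C \<subseteq> carrier V"
    using B C by (auto simp: fin_basis_def)
  have fc: "f x \<in> carrier V" if "x \<in> carrier V" for x
    using f that by (auto simp: lin_maps_def)
  have "(\<Sum>c\<in>C. coord V C (f c) c) = (\<Sum>c\<in>C. \<Sum>b\<in>B. coord V B c b * coord V C (f b) c)"
    using CV by (intro sum.cong refl functional_expand[OF V B functional_comp[OF functional_coord[OF V C] f]]) auto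
  also have "\<dots> = (\<Sum>b\<in>B. \<Sum>c\<in>C. coord V C (f b) c * coord V B c b)"
    by (subst sum.swap) (simp add: mult.commute)
  also have "\<dots> = (\<Sum>b\<in>B. coord V B (f b) b)"
    using BV fc by (intro sum.cong refl functional_expand[OF V C functional_coord[OF V B], symmetric]) auto
  finally show ?thesis by simp
qed

lemma endo_trace_eq:
  assumes "module scalars V" "fin_basis V B" "f \<in> lin_maps V V"
  shows "endo_trace V f = (\<Sum>b\<in>B. coord V B (f b) b)"
  unfolding endo_trace_def using assms trace_basis_change by (intro the_equality) blast+

text \<open>The explicit description of the semisimplification in terms of Jordan blocks. The blocks of
  size 1 are the elements \<open>k\<close> of a Jordan basis with \<open>t k = 0\<close> that are not in the image of \<open>t\<close>,
  the blocks of size 2 are headed by those \<open>k\<close> with \<open>t k \<noteq> 0 = t (t k)\<close> that are not in the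
  image of \<open>t\<close>. Modulo negligible morphisms, a morphism is determined by its coefficients at
  these heads, and each head is the value of a morphism.\<close>

definition jordan_basis :: "('k::field, 'v, 'z) module_scheme \<Rightarrow> ('v \<Rightarrow> 'v) \<Rightarrow> 'v set \<Rightarrow> bool" where
  "jordan_basis V t B \<longleftrightarrow> fin_basis V B \<and> t ` B \<subseteq> insert \<zero>\<^bsub>V\<^esub> B \<and>
     inj_on t {b \<in> B. t b \<noteq> \<zero>\<^bsub>V\<^esub>}"

definition heads1 :: "('k::field, 'v, 'z) module_scheme \<Rightarrow> ('v \<Rightarrow> 'v) \<Rightarrow> 'v set \<Rightarrow> 'v set" where
  "heads1 V t B = {k \<in> B. k \<notin> t ` B \<and> t k = \<zero>\<^bsub>V\<^esub>}"

definition heads2 :: "('k::field, 'v, 'z) module_scheme \<Rightarrow> ('v \<Rightarrow> 'v) \<Rightarrow> 'v set \<Rightarrow> 'v set" where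
  "heads2 V t B = {k \<in> B. k \<notin> t ` B \<and> t k \<noteq> \<zero>\<^bsub>V\<^esub> \<and> t (t k) = \<zero>\<^bsub>V\<^esub>}"

lemma jordan_coord:
  assumes V: "module scalars V" and t: "t \<in> lin_maps V V" and J: "jordan_basis V t B"
    and x: "x \<in> carrier V"
  shows "b \<in> B \<Longrightarrow> t b \<noteq> \<zero>\<^bsub>V\<^esub> \<Longrightarrow> coord V B (t x) (t b) = coord V B x b"
    and "b \<in> B \<Longrightarrow> b \<notin> t ` B \<Longrightarrow> coord V B (t x) b = 0"
proof -
  interpret module scalars V by fact
  have B: "fin_basis V B" and BV: "finite B" "B \<subseteq> carrier V"
    using J by (auto simp: jordan_basis_def fin_basis_def)
  have c0: "coord V B \<zero>\<^bsub>V\<^esub> b = 0" if "b \<in> B" for b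
    using functional_zero[OF V functional_coord[OF V B that]] .
  have tB: "t b' = \<zero>\<^bsub>V\<^esub> \<or> t b' \<in> B" if "b' \<in> B" for b'
    using J that by (auto simp: jordan_basis_def)
  have inj: "b = b'" if "b \<in> B" "b' \<in> B" "t b = t b'" "t b \<noteq> \<zero>\<^bsub>V\<^esub>" for b b'
    using J that by (auto simp: jordan_basis_def inj_on_def)
  {
    assume b: "b \<in> B" "t b \<noteq> \<zero>\<^bsub>V\<^esub>"
    then have tb: "t b \<in> B" using tB by auto
    have "coord V B (t x) (t b) = (\<Sum>b'\<in>B. coord V B x b' * coord V B (t b') (t b))"
      by (rule functional_expand[OF V B functional_comp[OF functional_coord[OF V B tb] t] x])
    also have "\<dots> = (\<Sum>b'\<in>B. coord V B x b' * (if b' = b then 1 else 0))"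
    proof (intro sum.cong refl arg_cong2[where f = "(*)"])
      fix b' assume b': "b' \<in> B"
      show "coord V B (t b') (t b) = (if b' = b then 1 else 0)"
      proof (cases "t b' = \<zero>\<^bsub>V\<^esub>")
        case True
        then show ?thesis using c0[OF tb] b by auto
      next
        case False
        then show ?thesis
          using tB[OF b'] inj[OF b' b(1)] b tb by (auto simp: coord_basis[OF V B])
      qed
    qed
    also have "\<dots> = coord V B x b" using b BV by (simp add: if_distrib cong: if_cong)
    finally show "coord V B (t x) (t b) = coord V B x b" .
  }
  {
    assume b: "b \<in> B" "b \<notin> t ` B"
    have "coord V B (t x) b = (\<Sum>b'\<in>B. coord V B x b' * coord V B (t b') b)"
      by (rule functional_expand[OF V B functional_comp[OF functional_coord[OF V B b(1)] t] x])
    also have "\<dots> = 0"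
    proof (intro sum.neutral ballI)
      fix b' assume b': "b' \<in> B"
      show "coord V B x b' * coord V B (t b') b = 0"
        using tB[OF b'] c0[OF b(1)] b b' by (auto simp: coord_basis[OF V B] image_iff)
    qed
    finally show "coord V B (t x) b = 0" .
  }
qed

lemma J_simps [simp]:
  "carrier J1 = UNIV" "add J1 = (+)" "smult J1 = (*)"
  "carrier J2 = UNIV" "add J2 = (\<lambda>a b. (fst a + fst b, snd a + snd b))"
  "smult J2 = (\<lambda>c a. (c * fst a, c * snd a))"
  by (simp_all add: J1_def J2_def)

lemma lin_maps_J1:
  assumes "u \<in> lin_maps J1 V"
  shows "u a = a \<odot>\<^bsub>V\<^esub> u 1"
proof -
  have "u (a \<odot>\<^bsub>J1\<^esub> 1) = a \<odot>\<^bsub>V\<^esub> u 1"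
    using assms unfolding lin_maps_def by fastforce
  then show ?thesis by simp
qed

lemma lin_maps_J2:
  assumes "u \<in> lin_maps J2 V"
  shows "u a = fst a \<odot>\<^bsub>V\<^esub> u (1, 0) \<oplus>\<^bsub>V\<^esub> snd a \<odot>\<^bsub>V\<^esub> u (0, 1)"
proof -
  have s: "u (c \<odot>\<^bsub>J2\<^esub> b) = c \<odot>\<^bsub>V\<^esub> u b" for c b
    using assms unfolding lin_maps_def by fastforce
  have p: "u (b \<oplus>\<^bsub>J2\<^esub> c) = u b \<oplus>\<^bsub>V\<^esub> u c" for b c
    using assms unfolding lin_maps_def by fastforce
  have "u a = u ((fst a \<odot>\<^bsub>J2\<^esub> (1, 0)) \<oplus>\<^bsub>J2\<^esub> (snd a \<odot>\<^bsub>J2\<^esub> (0, 1)))"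
    by (simp add: J2_def)
  then show ?thesis unfolding s p .
qed

lemma lin_maps_comp:
  assumes "v \<in> lin_maps U V" "u \<in> lin_maps V W"
  shows "u \<circ> v \<in> lin_maps U W"
  using assms unfolding lin_maps_def by (auto simp: Pi_iff)

lemma trace_J1:
  assumes V: "module scalars V" and B: "fin_basis V B"
    and u: "u \<in> lin_maps J1 V" and v: "v \<in> lin_maps V J1"
  shows "endo_trace V (u \<circ> v) = v (u 1)"
proof -
  have BV: "B \<subseteq> carrier V" using B by (auto simp: fin_basis_def)
  have u1: "u 1 \<in> carrier V" using u by (auto simp: lin_maps_def)
  have v': "functional V v" using v by (auto simp: lin_maps_def functional_def)
  have "endo_trace V (u \<circ> v) = (\<Sum>b\<in>B. coord V B (u (v b)) b)"
    using endo_trace_eq[OF V B lin_maps_comp[OF v u]] by simp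
  also have "\<dots> = (\<Sum>b\<in>B. coord V B (u 1) b * v b)"
  proof (intro sum.cong refl)
    fix b assume "b \<in> B"
    then have "coord V B (v b \<odot>\<^bsub>V\<^esub> u 1) b = v b * coord V B (u 1) b"
      using functional_coord[OF V B] u1 unfolding functional_def by blast
    then show "coord V B (u (v b)) b = coord V B (u 1) b * v b"
      using lin_maps_J1[OF u, of "v b"] by simp
  qed
  also have "\<dots> = v (u 1)"
    using functional_expand[OF V B v' u1] by simp
  finally show ?thesis .
qed

lemma functional_fst_snd:
  assumes "v \<in> lin_maps V J2"
  shows "functional V (\<lambda>x. fst (v x))" "functional V (\<lambda>x. snd (v x))"
  using assms by (auto simp: lin_maps_def functional_def)

lemma trace_J2:
  assumes V: "module scalars V" and B: "fin_basis V B"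
    and u: "u \<in> lin_maps J2 V" and v: "v \<in> lin_maps V J2"
  shows "endo_trace V (u \<circ> v) = fst (v (u (1, 0))) + snd (v (u (0, 1)))"
proof -
  interpret module scalars V by fact
  have cl: "r \<odot>\<^bsub>V\<^esub> x \<in> carrier V" if "x \<in> carrier V" for r x
    using smult_closed[of r x] that by simp
  have uc: "u a \<in> carrier V" for a using u by (auto simp: lin_maps_def)
  have "endo_trace V (u \<circ> v) = (\<Sum>b\<in>B. coord V B (u (v b)) b)"
    using endo_trace_eq[OF V B lin_maps_comp[OF v u]] by simp
  also have "\<dots> = (\<Sum>b\<in>B. coord V B (u (1, 0)) b * fst (v b) + coord V B (u (0, 1)) b * snd (v b))"
  proof (intro sum.cong refl)
    fix b assume "b \<in> B"
    from functional_coord[OF V B this] 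
    have "coord V B (fst (v b) \<odot>\<^bsub>V\<^esub> u (1, 0) \<oplus>\<^bsub>V\<^esub> snd (v b) \<odot>\<^bsub>V\<^esub> u (0, 1)) b =
        fst (v b) * coord V B (u (1, 0)) b + snd (v b) * coord V B (u (0, 1)) b"
      using uc cl unfolding functional_def by simp
    then show "coord V B (u (v b)) b =
        coord V B (u (1, 0)) b * fst (v b) + coord V B (u (0, 1)) b * snd (v b)"
      using lin_maps_J2[OF u, of "v b"] by (simp add: mult.commute)
  qed
  also have "\<dots> = fst (v (u (1, 0))) + snd (v (u (0, 1)))"
    using functional_expand[OF V B functional_fst_snd(1)[OF v] uc[of "(1, 0)"]]
      functional_expand[OF V B functional_fst_snd(2)[OF v] uc[of "(0, 1)"]]
    by (simp add: sum.distrib)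
  finally show ?thesis .
qed

lemma negligible_J1_iff:
  assumes V: "alpha3_rep V t" and J: "jordan_basis V t B" and u: "u \<in> rep_homs J1 J1_t V t"
  shows "u \<in> negligible_homs J1 J1_t V t \<longleftrightarrow> (\<forall>k\<in>heads1 V t B. coord V B (u 1) k = 0)"
proof -
  have M: "module scalars V" and t: "t \<in> lin_maps V V" using V by (auto simp: alpha3_rep_def)
  interpret module scalars V by fact
  have B: "fin_basis V B" and BV: "B \<subseteq> carrier V"
    using J by (auto simp: jordan_basis_def fin_basis_def)
  have ul: "u \<in> lin_maps J1 V" and u1: "u 1 \<in> carrier V"
    using u by (auto simp: rep_homs_def lin_maps_def)
  have c0: "coord V B \<zero>\<^bsub>V\<^esub> b = 0" if "b \<in> B" for b
    using functional_zero[OF M functional_coord[OF M B that]] .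
  have "u (J1_t 1) = t (u 1)" using u by (auto simp: rep_homs_def)
  then have tu: "t (u 1) = \<zero>\<^bsub>V\<^esub>"
    using lin_maps_J1[OF ul, of 0] smult_l_null[OF u1] by (simp add: J1_t_def)
  show ?thesis
  proof
    assume n: "u \<in> negligible_homs J1 J1_t V t"
    show "\<forall>k\<in>heads1 V t B. coord V B (u 1) k = 0"
    proof
      fix k assume "k \<in> heads1 V t B"
      then have k: "k \<in> B" "k \<notin> t ` B" by (auto simp: heads1_def)
      let ?v = "\<lambda>x. coord V B x k"
      have v: "?v \<in> rep_homs V t J1 J1_t"
        using functional_coord[OF M B k(1)] jordan_coord(2)[OF M t J _ k]
        by (auto simp: rep_homs_def lin_maps_def functional_def J1_t_def)
      then have "endo_trace V (u \<circ> ?v) = 0" using n by (auto simp: negligible_homs_def)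
      then show "coord V B (u 1) k = 0"
        using trace_J1[OF M B ul, of ?v] v by (auto simp: rep_homs_def)
    qed
  next
    assume h: "\<forall>k\<in>heads1 V t B. coord V B (u 1) k = 0"
    have "v (u 1) = 0" if v: "v \<in> rep_homs V t J1 J1_t" for v
    proof -
      have vt: "v (t x) = 0" if "x \<in> carrier V" for x
        using v that by (auto simp: rep_homs_def J1_t_def)
      have "v (u 1) = (\<Sum>b\<in>B. coord V B (u 1) b * v b)"
        using v u1 by (intro functional_expand[OF M B]) (auto simp: rep_homs_def lin_maps_def functional_def)
      also have "\<dots> = 0"
      proof (intro sum.neutral ballI)
        fix b assume b: "b \<in> B"
        consider "b \<in> t ` B" | "t b \<noteq> \<zero>\<^bsub>V\<^esub>" | "b \<in> heads1 V t B"
          using b by (auto simp: heads1_def)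
        then show "coord V B (u 1) b * v b = 0"
        proof cases
          case 1 then show ?thesis using vt BV by auto
        next
          case 2
          then have "t b \<in> B" using J b by (auto simp: jordan_basis_def)
          then show ?thesis using jordan_coord(1)[OF M t J u1 b 2] c0 tu by auto
        next
          case 3 then show ?thesis using h by auto
        qed
      qed
      finally show ?thesis .
    qed
    then show "u \<in> negligible_homs J1 J1_t V t"
      using u trace_J1[OF M B ul] by (auto simp: negligible_homs_def rep_homs_def)
  qed
qed

lemma negligible_J2_iff:
  fixes V :: "('k::field, 'v, 'z) module_scheme"
  assumes two: "(2::'k) \<noteq> 0"
    and V: "alpha3_rep V t" and J: "jordan_basis V t B" and u: "u \<in> rep_homs J2 J2_t V t"
  shows "u \<in> negligible_homs J2 J2_t V t \<longleftrightarrow> (\<forall>k\<in>heads2 V t B. coord V B (u (1, 0)) k = 0)"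
proof -
  have M: "module scalars V" and t: "t \<in> lin_maps V V" using V by (auto simp: alpha3_rep_def)
  interpret module scalars V by fact
  have B: "fin_basis V B" and BV: "B \<subseteq> carrier V"
    using J by (auto simp: jordan_basis_def fin_basis_def)
  define a where "a = u (1, 0)"
  have ul: "u \<in> lin_maps J2 V" and uc: "u c \<in> carrier V" for c
    using u by (auto simp: rep_homs_def lin_maps_def)
  have a: "a \<in> carrier V" using uc by (simp add: a_def)
  have ta: "t a \<in> carrier V" using a t by (auto simp: lin_maps_def)
  have c0: "coord V B \<zero>\<^bsub>V\<^esub> b = 0" if "b \<in> B" for b
    using functional_zero[OF M functional_coord[OF M B that]] .
  have u2: "u (0, 1) = t a"
    using u by (auto simp: rep_homs_def a_def J2_t_def dest: bspec[of _ _ "(1,0)"])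
  have "t (u (0, 1)) = u (0, 0)"
    using u by (auto simp: rep_homs_def J2_t_def dest: bspec[of _ _ "(0,1)"])
  also have "\<dots> = \<zero>\<^bsub>V\<^esub>"
    using lin_maps_J2[OF ul, of "(0, 0)"] smult_l_null[OF uc] by simp
  finally have tta: "t (t a) = \<zero>\<^bsub>V\<^esub>" unfolding u2 .
  have tB: "t b \<in> B" if "b \<in> B" "t b \<noteq> \<zero>\<^bsub>V\<^esub>" for b
    using J that by (auto simp: jordan_basis_def)
  show ?thesis
  proof
    assume n: "u \<in> negligible_homs J2 J2_t V t"
    show "\<forall>k\<in>heads2 V t B. coord V B (u (1, 0)) k = 0"
    proof
      fix k assume "k \<in> heads2 V t B"
      then have k: "k \<in> B" "k \<notin> t ` B" "t k \<noteq> \<zero>\<^bsub>V\<^esub>" by (auto simp: heads2_def)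
      let ?v = "\<lambda>x. (coord V B x k, coord V B x (t k))"
      have v: "?v \<in> rep_homs V t J2 J2_t"
        using functional_coord[OF M B k(1)] functional_coord[OF M B tB[OF k(1,3)]]
          jordan_coord(2)[OF M t J _ k(1,2)] jordan_coord(1)[OF M t J _ k(1,3)]
        by (auto simp: rep_homs_def lin_maps_def functional_def J2_t_def)
      then have "endo_trace V (u \<circ> ?v) = 0" using n by (auto simp: negligible_homs_def)
      then have "coord V B a k + coord V B (t a) (t k) = 0"
        using trace_J2[OF M B ul, of ?v] v u2 by (auto simp: rep_homs_def a_def)
      then have "2 * coord V B a k = 0"
        using jordan_coord(1)[OF M t J a k(1,3)] by simp
      then show "coord V B (u (1, 0)) k = 0" using two by (simp add: a_def)
    qed
  next
    assume h: "\<forall>k\<in>heads2 V t B. coord V B (u (1, 0)) k = 0"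
    have "fst (v (u (1, 0))) + snd (v (u (0, 1))) = 0" if v: "v \<in> rep_homs V t J2 J2_t" for v
    proof -
      have vt: "v (t x) = (0, fst (v x))" if "x \<in> carrier V" for x
        using v that by (auto simp: rep_homs_def J2_t_def)
      have vl: "v \<in> lin_maps V J2" using v by (auto simp: rep_homs_def)
      have "fst (v a) = (\<Sum>b\<in>B. coord V B a b * fst (v b))"
        by (rule functional_expand[OF M B functional_fst_snd(1)[OF vl] a])
      also have "\<dots> = 0"
      proof (intro sum.neutral ballI)
        fix b assume b: "b \<in> B"
        consider "b \<in> t ` B" | "t b = \<zero>\<^bsub>V\<^esub>" | "t b \<noteq> \<zero>\<^bsub>V\<^esub>" "t (t b) \<noteq> \<zero>\<^bsub>V\<^esub>" | "b \<in> heads2 V t B"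
          using b by (auto simp: heads2_def)
        then show "coord V B a b * fst (v b) = 0"
        proof cases
          case 1 then show ?thesis using vt BV by auto
        next
          case 2
          have "snd (v \<zero>\<^bsub>V\<^esub>) = 0"
            by (rule functional_zero[OF M functional_fst_snd(2)[OF vl]])
          then show ?thesis using vt[of b] 2 b BV by auto
        next
          case 3
          have "coord V B a b = coord V B (t (t a)) (t (t b))"
            using jordan_coord(1)[OF M t J a b 3(1)]
              jordan_coord(1)[OF M t J ta tB[OF b 3(1)] 3(2)] by simp
          then show ?thesis using c0[OF tB[OF tB[OF b 3(1)] 3(2)]] tta by simp
        next
          case 4 then show ?thesis using h by (auto simp: a_def)
        qed
      qed
      finally have "fst (v a) = 0" .
      then show ?thesis using vt[OF a] u2 by (simp add: a_def[symmetric])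
    qed
    then show "u \<in> negligible_homs J2 J2_t V t"
      using u trace_J2[OF M B ul] by (auto simp: negligible_homs_def rep_homs_def)
  qed
qed

lemma block_homs:
  assumes V: "alpha3_rep V t" and k: "k \<in> carrier V"
  shows "t k = \<zero>\<^bsub>V\<^esub> \<Longrightarrow> (\<lambda>a. a \<odot>\<^bsub>V\<^esub> k) \<in> rep_homs J1 J1_t V t"
    and "t (t k) = \<zero>\<^bsub>V\<^esub> \<Longrightarrow>
      (\<lambda>a. fst a \<odot>\<^bsub>V\<^esub> k \<oplus>\<^bsub>V\<^esub> snd a \<odot>\<^bsub>V\<^esub> t k) \<in> rep_homs J2 J2_t V t"
proof -
  have M: "module scalars V" and t: "t \<in> lin_maps V V" using V by (auto simp: alpha3_rep_def)
  interpret module scalars V by fact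
  have cl: "r \<odot>\<^bsub>V\<^esub> x \<in> carrier V" if "x \<in> carrier V" for r x
    using smult_closed[of r x] that by simp
  have tk: "t k \<in> carrier V" using k t by (auto simp: lin_maps_def)
  have ts: "t (c \<odot>\<^bsub>V\<^esub> x) = c \<odot>\<^bsub>V\<^esub> t x" if "x \<in> carrier V" for c x
    using t that by (auto simp: lin_maps_def)
  have tp: "t (x \<oplus>\<^bsub>V\<^esub> y) = t x \<oplus>\<^bsub>V\<^esub> t y" if "x \<in> carrier V" "y \<in> carrier V" for x y
    using t that by (auto simp: lin_maps_def)
  have z: "0 \<odot>\<^bsub>V\<^esub> x = \<zero>\<^bsub>V\<^esub>" if "x \<in> carrier V" for x
    using smult_l_null[OF that] by simp
  have rz: "c \<odot>\<^bsub>V\<^esub> \<zero>\<^bsub>V\<^esub> = \<zero>\<^bsub>V\<^esub>" for c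
    using smult_r_null[of c] by simp
  have ld: "(c + c') \<odot>\<^bsub>V\<^esub> x = c \<odot>\<^bsub>V\<^esub> x \<oplus>\<^bsub>V\<^esub> c' \<odot>\<^bsub>V\<^esub> x" if "x \<in> carrier V" for c c' x
    using smult_l_distr[of c c' x] that by simp
  have as: "(c * c') \<odot>\<^bsub>V\<^esub> x = c \<odot>\<^bsub>V\<^esub> (c' \<odot>\<^bsub>V\<^esub> x)" if "x \<in> carrier V" for c c' x
    using smult_assoc1[of c c' x] that by simp
  have rd: "c \<odot>\<^bsub>V\<^esub> (x \<oplus>\<^bsub>V\<^esub> y) = c \<odot>\<^bsub>V\<^esub> x \<oplus>\<^bsub>V\<^esub> c \<odot>\<^bsub>V\<^esub> y" if "x \<in> carrier V" "y \<in> carrier V" for c x y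
    using smult_r_distr[of c x y] that by simp
  show "(\<lambda>a. a \<odot>\<^bsub>V\<^esub> k) \<in> rep_homs J1 J1_t V t" if "t k = \<zero>\<^bsub>V\<^esub>"
    using that k by (auto simp: rep_homs_def lin_maps_def J1_t_def cl ts z rz ld as)
  show "(\<lambda>a. fst a \<odot>\<^bsub>V\<^esub> k \<oplus>\<^bsub>V\<^esub> snd a \<odot>\<^bsub>V\<^esub> t k) \<in> rep_homs J2 J2_t V t" if "t (t k) = \<zero>\<^bsub>V\<^esub>"
    using that k tk
    by (auto simp: rep_homs_def lin_maps_def J2_t_def cl ts tp z rz ld as rd M.a_ac)
qed

section \<open>The two Cartan matrices\<close>

text \<open>Rows and columns are indexed by \<open>1, 2, \<dots>\<close> as usual; in the index types \<open>8\<close> and \<open>7\<close>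
  the last index is also denoted \<open>0\<close>.\<close>

definition cartan_e8 :: "int^8^8" where
  "cartan_e8 = vector
    [vector [ 2, 0,-1, 0, 0, 0, 0, 0],
     vector [ 0, 2, 0,-1, 0, 0, 0, 0],
     vector [-1, 0, 2,-1, 0, 0, 0, 0],
     vector [ 0,-1,-1, 2,-1, 0, 0, 0],
     vector [ 0, 0, 0,-1, 2,-1, 0, 0],
     vector [ 0, 0, 0, 0,-1, 2,-1, 0],
     vector [ 0, 0, 0, 0, 0,-1, 2,-1],
     vector [ 0, 0, 0, 0, 0, 0,-1, 2]]"

definition parity_e8 :: "8 \<Rightarrow> bit" where
  "parity_e8 i = 0"

definition cartan_g86 :: "int^7^7" where
  "cartan_g86 = vector
    [vector [ 2, 0,-1, 0, 0, 0, 0],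
     vector [ 0, 0,-1, 0, 0, 0, 0],
     vector [-1,-1, 2,-1, 0, 0, 0],
     vector [ 0, 0,-1, 2,-1, 0, 0],
     vector [ 0, 0, 0,-1, 2,-1, 0],
     vector [ 0, 0, 0, 0,-1, 2,-1],
     vector [ 0, 0, 0, 0, 0,-1, 2]]"

definition parity_g86 :: "7 \<Rightarrow> bit" where
  "parity_g86 i = (if i = 2 then 1 else 0)"

end

theory Submission
  imports Defs
begin

text \<open>
  The proof works with explicit models. Over the reduction modulo 3 of an even lattice with
  simply laced Cartan matrix, \<open>brk\<close> is the bracket given by a bimultiplicative sign \<open>eps\<close>; a
  perfectly paired, generated bracket of this kind satisfying the Cartan relations is the
  contragredient algebra, because a graded ideal meeting the Cartan part trivially vanishes.

  Let \<open>\<theta>\<close> be a simple root and \<open>D = ad e\<^sub>\<theta>\<close>. Grade the algebra by the pairing with \<open>\<theta>\<close>, that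
  is by the weights \<open>-2, \<dots>, 2\<close> of the \<open>sl\<^sub>2\<close> of \<open>\<theta>\<close>. In characteristic 3 the degrees \<open>\<plusminus>2\<close> together
  with \<open>h\<^sub>\<theta>\<close> make up a block \<open>J\<^sub>3\<close>, the degrees \<open>\<plusminus>1\<close> split into blocks \<open>J\<^sub>2\<close>, and a complement of \<open>h\<^sub>\<theta>\<close>
  in degree 0 is killed by \<open>D\<close>. So the semisimplification has the kernel of \<open>D\<close> in degree 0 as
  even part and degree \<open>-1\<close> as odd part, with \<open>[x, y] = [D x, y] - [x, D y]\<close>. This superalgebra is again generated and
  perfectly paired: its simple root vectors are those of the nodes other than \<open>\<theta>\<close>, the neighbour
  of \<open>\<theta>\<close> being odd, and the weights lose their \<open>\<theta>\<close>-coordinate.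
\<close>

section \<open>Quotients of nonassociative algebras\<close>

text \<open>\<open>contragredient\<close> is a quotient, by a greatest ideal, of a quotient of a
  free algebra, so nothing can be computed in it directly. The relations map the presented algebra
  onto a model. That the kernel is the greatest ideal rests on one fact about the presentation
  itself: its weight 0 part is no larger than the Cartan part. The triangular decomposition supplies
  it. The generators at the neighbour p of \<theta> are forced. The vector of -p has degree 1 and is
  lost, so its place is taken by the vector of -p - \<theta>, of degree -1. Its bracket with the
  vector of p is, up to sign, the Cartan element of 2p + \<theta>, and -(2p + \<theta>) is p -
  \<theta> modulo 3. This pairs with p to 2 + 1 = 3 = 0, whence the zero on the diagonal of the
  second matrix, and with \<theta> to -3 = 0, so that \<open>D\<close> kills it. The 240 roots are
  never listed: bounds on pairings, positivity and induction on height take the place of a list, and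
  the two explicit matrices are inspected only at the end.\<close>

locale nonassoc_algebra = module "scalars :: 'k::field ring" L
  for L :: "('k::field, 'v, 'z) module_scheme" (structure) +
  assumes mult_closed [simp]: "x \<in> carrier L \<Longrightarrow> y \<in> carrier L \<Longrightarrow> x \<otimes> y \<in> carrier L"
    and mult_add_left: "x \<in> carrier L \<Longrightarrow> y \<in> carrier L \<Longrightarrow> z \<in> carrier L \<Longrightarrow>
      (x \<oplus> y) \<otimes> z = x \<otimes> z \<oplus> y \<otimes> z"
    and mult_add_right: "x \<in> carrier L \<Longrightarrow> y \<in> carrier L \<Longrightarrow> z \<in> carrier L \<Longrightarrow>
      x \<otimes> (y \<oplus> z) = x \<otimes> y \<oplus> x \<otimes> z"
    and mult_smult_left: "x \<in> carrier L \<Longrightarrow> y \<in> carrier L \<Longrightarrow> (c \<odot> x) \<otimes> y = c \<odot> (x \<otimes> y)"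
    and mult_smult_right: "x \<in> carrier L \<Longrightarrow> y \<in> carrier L \<Longrightarrow> x \<otimes> (c \<odot> y) = c \<odot> (x \<otimes> y)"
begin

lemma scale_add_left: "x \<in> carrier L \<Longrightarrow> (a + b) \<odot> x = a \<odot> x \<oplus> b \<odot> x"
  using smult_l_distr[of a b x] by simp

lemma scale_add_right:
  "x \<in> carrier L \<Longrightarrow> y \<in> carrier L \<Longrightarrow> c \<odot> (x \<oplus> y) = c \<odot> x \<oplus> c \<odot> y"
  using smult_r_distr[of c x y] by simp

lemma scale_scale: "x \<in> carrier L \<Longrightarrow> (a * b) \<odot> x = a \<odot> (b \<odot> x)"
  using smult_assoc1[of a b x] by simp

lemma scale_one [simp]: "x \<in> carrier L \<Longrightarrow> 1 \<odot> x = x"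
  using smult_one[of x] by simp

lemma scale_zero_left [simp]: "x \<in> carrier L \<Longrightarrow> 0 \<odot> x = \<zero>"
  using smult_l_null[of x] by simp

lemma scale_zero_right [simp]: "c \<odot> \<zero> = \<zero>"
  using smult_r_null[of c] by simp

lemma scale_minus_one: "x \<in> carrier L \<Longrightarrow> (- 1) \<odot> x = \<ominus> x"
  using scale_add_left[of x 1 "-1"] M.minus_equality[of "(-1) \<odot> x" x]
  by (simp add: M.a_comm)

lemma mult_zero [simp]: "x \<in> carrier L \<Longrightarrow> x \<otimes> \<zero> = \<zero>" "x \<in> carrier L \<Longrightarrow> \<zero> \<otimes> x = \<zero>"
  using mult_smult_right[of x \<zero> 0] mult_smult_left[of \<zero> x 0] by simp_all

lemma scale_minus: "x \<in> carrier L \<Longrightarrow> c \<odot> (\<ominus> x) = \<ominus> (c \<odot> x)"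
  using scale_scale[of x c "-1"] scale_scale[of x "-1" c] by (simp add: scale_minus_one)

lemma ideal_props:
  assumes "bracket_ideal L I"
  shows "I \<subseteq> carrier L" "\<zero> \<in> I" "x \<in> I \<Longrightarrow> y \<in> I \<Longrightarrow> x \<oplus> y \<in> I"
    "x \<in> I \<Longrightarrow> \<ominus> x \<in> I" "x \<in> I \<Longrightarrow> c \<odot> x \<in> I"
    "x \<in> carrier L \<Longrightarrow> y \<in> I \<Longrightarrow> x \<otimes> y \<in> I" "x \<in> carrier L \<Longrightarrow> y \<in> I \<Longrightarrow> y \<otimes> x \<in> I"
    "x \<in> I \<Longrightarrow> y \<in> I \<Longrightarrow> x \<ominus> y \<in> I"
proof -
  have S: "submodule I scalars L" using assms by (simp add: bracket_ideal_def)
  interpret S: submodule I scalars L by fact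
  show c: "I \<subseteq> carrier L" and "\<zero> \<in> I" and a: "\<And>x y. x \<in> I \<Longrightarrow> y \<in> I \<Longrightarrow> x \<oplus> y \<in> I"
    using S.subset S.one_closed S.m_closed by auto
  show s: "x \<in> I \<Longrightarrow> c \<odot> x \<in> I" for x c using S.smult_closed[of c x] by simp
  show m: "x \<in> I \<Longrightarrow> \<ominus> x \<in> I" for x
  proof -
    assume x: "x \<in> I"
    then have "x \<in> carrier L" using c by auto
    then show "\<ominus> x \<in> I" using s[OF x, of "-1"] by (simp add: scale_minus_one)
  qed
  show "x \<in> carrier L \<Longrightarrow> y \<in> I \<Longrightarrow> x \<otimes> y \<in> I" "x \<in> carrier L \<Longrightarrow> y \<in> I \<Longrightarrow> y \<otimes> x \<in> I"
    using assms by (auto simp: bracket_ideal_def)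
  show "x \<in> I \<Longrightarrow> y \<in> I \<Longrightarrow> x \<ominus> y \<in> I" using a m by (simp add: a_minus_def)
qed

lemma submoduleI':
  assumes "I \<subseteq> carrier L" "\<zero> \<in> I" "\<And>x y. x \<in> I \<Longrightarrow> y \<in> I \<Longrightarrow> x \<oplus> y \<in> I"
    "\<And>c x. x \<in> I \<Longrightarrow> c \<odot> x \<in> I"
  shows "submodule I scalars L"
proof (rule submoduleI)
  show "\<ominus> a \<in> I" if "a \<in> I" for a
    using assms(1) assms(4)[OF that, of "-1"] that scale_minus_one[of a] by auto
qed (use assms in auto)

lemma lin_span_least:
  assumes "submodule W scalars L" "S \<subseteq> W"
  shows "lin_span L S \<subseteq> W"
  using assms by (auto simp: lin_span_def)

section \<open>Cosets of an ideal and their operations\<close>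

lemma coset_eq: "I +> x = (\<lambda>i. i \<oplus> x) ` I"
  by (auto simp: a_r_coset_def r_coset_def)

lemma mem_coset_iff:
  assumes I: "bracket_ideal L I" and x: "x \<in> carrier L"
  shows "y \<in> I +> x \<longleftrightarrow> y \<in> carrier L \<and> y \<ominus> x \<in> I"
proof
  assume "y \<in> I +> x"
  then obtain i where i: "i \<in> I" "y = i \<oplus> x" by (auto simp: coset_eq)
  then have "i \<in> carrier L" using ideal_props(1)[OF I] by auto
  moreover from this have "y \<ominus> x = i" using i x by (simp add: a_minus_def M.a_assoc M.r_neg)
  ultimately show "y \<in> carrier L \<and> y \<ominus> x \<in> I" using i x by simp
next
  assume y: "y \<in> carrier L \<and> y \<ominus> x \<in> I"
  then have "y = (y \<ominus> x) \<oplus> x" using x by (simp add: a_minus_def M.a_assoc M.l_neg)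
  then show "y \<in> I +> x" using y by (auto simp: coset_eq)
qed

lemma diff_in_ideal_trans:
  assumes I: "bracket_ideal L I" and "x \<in> carrier L" "y \<in> carrier L" "z \<in> carrier L"
    and "x \<ominus> y \<in> I" "y \<ominus> z \<in> I"
  shows "x \<ominus> z \<in> I"
proof -
  have "y \<ominus> z = y \<oplus> \<ominus> z" by (simp add: a_minus_def)
  have "(x \<ominus> y) \<oplus> (y \<ominus> z) = x \<ominus> z"
    using assms(2-4) by (simp add: a_minus_def M.a_assoc M.r_neg1)
  then show ?thesis using ideal_props(3)[OF I assms(5,6)] by simp
qed

lemma diff_in_ideal_sym:
  assumes I: "bracket_ideal L I" and "x \<in> carrier L" "y \<in> carrier L" and "x \<ominus> y \<in> I"
  shows "y \<ominus> x \<in> I"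
proof -
  have "\<ominus> (x \<ominus> y) = y \<ominus> x" using assms(2,3) by (simp add: a_minus_def M.minus_add M.a_comm)
  then show ?thesis using ideal_props(4)[OF I assms(4)] by simp
qed

lemma coset_eq_iff:
  assumes I: "bracket_ideal L I" and x: "x \<in> carrier L" and y: "y \<in> carrier L"
  shows "I +> x = I +> y \<longleftrightarrow> x \<ominus> y \<in> I"
proof
  assume "I +> x = I +> y"
  moreover have "x \<in> I +> x"
    using mem_coset_iff[OF I x] x ideal_props(2)[OF I] by (simp add: M.r_neg a_minus_def)
  ultimately show "x \<ominus> y \<in> I" using mem_coset_iff[OF I y] by simp
next
  assume *: "x \<ominus> y \<in> I"
  have **: "y \<ominus> x \<in> I" by (rule diff_in_ideal_sym[OF I x y *])
  show "I +> x = I +> y"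
  proof (rule Set.set_eqI)
    fix z
    show "z \<in> I +> x \<longleftrightarrow> z \<in> I +> y"
      using diff_in_ideal_trans[OF I _ x y _ *] diff_in_ideal_trans[OF I _ y x _ **] x y
      by (auto simp: mem_coset_iff[OF I])
  qed
qed

lemma coset_self: "bracket_ideal L I \<Longrightarrow> x \<in> carrier L \<Longrightarrow> x \<in> I +> x"
  using mem_coset_iff ideal_props(2) by (simp add: M.r_neg a_minus_def)

lemma coset_zero: "bracket_ideal L I \<Longrightarrow> I +> \<zero> = I"
  using ideal_props(1) by (force simp: coset_eq)

lemma coset_add:
  assumes I: "bracket_ideal L I" and x: "x \<in> carrier L" and y: "y \<in> carrier L"
  shows "set_add L (I +> x) (I +> y) = I +> (x \<oplus> y)"
proof -
  have c: "i \<in> I \<Longrightarrow> i \<in> carrier L" for i using ideal_props(1)[OF I] by auto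
  have e: "(i \<oplus> x) \<oplus> (j \<oplus> y) = (i \<oplus> j) \<oplus> (x \<oplus> y)" if "i \<in> I" "j \<in> I" for i j
    using c that x y by (simp add: M.a_ac)
  show ?thesis
  proof
    show "set_add L (I +> x) (I +> y) \<subseteq> I +> (x \<oplus> y)"
      using e ideal_props(3)[OF I] by (auto simp: set_add_def set_mult_def coset_eq)
    show "I +> (x \<oplus> y) \<subseteq> set_add L (I +> x) (I +> y)"
    proof
      fix z assume "z \<in> I +> (x \<oplus> y)"
      then obtain i where i: "i \<in> I" "z = i \<oplus> (x \<oplus> y)" by (auto simp: coset_eq)
      then have "z = (i \<oplus> x) \<oplus> (\<zero> \<oplus> y)" using c x y by (simp add: M.a_ac)
      then show "z \<in> set_add L (I +> x) (I +> y)"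
        using i ideal_props(2)[OF I] by (auto simp: set_add_def set_mult_def coset_eq)
    qed
  qed
qed

text \<open>\<open>rcoset_mult\<close> is a union over all pairs of representatives. It collapses to
  one coset because \<open>(i + x)(j + y)\<close> and \<open>xy\<close> differ by
  \<open>ij + iy + xj\<close>, which lies in the two-sided ideal.\<close>

lemma coset_mult:
  assumes I: "bracket_ideal L I" and x: "x \<in> carrier L" and y: "y \<in> carrier L"
  shows "rcoset_mult L I (I +> x) (I +> y) = I +> (x \<otimes> y)"
proof -
  have c: "i \<in> I \<Longrightarrow> i \<in> carrier L" for i using ideal_props(1)[OF I] by auto
  have "I +> (a \<otimes> b) = I +> (x \<otimes> y)" if "a \<in> I +> x" "b \<in> I +> y" for a b
  proof -
    obtain i j where ij: "i \<in> I" "j \<in> I" "a = i \<oplus> x" "b = j \<oplus> y" using \<open>a \<in> _\<close> \<open>b \<in> _\<close> by (auto simp: coset_eq)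
    note cc = c[OF ij(1)] c[OF ij(2)]
    have "a \<otimes> b = (i \<otimes> j \<oplus> i \<otimes> y \<oplus> x \<otimes> j) \<oplus> (x \<otimes> y)"
      using ij cc x y by (simp add: mult_add_left mult_add_right M.a_ac)
    moreover have "i \<otimes> j \<oplus> i \<otimes> y \<oplus> x \<otimes> j \<in> I"
      using ij cc x y by (intro ideal_props(3)[OF I] ideal_props(6)[OF I] ideal_props(7)[OF I]) auto
    ultimately have "a \<otimes> b \<ominus> x \<otimes> y \<in> I"
      using ideal_props(1)[OF I] x y cc by (simp add: a_minus_def M.a_assoc M.r_neg subset_iff)
    then show ?thesis using coset_eq_iff[OF I] x y cc ij by simp
  qed
  moreover have "x \<in> I +> x" "y \<in> I +> y" using coset_self[OF I] x y by auto
  ultimately show ?thesis unfolding rcoset_mult_def by blast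
qed

lemma coset_scale:
  assumes I: "bracket_ideal L I" and x: "x \<in> carrier L"
  shows "(\<Union>a\<in>I +> x. I +> (c \<odot> a)) = I +> (c \<odot> x)"
proof -
  have "I +> (c \<odot> a) = I +> (c \<odot> x)" if "a \<in> I +> x" for a
  proof -
    from that have a: "a \<in> carrier L" "a \<ominus> x \<in> I" using mem_coset_iff[OF I x] by auto
    then have "c \<odot> a \<ominus> c \<odot> x \<in> I"
      using ideal_props(5)[OF I a(2), of c] x by (simp add: scale_add_right scale_minus a_minus_def)
    then show ?thesis using coset_eq_iff[OF I] a x by simp
  qed
  then show ?thesis using coset_self[OF I x] by blast
qed

end

locale super_nonassoc_algebra = nonassoc_algebra L
  for L :: "('k::field, 'v, 'z) superalgebra_scheme" (structure) +
  assumes part_closed: "part L p \<subseteq> carrier L"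
begin

abbreviation "Q I \<equiv> quotient_superalgebra L I"

lemma quotient_carrier: "carrier (Q I) = (\<lambda>x. I +> x) ` carrier L"
  by (auto simp: quotient_superalgebra_def A_RCOSETS_def RCOSETS_def a_r_coset_def)

lemma quotient_part: "part (Q I) p = (\<lambda>x. I +> x) ` part L p"
  by (simp add: quotient_superalgebra_def)

lemma quotient_ops:
  assumes I: "bracket_ideal L I"
  shows "x \<in> carrier L \<Longrightarrow> y \<in> carrier L \<Longrightarrow> (I +> x) \<oplus>\<^bsub>Q I\<^esub> (I +> y) = I +> (x \<oplus> y)"
    "x \<in> carrier L \<Longrightarrow> y \<in> carrier L \<Longrightarrow> (I +> x) \<otimes>\<^bsub>Q I\<^esub> (I +> y) = I +> (x \<otimes> y)"
    "x \<in> carrier L \<Longrightarrow> c \<odot>\<^bsub>Q I\<^esub> (I +> x) = I +> (c \<odot> x)"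
    "\<zero>\<^bsub>Q I\<^esub> = I +> \<zero>"
  using coset_add[OF I] coset_mult[OF I] coset_scale[OF I] coset_zero[OF I]
  by (simp_all add: quotient_superalgebra_def)

lemma quotient_super:
  assumes I: "bracket_ideal L I"
  shows "super_nonassoc_algebra (Q I)"
proof -
  note ops = quotient_ops[OF I]
  have ab: "abelian_group (Q I)"
  proof (rule abelian_groupI)
    fix x assume "x \<in> carrier (Q I)"
    then obtain a where "a \<in> carrier L" "x = I +> a" by (auto simp: quotient_carrier)
    then show "\<exists>y\<in>carrier (Q I). y \<oplus>\<^bsub>Q I\<^esub> x = \<zero>\<^bsub>Q I\<^esub>"
      by (intro bexI[of _ "I +> (\<ominus> a)"]) (auto simp: ops quotient_carrier M.l_neg)
  qed (auto simp: quotient_carrier ops M.a_ac)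
  have mod: "module scalars (Q I)"
  proof (rule moduleI)
    show "cring scalars" by (rule cring_from_type_algebra)
  qed (use ab in \<open>auto simp: quotient_carrier ops scale_add_left scale_add_right scale_scale\<close>)
  show ?thesis
    unfolding super_nonassoc_algebra_def nonassoc_algebra_def
      nonassoc_algebra_axioms_def super_nonassoc_algebra_axioms_def
    using mod part_closed
    by (auto simp: quotient_carrier quotient_part ops mult_add_left mult_add_right mult_smult_left mult_smult_right)
qed

end

text \<open>The map on cosets is obtained by choosing a representative with \<open>SOME\<close>;
  vanishing of \<open>u\<close> on the ideal makes the value independent of the choice.\<close>

lemma quotient_hom:
  fixes L :: "('k::field, 'v, 'z) superalgebra_scheme" and M :: "('k, 'w, 'y) superalgebra_scheme"
  assumes L: "super_nonassoc_algebra L" and M: "nonassoc_algebra M"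
    and I: "bracket_ideal L I"
    and u: "u \<in> lin_maps L M"
    and um: "\<And>x y. x \<in> carrier L \<Longrightarrow> y \<in> carrier L \<Longrightarrow> u (x \<otimes>\<^bsub>L\<^esub> y) = u x \<otimes>\<^bsub>M\<^esub> u y"
    and ui: "\<And>x. x \<in> I \<Longrightarrow> u x = \<zero>\<^bsub>M\<^esub>"
  obtains v where "\<And>x. x \<in> carrier L \<Longrightarrow> v (I +>\<^bsub>L\<^esub> x) = u x"
    "v \<in> lin_maps (quotient_superalgebra L I) M"
    "\<And>x y. x \<in> carrier (quotient_superalgebra L I) \<Longrightarrow> y \<in> carrier (quotient_superalgebra L I) \<Longrightarrow>
       v (x \<otimes>\<^bsub>quotient_superalgebra L I\<^esub> y) = v x \<otimes>\<^bsub>M\<^esub> v y"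
proof -
  interpret L: super_nonassoc_algebra L by fact
  interpret M: nonassoc_algebra M by fact
  have ucl: "x \<in> carrier L \<Longrightarrow> u x \<in> carrier M" for x using u by (auto simp: lin_maps_def)
  have uadd: "x \<in> carrier L \<Longrightarrow> y \<in> carrier L \<Longrightarrow> u (x \<oplus>\<^bsub>L\<^esub> y) = u x \<oplus>\<^bsub>M\<^esub> u y" for x y
    using u by (auto simp: lin_maps_def)
  have usc: "x \<in> carrier L \<Longrightarrow> u (c \<odot>\<^bsub>L\<^esub> x) = c \<odot>\<^bsub>M\<^esub> u x" for c x
    using u by (auto simp: lin_maps_def)
  define v where "v C = u (SOME x. x \<in> C)" for C
  have vx: "v (I +>\<^bsub>L\<^esub> x) = u x" if x: "x \<in> carrier L" for x
  proof -
    have "(SOME y. y \<in> I +>\<^bsub>L\<^esub> x) \<in> I +>\<^bsub>L\<^esub> x" using L.coset_self[OF I x] by (rule someI)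
    then obtain i where i: "i \<in> I" "(SOME y. y \<in> I +>\<^bsub>L\<^esub> x) = i \<oplus>\<^bsub>L\<^esub> x"
      by (auto simp: L.coset_eq)
    then show ?thesis
      unfolding v_def using ui[OF i(1)] ucl x uadd[of i x] L.ideal_props(1)[OF I] by auto
  qed
  note ops = L.quotient_ops[OF I]
  show ?thesis
  proof (rule that[of v])
    show "v \<in> lin_maps (quotient_superalgebra L I) M"
      unfolding lin_maps_def by (auto simp: L.quotient_carrier ops vx ucl uadd usc)
    show "v (x \<otimes>\<^bsub>quotient_superalgebra L I\<^esub> y) = v x \<otimes>\<^bsub>M\<^esub> v y"
      if "x \<in> carrier (quotient_superalgebra L I)" "y \<in> carrier (quotient_superalgebra L I)" for x y
      using that by (auto simp: L.quotient_carrier ops vx um)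
  qed (rule vx)
qed

lemma kernel_ideal:
  fixes L :: "('k::field, 'v, 'z) module_scheme" and M :: "('k, 'w, 'y) module_scheme"
  assumes L: "nonassoc_algebra L" and M: "nonassoc_algebra M"
    and u: "u \<in> lin_maps L M"
    and um: "\<And>x y. x \<in> carrier L \<Longrightarrow> y \<in> carrier L \<Longrightarrow> u (x \<otimes>\<^bsub>L\<^esub> y) = u x \<otimes>\<^bsub>M\<^esub> u y"
  shows "bracket_ideal L {x \<in> carrier L. u x = \<zero>\<^bsub>M\<^esub>}"
proof -
  interpret L: nonassoc_algebra L by fact
  interpret M: nonassoc_algebra M by fact
  have ucl: "x \<in> carrier L \<Longrightarrow> u x \<in> carrier M" for x using u by (auto simp: lin_maps_def)
  have uadd: "x \<in> carrier L \<Longrightarrow> y \<in> carrier L \<Longrightarrow> u (x \<oplus>\<^bsub>L\<^esub> y) = u x \<oplus>\<^bsub>M\<^esub> u y" for x y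
    using u by (auto simp: lin_maps_def)
  have usc: "x \<in> carrier L \<Longrightarrow> u (c \<odot>\<^bsub>L\<^esub> x) = c \<odot>\<^bsub>M\<^esub> u x" for c x
    using u by (auto simp: lin_maps_def)
  have u0: "u \<zero>\<^bsub>L\<^esub> = \<zero>\<^bsub>M\<^esub>"
    using usc[of "\<zero>\<^bsub>L\<^esub>" 0] ucl[of "\<zero>\<^bsub>L\<^esub>"] by simp
  show ?thesis
    unfolding bracket_ideal_def
  proof
    show "submodule {x \<in> carrier L. u x = \<zero>\<^bsub>M\<^esub>} scalars L"
      by (rule L.submoduleI') (auto simp: u0 uadd usc)
  qed (auto simp: um ucl)
qed

text \<open>The first isomorphism theorem, with the parts carried along. The ideal enters as a name
  equal to the kernel, since for the semisimplification it is given as a product of spaces of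
  negligible morphisms.\<close>

lemma quotient_iso:
  fixes L :: "('k::field, 'v, 'z) superalgebra_scheme" and M :: "('k, 'w, 'y) superalgebra_scheme"
  assumes L: "super_nonassoc_algebra L" and M: "nonassoc_algebra M"
    and u: "u \<in> lin_maps L M"
    and um: "\<And>x y. x \<in> carrier L \<Longrightarrow> y \<in> carrier L \<Longrightarrow> u (x \<otimes>\<^bsub>L\<^esub> y) = u x \<otimes>\<^bsub>M\<^esub> u y"
    and I: "I = {x \<in> carrier L. u x = \<zero>\<^bsub>M\<^esub>}"
    and surj: "carrier M \<subseteq> u ` carrier L"
    and parts: "\<And>p. u ` part L p = part M p"
  obtains v where "\<And>x. x \<in> carrier L \<Longrightarrow> v (I +>\<^bsub>L\<^esub> x) = u x"
    "v \<in> lin_maps (quotient_superalgebra L I) M"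
    "\<And>x y. x \<in> carrier (quotient_superalgebra L I) \<Longrightarrow> y \<in> carrier (quotient_superalgebra L I) \<Longrightarrow>
       v (x \<otimes>\<^bsub>quotient_superalgebra L I\<^esub> y) = v x \<otimes>\<^bsub>M\<^esub> v y"
    "bij_betw v (carrier (quotient_superalgebra L I)) (carrier M)"
    "\<And>p. v ` part (quotient_superalgebra L I) p = part M p"
proof -
  interpret L: super_nonassoc_algebra L by fact
  interpret M: nonassoc_algebra M by fact
  have bi: "bracket_ideal L I"
    unfolding I by (rule kernel_ideal[OF L.nonassoc_algebra_axioms M u um])
  obtain v where v: "\<And>x. x \<in> carrier L \<Longrightarrow> v (I +>\<^bsub>L\<^esub> x) = u x"
    "v \<in> lin_maps (quotient_superalgebra L I) M"
    "\<And>x y. x \<in> carrier (quotient_superalgebra L I) \<Longrightarrow> y \<in> carrier (quotient_superalgebra L I) \<Longrightarrow>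
       v (x \<otimes>\<^bsub>quotient_superalgebra L I\<^esub> y) = v x \<otimes>\<^bsub>M\<^esub> v y"
    using quotient_hom[OF L M bi u um] I by auto
  have ucl: "x \<in> carrier L \<Longrightarrow> u x \<in> carrier M" for x using u by (auto simp: lin_maps_def)
  have uadd: "x \<in> carrier L \<Longrightarrow> y \<in> carrier L \<Longrightarrow> u (x \<oplus>\<^bsub>L\<^esub> y) = u x \<oplus>\<^bsub>M\<^esub> u y" for x y
    using u by (auto simp: lin_maps_def)
  have usc: "x \<in> carrier L \<Longrightarrow> u (c \<odot>\<^bsub>L\<^esub> x) = c \<odot>\<^bsub>M\<^esub> u x" for c x
    using u by (auto simp: lin_maps_def)
  have udiff: "u (x \<ominus>\<^bsub>L\<^esub> y) = u x \<ominus>\<^bsub>M\<^esub> u y" if "x \<in> carrier L" "y \<in> carrier L" for x y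
    using that uadd[of x "\<ominus>\<^bsub>L\<^esub> y"] usc[of y "-1"] ucl
    by (simp add: a_minus_def L.scale_minus_one M.scale_minus_one)
  show ?thesis
  proof (rule that[OF v])
    show "bij_betw v (carrier (quotient_superalgebra L I)) (carrier M)"
      unfolding bij_betw_def
    proof
      show "inj_on v (carrier (quotient_superalgebra L I))"
      proof (rule inj_onI, clarsimp simp: L.quotient_carrier v(1))
        fix x y assume xy: "x \<in> carrier L" "y \<in> carrier L" "u x = u y"
        then have "u (x \<ominus>\<^bsub>L\<^esub> y) = \<zero>\<^bsub>M\<^esub>"
          using udiff[OF xy(1,2)] ucl by (simp add: a_minus_def M.M.r_neg)
        then show "I +>\<^bsub>L\<^esub> x = I +>\<^bsub>L\<^esub> y"
          using xy L.coset_eq_iff[OF bi] I by (simp add: a_minus_def)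
      qed
      show "v ` carrier (quotient_superalgebra L I) = carrier M"
        using surj ucl by (auto simp: L.quotient_carrier v(1) image_image)
    qed
    show "v ` part (quotient_superalgebra L I) p = part M p" for p
    proof -
      have "v ` part (quotient_superalgebra L I) p = u ` part L p"
        using L.part_closed[of p] v(1) by (auto simp: L.quotient_part image_image subset_iff intro!: image_cong)
      then show ?thesis using parts by simp
    qed
  qed
qed

section \<open>The free nonassociative superalgebra\<close>

lemma lookup_free_scale [simp]:
  "Poly_Mapping.lookup (free_scale c a) w = c * Poly_Mapping.lookup a w"
  by (simp add: free_scale_def Poly_Mapping.map.rep_eq when_def)

interpretation free: vector_space free_scale
  by unfold_locales (auto intro!: poly_mapping_eqI simp: lookup_add algebra_simps)

text \<open>The sums in \<open>free_bracket\<close> run over supports, which change under the vector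
  space operations. Over a common larger finite set bilinearity can be checked term by term.\<close>

lemma free_bracket_superset:
  assumes "finite A" "finite B" "Poly_Mapping.keys a \<subseteq> A" "Poly_Mapping.keys b \<subseteq> B"
  shows "free_bracket a b = (\<Sum>v\<in>A. \<Sum>w\<in>B.
     Poly_Mapping.single (Br v w) (Poly_Mapping.lookup a v * Poly_Mapping.lookup b w))"
proof -
  have "free_bracket a b = (\<Sum>v\<in>Poly_Mapping.keys a. \<Sum>w\<in>B.
     Poly_Mapping.single (Br v w) (Poly_Mapping.lookup a v * Poly_Mapping.lookup b w))"
    unfolding free_bracket_def using assms
    by (intro sum.cong refl sum.mono_neutral_left) (auto simp: in_keys_iff)
  also have "\<dots> = (\<Sum>v\<in>A. \<Sum>w\<in>B.
     Poly_Mapping.single (Br v w) (Poly_Mapping.lookup a v * Poly_Mapping.lookup b w))"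
    using assms by (intro sum.mono_neutral_left) (auto simp: in_keys_iff)
  finally show ?thesis .
qed

lemma single_scale: "Poly_Mapping.single w (c * r) = free_scale c (Poly_Mapping.single w r)"
  by (rule poly_mapping_eqI) (simp add: lookup_single when_def)

lemma keys_free_scale: "Poly_Mapping.keys (free_scale c a) \<subseteq> Poly_Mapping.keys a"
  by (auto simp: in_keys_iff)

lemma free_bracket_bilinear:
  "free_bracket (a + b) c = free_bracket a c + free_bracket b c"
  "free_bracket c (a + b) = free_bracket c a + free_bracket c b"
  "free_bracket (free_scale r a) c = free_scale r (free_bracket a c)"
  "free_bracket c (free_scale r a) = free_scale r (free_bracket c a)"
proof -
  let ?A = "Poly_Mapping.keys a \<union> Poly_Mapping.keys b" and ?C = "Poly_Mapping.keys c"
  have k: "Poly_Mapping.keys (a + b) \<subseteq> ?A" by (rule Poly_Mapping.keys_add)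
  show "free_bracket (a + b) c = free_bracket a c + free_bracket b c"
    by (subst (1 2 3) free_bracket_superset[of ?A ?C])
      (use k in \<open>auto simp: lookup_add distrib_right single_add sum.distrib\<close>)
  show "free_bracket c (a + b) = free_bracket c a + free_bracket c b"
    by (subst (1 2 3) free_bracket_superset[of ?C ?A])
      (use k in \<open>auto simp: lookup_add distrib_left single_add sum.distrib\<close>)
  show "free_bracket (free_scale r a) c = free_scale r (free_bracket a c)"
    by (subst (1 2) free_bracket_superset[of ?A ?C])
      (use keys_free_scale[of r a] in \<open>auto simp: mult.assoc single_scale free.scale_sum_right\<close>)
  show "free_bracket c (free_scale r a) = free_scale r (free_bracket c a)"
    by (subst (1 2) free_bracket_superset[of ?C ?A])
      (use keys_free_scale[of r a] in \<open>auto simp: mult.left_commute single_scale free.scale_sum_right\<close>)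
qed

lemma free_superalgebra_simps [simp]:
  "carrier (free_superalgebra par) = UNIV" "x \<otimes>\<^bsub>free_superalgebra par\<^esub> y = free_bracket x y"
  "\<zero>\<^bsub>free_superalgebra par\<^esub> = 0" "x \<oplus>\<^bsub>free_superalgebra par\<^esub> y = x + y"
  "c \<odot>\<^bsub>free_superalgebra par\<^esub> x = free_scale c x" "part (free_superalgebra par) p = free_part par p"
  by (simp_all add: free_superalgebra_def)

lemma free_bracket_diff:
  "free_bracket (a - b) c = free_bracket a c - free_bracket b c"
  "free_bracket c (a - b) = free_bracket c a - free_bracket c b"
  using free_bracket_bilinear(1)[of "a - b" b c] free_bracket_bilinear(2)[of c "a - b" b]
  by (simp_all add: eq_diff_eq)

lemma free_bracket_zero [simp]: "free_bracket 0 c = 0" "free_bracket c 0 = 0"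
  using free_bracket_diff(1)[of 0 0 c] free_bracket_diff(2)[of c 0 0] by simp_all

lemma free_super: "super_nonassoc_algebra (free_superalgebra par :: ('k::field, 'x word \<Rightarrow>\<^sub>0 'k) superalgebra)"
proof -
  let ?F = "free_superalgebra par :: ('k::field, 'x word \<Rightarrow>\<^sub>0 'k) superalgebra"
  have ab: "abelian_group ?F"
  proof (rule abelian_groupI)
    fix x assume "x \<in> carrier ?F"
    show "\<exists>y\<in>carrier ?F. y \<oplus>\<^bsub>?F\<^esub> x = \<zero>\<^bsub>?F\<^esub>"
      by (rule bexI[of _ "- x"]) simp_all
  qed (simp_all add: add.assoc add.commute)
  have "module scalars ?F"
    by (rule moduleI)
      (use ab in \<open>auto intro: cring_from_type_algebra simp: free.scale_left_distrib free.scale_right_distrib\<close>)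
  then show ?thesis
    unfolding super_nonassoc_algebra_def nonassoc_algebra_def
      nonassoc_algebra_axioms_def super_nonassoc_algebra_axioms_def
    by (auto simp: free_bracket_bilinear)
qed

lemma free_minus [simp]: "x \<ominus>\<^bsub>free_superalgebra par\<^esub> y = x - y"
proof -
  interpret super_nonassoc_algebra "free_superalgebra par" by (rule free_super)
  have "\<ominus>\<^bsub>free_superalgebra par\<^esub> y = - y"
    using scale_minus_one[of y] by (simp add: free.scale_minus_left)
  then show ?thesis by (simp add: a_minus_def)
qed

lemma ideal_generated_ideal:
  assumes "nonassoc_algebra L" "S \<subseteq> carrier L"
  shows "bracket_ideal L (ideal_generated L S)" "S \<subseteq> ideal_generated L S"
proof -
  interpret nonassoc_algebra L by fact
  have c: "bracket_ideal L (carrier L)"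
    by (auto simp: bracket_ideal_def intro: submoduleI')
  \<comment> \<open>The whole carrier is an ideal containing \<open>S\<close>, so the intersection
    is taken over a nonempty family and stays inside the carrier.\<close>
  then have ne: "carrier L \<in> {I. bracket_ideal L I \<and> S \<subseteq> I}" using assms by auto
  show "S \<subseteq> ideal_generated L S" by (auto simp: ideal_generated_def)
  show "bracket_ideal L (ideal_generated L S)"
    unfolding bracket_ideal_def
  proof
    show "submodule (ideal_generated L S) scalars L"
      by (rule submoduleI')
        (use ne in \<open>auto simp: ideal_generated_def intro: ideal_props(2,3,5)\<close>)
  qed (auto simp: ideal_generated_def intro: ideal_props(6,7))
qed

abbreviation word_mon :: "'x word \<Rightarrow> ('x word \<Rightarrow>\<^sub>0 'k::field)" where
  "word_mon w \<equiv> Poly_Mapping.single w 1"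

lemma free_bracket_word: "free_bracket (word_mon v) (word_mon w) = word_mon (Br v w)"
  by (simp add: free_bracket_def)

lemma word_mon_part: "word_mon w \<in> free_part gr (word_degree gr w)"
  by (simp add: free_part_def)

lemma free_expand:
  assumes "finite A" "Poly_Mapping.keys a \<subseteq> A"
  shows "a = (\<Sum>w\<in>A. free_scale (Poly_Mapping.lookup a w) (word_mon w))"
proof (rule poly_mapping_eqI)
  fix v
  have "Poly_Mapping.lookup (\<Sum>w\<in>A. free_scale (Poly_Mapping.lookup a w) (word_mon w)) v =
      (\<Sum>w\<in>A. if w = v then Poly_Mapping.lookup a v else 0)"
    by (auto simp: lookup_sum lookup_single when_def intro!: sum.cong)
  also have "\<dots> = Poly_Mapping.lookup a v"
    using assms by (auto simp: in_keys_iff)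
  finally show "Poly_Mapping.lookup a v =
    Poly_Mapping.lookup (\<Sum>w\<in>A. free_scale (Poly_Mapping.lookup a w) (word_mon w)) v" by simp
qed

lemma free_part_span:
  assumes "a \<in> free_part gr d" "free.subspace T"
    and "\<And>w. word_degree gr w = d \<Longrightarrow> word_mon w \<in> T"
  shows "a \<in> T"
proof -
  have "(\<Sum>w\<in>Poly_Mapping.keys a. free_scale (Poly_Mapping.lookup a w) (word_mon w)) \<in> T"
    using assms by (intro free.subspace_sum free.subspace_scale) (auto simp: free_part_def)
  then show ?thesis using free_expand[of "Poly_Mapping.keys a" a] by simp
qed

section \<open>Triangular decomposition\<close>

lemma koszul_square [simp]: "koszul_sign p q * koszul_sign p q = 1"
  by (simp add: koszul_sign_def)

lemma koszul_zero [simp]: "koszul_sign 0 q = 1" "koszul_sign p 0 = 1"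
  by (simp_all add: koszul_sign_def)

locale cartan_presentation =
  fixes par :: "'n::finite \<Rightarrow> bit" and R :: "('k::field, 'n, 'h::ab_group_add) cartan_data"
begin

abbreviation "I \<equiv> cartan_ideal par R"

abbreviation "parity \<equiv> word_degree (gen_parity par :: ('n, 'h) cartan_gen \<Rightarrow> bit)"

section \<open>The defining ideal and its relators on words\<close>

lemma I_bracket_ideal: "bracket_ideal (free_superalgebra (gen_parity par)) I"
  and relators_in_I: "lie_super_relators (free_superalgebra (gen_parity par)) \<union> cartan_relators R \<subseteq> I"
proof -
  interpret super_nonassoc_algebra "free_superalgebra (gen_parity par) :: ('k, ('n, 'h) cartan_gen word \<Rightarrow>\<^sub>0 'k) superalgebra"
    by (rule free_super)
  show "bracket_ideal (free_superalgebra (gen_parity par)) I"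
    "lie_super_relators (free_superalgebra (gen_parity par)) \<union> cartan_relators R \<subseteq> I"
    unfolding cartan_ideal_def
    by (rule ideal_generated_ideal[OF nonassoc_algebra_axioms]; simp)+
qed

lemma I_subspace: "free.subspace I"
  and I_bracket: "a \<in> I \<Longrightarrow> free_bracket x a \<in> I" "a \<in> I \<Longrightarrow> free_bracket a x \<in> I"
proof -
  interpret super_nonassoc_algebra "free_superalgebra (gen_parity par) :: ('k, ('n, 'h) cartan_gen word \<Rightarrow>\<^sub>0 'k) superalgebra"
    by (rule free_super)
  note p = ideal_props[OF I_bracket_ideal, simplified]
  show "free.subspace I" using p by (auto simp: free.subspace_def)
  show "a \<in> I \<Longrightarrow> free_bracket x a \<in> I" "a \<in> I \<Longrightarrow> free_bracket a x \<in> I" using p by auto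
qed

lemmas I_closed = free.subspace_add[OF I_subspace] free.subspace_diff[OF I_subspace]
  free.subspace_neg[OF I_subspace] free.subspace_scale[OF I_subspace] free.subspace_0[OF I_subspace]

lemma I_cartan:
  "free_gen (H (v + w)) - (free_gen (H v) + free_gen (H w)) \<in> I"
  "free_gen (H (hscale R c v)) - free_scale c (free_gen (H v)) \<in> I"
  "free_bracket (free_gen (E i)) (free_gen (F j)) - (if i = j then free_gen (H (coroot R i)) else 0) \<in> I"
  "free_bracket (free_gen (H v)) (free_gen (E j)) - free_scale (root R j v) (free_gen (E j)) \<in> I"
  "free_bracket (free_gen (H v)) (free_gen (F j)) + free_scale (root R j v) (free_gen (F j)) \<in> I"
  "free_bracket (free_gen (H v)) (free_gen (H w)) \<in> I"
proof -
  have c: "cartan_relators R \<subseteq> I" using relators_in_I by simp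
  show "free_gen (H (v + w)) - (free_gen (H v) + free_gen (H w)) \<in> I"
    by (rule subsetD[OF c], unfold cartan_relators_def, rule UnI1, rule UnI1, rule UnI1, rule UnI1, rule UnI1, blast)
  show "free_gen (H (hscale R c v)) - free_scale c (free_gen (H v)) \<in> I"
    by (rule subsetD[OF c], unfold cartan_relators_def, rule UnI1, rule UnI1, rule UnI1, rule UnI1, rule UnI2, blast)
  show "free_bracket (free_gen (E i)) (free_gen (F j)) - (if i = j then free_gen (H (coroot R i)) else 0) \<in> I"
    by (rule subsetD[OF c], unfold cartan_relators_def, rule UnI1, rule UnI1, rule UnI1, rule UnI2, blast)
  show "free_bracket (free_gen (H v)) (free_gen (E j)) - free_scale (root R j v) (free_gen (E j)) \<in> I"
    by (rule subsetD[OF c], unfold cartan_relators_def, rule UnI1, rule UnI1, rule UnI2, blast)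
  show "free_bracket (free_gen (H v)) (free_gen (F j)) + free_scale (root R j v) (free_gen (F j)) \<in> I"
    by (rule subsetD[OF c], unfold cartan_relators_def, rule UnI1, rule UnI2, blast)
  show "free_bracket (free_gen (H v)) (free_gen (H w)) \<in> I"
    by (rule subsetD[OF c], unfold cartan_relators_def, rule UnI2, blast)
qed

lemma I_anti:
  "word_mon (Br v w) + free_scale (koszul_sign (parity v) (parity w)) (word_mon (Br w v)) \<in> I"
proof -
  have "free_bracket (word_mon v) (word_mon w) +
      free_scale (koszul_sign (parity v) (parity w)) (free_bracket (word_mon w) (word_mon v)) \<in>
    lie_super_relators (free_superalgebra (gen_parity par) :: ('k, ('n, 'h) cartan_gen word \<Rightarrow>\<^sub>0 'k) superalgebra)"
    using word_mon_part[of v "gen_parity par"] word_mon_part[of w "gen_parity par"]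
    unfolding lie_super_relators_def by (simp, blast)
  then show ?thesis using relators_in_I by (auto simp: free_bracket_word)
qed

lemma I_jacobi:
  "word_mon (Br u (Br v w)) - (word_mon (Br (Br u v) w) +
     free_scale (koszul_sign (parity u) (parity v)) (word_mon (Br v (Br u w)))) \<in> I"
proof -
  have "free_bracket (word_mon u) (free_bracket (word_mon v) (word_mon w)) -
     (free_bracket (free_bracket (word_mon u) (word_mon v)) (word_mon w) +
      free_scale (koszul_sign (parity u) (parity v))
        (free_bracket (word_mon v) (free_bracket (word_mon u) (word_mon w)))) \<in>
    lie_super_relators (free_superalgebra (gen_parity par) :: ('k, ('n, 'h) cartan_gen word \<Rightarrow>\<^sub>0 'k) superalgebra)"
    using word_mon_part[of u "gen_parity par"] word_mon_part[of v "gen_parity par"]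
      word_mon_part[of w "gen_parity par"]
    unfolding lie_super_relators_def by (simp, blast)
  then show ?thesis using relators_in_I by (auto simp: free_bracket_word)
qed

text \<open>The sign \<open>s\<close> is \<open>1\<close> for the generators \<open>e\<^sub>i\<close> and \<open>-1\<close> for the generators \<open>f\<^sub>i\<close>.\<close>

definition gen :: "int \<Rightarrow> 'n \<Rightarrow> ('n, 'h) cartan_gen" where
  "gen s i = (if s = 1 then E i else F i)"

section \<open>Words of one sign and the spans of given height\<close>

primrec pure :: "int \<Rightarrow> ('n, 'h) cartan_gen word \<Rightarrow> bool" where
  "pure s (Gen x) = (\<exists>i. x = gen s i)"
| "pure s (Br v w) = (pure s v \<and> pure s w)"

primrec len :: "('n, 'h) cartan_gen word \<Rightarrow> nat" where
  "len (Gen x) = 1"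
| "len (Br v w) = len v + len w"

lemma len_pos: "len w > 0"
  by (induction w) auto

definition layer_words :: "int \<Rightarrow> ('n, 'h) cartan_gen word set" where
  "layer_words k = (if k = 0 then range (Gen \<circ> H) else {w. pure (sgn k) w \<and> int (len w) = \<bar>k\<bar>})"

text \<open>The span is formed in the free algebra and contains the ideal, so membership expresses a
  statement about the quotient without passing to cosets.\<close>

definition layer :: "int \<Rightarrow> (('n, 'h) cartan_gen word \<Rightarrow>\<^sub>0 'k) set" where
  "layer k = free.span (I \<union> word_mon ` layer_words k)"

lemma layer_I: "a \<in> I \<Longrightarrow> a \<in> layer k"
  and layer_word: "w \<in> layer_words k \<Longrightarrow> word_mon w \<in> layer k"
  and layer_subspace: "free.subspace (layer k)"
  by (auto simp: layer_def intro: free.span_base)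

lemmas layer_closed = free.subspace_add[OF layer_subspace] free.subspace_diff[OF layer_subspace]
  free.subspace_neg[OF layer_subspace] free.subspace_scale[OF layer_subspace]

lemma layer_bracket_induct:
  assumes "y \<in> layer k"
    and "\<And>w. w \<in> layer_words k \<Longrightarrow> free_bracket x (word_mon w) \<in> layer j"
  shows "free_bracket x y \<in> layer j"
  using assms(1) unfolding layer_def[of k]
proof (induction rule: free.span_induct)
  case base
  show ?case
    using layer_subspace[of j] by (auto simp: free.subspace_def free_bracket_bilinear)
next
  case (step y)
  then show ?case using assms(2) layer_I I_bracket by auto
qed

lemma layer_bracket_induct':
  assumes "y \<in> layer k"
    and "\<And>w. w \<in> layer_words k \<Longrightarrow> free_bracket (word_mon w) x \<in> layer j"
  shows "free_bracket y x \<in> layer j"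
  using assms(1) unfolding layer_def[of k]
proof (induction rule: free.span_induct)
  case base
  show ?case
    using layer_subspace[of j] by (auto simp: free.subspace_def free_bracket_bilinear)
next
  case (step y)
  then show ?case using assms(2) layer_I I_bracket by auto
qed

lemma layer_swap_words:
  assumes "word_mon (Br v w) \<in> layer k"
  shows "word_mon (Br w v) \<in> layer k"
proof -
  let ?c = "koszul_sign (parity v) (parity w) :: 'k"
  have "free_scale ?c (word_mon (Br w v)) \<in> layer k"
    using free.subspace_diff[OF layer_subspace layer_I[OF I_anti[of v w]] assms] by simp
  then have "free_scale ?c (free_scale ?c (word_mon (Br w v))) \<in> layer k"
    by (rule layer_closed)
  then show ?thesis by simp
qed

lemma layer_swap:
  assumes "y \<in> layer k" and "\<And>w. w \<in> layer_words k \<Longrightarrow> word_mon (Br w v) \<in> layer j"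
  shows "free_bracket (word_mon v) y \<in> layer j"
  by (rule layer_bracket_induct[OF assms(1)])
    (simp add: free_bracket_word layer_swap_words[OF assms(2)])

lemma H_gen: "\<exists>c. word_mon (Br (Gen (H v)) (Gen (gen s j))) - free_scale c (word_mon (Gen (gen s j))) \<in> I"
proof (cases "s = 1")
  case True
  then show ?thesis
    using I_cartan(4)[of v j] by (auto simp: gen_def free_gen_def free_bracket_word)
next
  case False
  then show ?thesis
    using I_cartan(5)[of v j]
    by (auto simp: gen_def free_gen_def free_bracket_word intro!: exI[of _ "- root R j v"])
qed

text \<open>A Cartan generator acts modulo \<open>I\<close> as a derivation, without sign because it
  is even, and diagonally on the letters; hence a bracket is again an eigenvector and the
  eigenvalues add.\<close>

lemma H_pure: "pure s w \<Longrightarrow> \<exists>c. word_mon (Br (Gen (H v)) w) - free_scale c (word_mon w) \<in> I"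
proof (induction w)
  case (Gen x)
  then obtain i where "x = gen s i" by auto
  then show ?case using H_gen[of v s i] by simp
next
  case (Br w1 w2)
  obtain c1 c2 where c: "word_mon (Br (Gen (H v)) w1) - free_scale c1 (word_mon w1) \<in> I"
    "word_mon (Br (Gen (H v)) w2) - free_scale c2 (word_mon w2) \<in> I"
    using Br.IH Br.prems by (metis pure.simps(2))
  have 1: "word_mon (Br (Br (Gen (H v)) w1) w2) - free_scale c1 (word_mon (Br w1 w2)) \<in> I"
    using I_bracket(2)[OF c(1), of "word_mon w2"]
    by (simp add: free_bracket_diff free_bracket_bilinear(3) free_bracket_word)
  have 2: "word_mon (Br w1 (Br (Gen (H v)) w2)) - free_scale c2 (word_mon (Br w1 w2)) \<in> I"
    using I_bracket(1)[OF c(2), of "word_mon w1"]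
    by (simp add: free_bracket_diff free_bracket_bilinear(4) free_bracket_word)
  have 3: "word_mon (Br (Gen (H v)) (Br w1 w2)) - (word_mon (Br (Br (Gen (H v)) w1) w2) +
      word_mon (Br w1 (Br (Gen (H v)) w2))) \<in> I"
    using I_jacobi[of "Gen (H v)" w1 w2] by simp
  have "word_mon (Br (Gen (H v)) (Br w1 w2)) - free_scale (c1 + c2) (word_mon (Br w1 w2)) \<in> I"
    using I_closed(1)[OF 3 I_closed(1)[OF 1 2]] by (simp add: free.scale_left_distrib algebra_simps)
  then show ?case by blast
qed

lemma H_layer: "y \<in> layer k \<Longrightarrow> free_bracket (word_mon (Gen (H v))) y \<in> layer k"
proof (erule layer_bracket_induct)
  fix w assume w: "w \<in> layer_words k"
  show "free_bracket (word_mon (Gen (H v))) (word_mon w) \<in> layer k"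
  proof (cases "k = 0")
    case True
    then obtain u where u: "w = Gen (H u)" using w by (auto simp: layer_words_def)
    show ?thesis using I_cartan(6)[of v u] by (auto simp: u free_gen_def intro: layer_I)
  next
    case False
    then have "pure (sgn k) w" using w by (simp add: layer_words_def)
    from H_pure[OF this] obtain c where
      c: "word_mon (Br (Gen (H v)) w) - free_scale c (word_mon w) \<in> I" by blast
    have "word_mon (Br (Gen (H v)) w) - free_scale c (word_mon w) + free_scale c (word_mon w) \<in> layer k"
      by (rule layer_closed(1)[OF layer_I[OF c] layer_closed(4)[OF layer_word[OF w]]])
    then show ?thesis by (simp add: free_bracket_word)
  qed
qed

lemma layer_words_pure:
  assumes "pure s w" "s \<in> {1, -1}"
  shows "w \<in> layer_words (s * int (len w))"
proof (cases "s = 1")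
  case True
  then show ?thesis using assms(1) len_pos[of w] unfolding layer_words_def by simp
next
  case False
  then have "s = -1" using assms(2) by simp
  then show ?thesis using assms(1) len_pos[of w] unfolding layer_words_def by simp
qed

lemma layer_words_cases [consumes 2, case_names H same opposite]:
  assumes "w \<in> layer_words k" "s \<in> {1, -1}" and
    "\<And>v. k = 0 \<Longrightarrow> w = Gen (H v) \<Longrightarrow> P" "pure s w \<Longrightarrow> k = s * int (len w) \<Longrightarrow> P"
    "pure (- s) w \<Longrightarrow> k = - s * int (len w) \<Longrightarrow> P"
  shows P
proof (cases k "0::int" rule: linorder_cases)
  case equal
  then have "w \<in> range (Gen \<circ> H)" using assms(1) unfolding layer_words_def by simp
  then show ?thesis using assms(3)[OF equal] unfolding image_iff comp_def by (elim bexE)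
next
  case greater
  then have w: "pure 1 w" "k = int (len w)" using assms(1) unfolding layer_words_def by simp_all
  show ?thesis
  proof (cases "s = 1")
    case True
    then show ?thesis using assms(4) w by simp
  next
    case False
    then have "- s = 1" using assms(2) by simp
    then show ?thesis using assms(5) w by simp
  qed
next
  case less
  then have w: "pure (-1) w" "k = - int (len w)" using assms(1) unfolding layer_words_def by simp_all
  show ?thesis
  proof (cases "s = 1")
    case True
    then show ?thesis using assms(5) w by simp
  next
    case False
    then have "s = - 1" using assms(2) by simp
    then show ?thesis using assms(4) w by simp
  qed
qed

text \<open>With \<open>s * k \<ge> 0\<close> the words spanning \<open>layer k\<close> modulo
  \<open>I\<close> are Cartan generators or have the sign of \<open>w\<close>, so the bracket never
  has to cancel an \<open>e\<close> against an \<open>f\<close>.\<close>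

lemma layer_pure_right:
  assumes y: "y \<in> layer k" and s: "s \<in> {1, -1}" and k: "s * k \<ge> 0" and w: "pure s w"
  shows "free_bracket (word_mon w) y \<in> layer (k + s * int (len w))"
    and "free_bracket y (word_mon w) \<in> layer (k + s * int (len w))"
proof -
  have *: "word_mon (Br u w) \<in> layer (k + s * int (len w))" if u: "u \<in> layer_words k" for u
    using u s
  proof (cases rule: layer_words_cases)
    case (H v)
    then show ?thesis
      using H_layer[OF layer_word[OF layer_words_pure[OF w s]], of v] by (simp add: free_bracket_word)
  next
    case same
    then show ?thesis
      using layer_word[OF layer_words_pure[of s "Br u w"]] w s by (simp add: algebra_simps)
  next
    case opposite
    then show ?thesis using k s len_pos[of u] by auto
  qed
  show "free_bracket y (word_mon w) \<in> layer (k + s * int (len w))"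
    by (rule layer_bracket_induct'[OF y]) (simp add: free_bracket_word *)
  show "free_bracket (word_mon w) y \<in> layer (k + s * int (len w))"
    by (rule layer_swap[OF y *])
qed

lemma gen_opposite:
  assumes s: "s \<in> {1, -1}"
  shows "word_mon (Br (Gen (gen s i)) (Gen (gen (- s) j))) \<in> layer 0"
proof -
  have *: "word_mon (Br (Gen (E i)) (Gen (F j))) \<in> layer 0" for i j
  proof -
    note I_cartan(3)[of i j]
    moreover have "(if i = j then free_gen (H (coroot R i)) else 0) \<in> layer 0"
      using layer_I[OF I_closed(5)] layer_word[of "Gen (H (coroot R i))" 0]
      by (auto simp: layer_words_def free_gen_def)
    ultimately have "free_bracket (free_gen (E i)) (free_gen (F j)) -
        (if i = j then free_gen (H (coroot R i)) else 0) +
        (if i = j then free_gen (H (coroot R i)) else 0) \<in> layer 0"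
      by (intro layer_closed(1)[OF layer_I])
    then show ?thesis by (simp add: free_gen_def free_bracket_word)
  qed
  then show ?thesis using s layer_swap_words[OF *] by (auto simp: gen_def)
qed

text \<open>The Jacobi identity pushes the single generator of sign \<open>s\<close> into the word
  of sign \<open>- s\<close> until it meets one letter, where the bracket is a Cartan element or 0.
  Each intermediate bracket has degree 0 or of sign \<open>- s\<close>, where
  \<open>layer_pure_right\<close> applies.\<close>

lemma gen_pure_opposite:
  assumes s: "s \<in> {1, -1}" and w: "pure (- s) w"
  shows "word_mon (Br (Gen (gen s i)) w) \<in> layer (s - s * int (len w))"
  using w
proof (induction w)
  case (Gen x)
  then obtain j where "x = gen (- s) j" by auto
  then show ?case using gen_opposite[OF s, of i j] by simp
next
  case (Br w1 w2)
  let ?k = "s - s * int (len (Br w1 w2))"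
  let ?g = "Gen (gen s i)"
  have l: "s * (s - s * int (len w)) \<le> 0" for w
    using s len_pos[of w] by (elim insertE) simp_all
  have ms: "- s \<in> {1, -1}" using s by auto
  have "free_bracket (word_mon (Br ?g w1)) (word_mon w2) \<in> layer (s - s * int (len w1) + - s * int (len w2))"
    using Br.IH(1) Br.prems l[of w1] by (intro layer_pure_right(2)[OF _ ms]) simp_all
  then have 1: "word_mon (Br (Br ?g w1) w2) \<in> layer ?k"
    by (simp add: free_bracket_word algebra_simps)
  have "free_bracket (word_mon w1) (word_mon (Br ?g w2)) \<in> layer (s - s * int (len w2) + - s * int (len w1))"
    using Br.IH(2) Br.prems l[of w2] by (intro layer_pure_right(1)[OF _ ms]) simp_all
  then have 2: "word_mon (Br w1 (Br ?g w2)) \<in> layer ?k"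
    by (simp add: free_bracket_word algebra_simps)
  have "word_mon (Br ?g (Br w1 w2)) - (word_mon (Br (Br ?g w1) w2) +
     free_scale (koszul_sign (parity ?g) (parity w1)) (word_mon (Br w1 (Br ?g w2)))) +
     (word_mon (Br (Br ?g w1) w2) +
     free_scale (koszul_sign (parity ?g) (parity w1)) (word_mon (Br w1 (Br ?g w2)))) \<in> layer ?k"
    by (rule layer_closed(1)[OF layer_I[OF I_jacobi] layer_closed(1)[OF 1 layer_closed(4)[OF 2]]])
  then show ?case by simp
qed

lemma gen_layer:
  assumes s: "s \<in> {1, -1}" and y: "y \<in> layer k"
  shows "free_bracket (word_mon (Gen (gen s i))) y \<in> layer (k + s)"
  using y
proof (rule layer_bracket_induct)
  fix w assume w: "w \<in> layer_words k"
  have p: "pure s (Gen (gen s i))" by auto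
  show "free_bracket (word_mon (Gen (gen s i))) (word_mon w) \<in> layer (k + s)"
    using w s
  proof (cases rule: layer_words_cases)
    case (H v)
    then show ?thesis
      using layer_pure_right(1)[OF layer_word[OF w] s _ p] by simp
  next
    case same
    have "s * k \<ge> 0" using s unfolding same(2) by (elim insertE) simp_all
    then show ?thesis
      using layer_pure_right(1)[OF layer_word[OF w] s _ p] by simp
  next
    case opposite
    then show ?thesis
      using gen_pure_opposite[OF s opposite(1), of i] by (simp add: free_bracket_word algebra_simps)
  qed
qed

text \<open>By the Jacobi identity the action of a bracket of words is a signed commutator of the
  two actions, so the claim passes from letters to pure words.\<close>

lemma pure_layer:
  assumes s: "s \<in> {1, -1}" and w: "pure s w" and y: "y \<in> layer k"
  shows "free_bracket (word_mon w) y \<in> layer (k + s * int (len w))"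
  using w y
proof (induction w arbitrary: k y)
  case (Gen x)
  then obtain i where "x = gen s i" by auto
  then show ?case using gen_layer[OF s Gen.prems(2), of i] by simp
next
  case (Br w1 w2)
  show ?case
    using Br.prems(2)
  proof (rule layer_bracket_induct)
    fix u assume u: "u \<in> layer_words k"
    have 1: "word_mon (Br w1 (Br w2 u)) \<in> layer (k + s * int (len w2) + s * int (len w1))"
      using Br.IH(1)[OF _ Br.IH(2)[OF _ layer_word[OF u]]] Br.prems(1)
      by (simp add: free_bracket_word)
    have 2: "word_mon (Br w2 (Br w1 u)) \<in> layer (k + s * int (len w1) + s * int (len w2))"
      using Br.IH(2)[OF _ Br.IH(1)[OF _ layer_word[OF u]]] Br.prems(1)
      by (simp add: free_bracket_word)
    let ?k = "k + s * int (len (Br w1 w2))" and ?c = "koszul_sign (parity w1) (parity w2) :: 'k"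
    have "word_mon (Br w1 (Br w2 u)) - (word_mon (Br (Br w1 w2) u) + free_scale ?c (word_mon (Br w2 (Br w1 u)))) \<in> layer ?k"
      by (rule layer_I[OF I_jacobi])
    moreover have "word_mon (Br w1 (Br w2 u)) - free_scale ?c (word_mon (Br w2 (Br w1 u))) \<in> layer ?k"
      using layer_closed(2)[OF 1 layer_closed(4), of "word_mon (Br w2 (Br w1 u))" ?c] 2
      by (simp add: algebra_simps)
    ultimately have "(word_mon (Br w1 (Br w2 u)) - free_scale ?c (word_mon (Br w2 (Br w1 u)))) -
      (word_mon (Br w1 (Br w2 u)) - (word_mon (Br (Br w1 w2) u) + free_scale ?c (word_mon (Br w2 (Br w1 u))))) \<in> layer ?k"
      by (rule layer_closed(2)[rotated])
    then show "free_bracket (word_mon (Br w1 w2)) (word_mon u) \<in> layer ?k"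
      by (simp add: free_bracket_word)
  qed
qed

text \<open>This makes the sum of all layers closed under the bracket. As it contains the
  generators, it is everything: \<open>n_- + h + n_+\<close> exhausts the presented algebra.\<close>

lemma layer_bracket:
  assumes x: "x \<in> layer j" and y: "y \<in> layer k"
  shows "free_bracket x y \<in> layer (j + k)"
  using x
proof (rule layer_bracket_induct')
  fix w assume w: "w \<in> layer_words j"
  have o: "(1::int) \<in> {1, -1}" "(-1::int) \<in> {1, -1}" by auto
  show "free_bracket (word_mon w) y \<in> layer (j + k)"
    using w o(1)
  proof (cases rule: layer_words_cases)
    case (H v)
    then show ?thesis using H_layer[OF y] by simp
  next
    case same
    then show ?thesis using pure_layer[OF o(1) _ y] by (simp add: add.commute)
  next
    case opposite
    then show ?thesis using pure_layer[OF o(2) _ y] by (simp add: add.commute)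
  qed
qed

section \<open>Height, and the part of weight 0\<close>

definition height :: "int^'n \<Rightarrow> int" where
  "height d = (\<Sum>i\<in>UNIV. d $ i)"

lemma word_layer: "word_mon w \<in> layer (height (word_degree gen_weight w))"
proof (induction w)
  case (Gen x)
  have h: "height (axis i 1) = 1" "height (- axis i 1) = -1" "height 0 = 0" for i
    by (simp_all add: height_def axis_def sum_negf)
  show ?case
    by (cases x) (auto simp: h layer_words_def gen_def intro!: layer_word)
next
  case (Br v w)
  have "height (a + b) = height a + height b" for a b
    by (simp add: height_def sum.distrib)
  then show ?case using layer_bracket[OF Br] by (simp add: free_bracket_word)
qed

text \<open>The linearity relators merge any combination of Cartan generators into a single
  one.\<close>

lemma layer_zero:
  assumes "a \<in> layer 0"
  shows "\<exists>v. a - free_gen (H v) \<in> I"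
  using assms unfolding layer_def
proof (induction rule: free.span_induct)
  case base
  note r = I_cartan(1,2)
  \<comment> \<open>The relator for the sum \<open>0 + 0\<close> reduces to
    \<open>- free_gen (H 0)\<close>.\<close>
  have z: "- free_gen (H 0) \<in> I" using r(1)[of 0 0] by simp
  show ?case
    unfolding free.subspace_def mem_Collect_eq
  proof (intro conjI ballI allI impI)
    show "\<exists>v. 0 - free_gen (H v) \<in> I" using z by (intro exI[of _ 0]) simp
  next
    fix x y assume "x \<in> {a. \<exists>v. a - free_gen (H v) \<in> I}" "y \<in> {a. \<exists>v. a - free_gen (H v) \<in> I}"
    then obtain v w where "x - free_gen (H v) \<in> I" "y - free_gen (H w) \<in> I" by auto
    from I_closed(2)[OF I_closed(1)[OF this] r(1)[of v w]]
    have "x + y - free_gen (H (v + w)) \<in> I" by (simp add: algebra_simps)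
    then show "\<exists>v. x + y - free_gen (H v) \<in> I" by blast
  next
    fix c x assume "x \<in> {a. \<exists>v. a - free_gen (H v) \<in> I}"
    then obtain v where "x - free_gen (H v) \<in> I" by auto
    from I_closed(2)[OF I_closed(4)[OF this, of c] r(2)[of c v]]
    have "free_scale c x - free_gen (H (hscale R c v)) \<in> I"
      by (simp add: free.scale_right_diff_distrib)
    then show "\<exists>v. free_scale c x - free_gen (H v) \<in> I" by blast
  qed
next
  case (step x)
  have z: "free_gen (H 0) \<in> I"
    using I_closed(3)[OF I_cartan(1)[of 0 0]] by simp
  show ?case
  proof (cases "x \<in> I")
    case True
    then show ?thesis using I_closed(2)[OF True z] by blast
  next
    case False
    then obtain v where "x = free_gen (H v)" using step by (auto simp: layer_words_def free_gen_def)
    then show ?thesis using I_closed(5) by (intro exI[of _ v]) simp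
  qed
qed

text \<open>Weight 0 forces height 0, and there only Cartan generators are left. From this
  consequence of the triangular decomposition the maximality of the kernel of evaluation in a model
  is deduced.\<close>

lemma weight_zero:
  assumes "a \<in> free_part gen_weight 0"
  shows "\<exists>v. a - free_gen (H v) \<in> I"
proof (rule layer_zero, rule free_part_span[OF assms layer_subspace])
  show "word_mon w \<in> layer 0" if "word_degree gen_weight w = 0" for w :: "('n, 'h) cartan_gen word"
    using word_layer[of w] that by (simp add: height_def)
qed

end

section \<open>Models of contragredient superalgebras\<close>

locale vec_bracket =
  fixes brk :: "'k::field^'i::finite \<Rightarrow> 'k^'i \<Rightarrow> 'k^'i"
  assumes add_left: "brk (x + y) z = brk x z + brk y z"
    and add_right: "brk x (y + z) = brk x y + brk x z"
    and scale_left: "brk (c *s x) y = c *s brk x y"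
    and scale_right: "brk x (c *s y) = c *s brk x y"
begin

lemma zero_left [simp]: "brk 0 y = 0" and zero_right [simp]: "brk x 0 = 0"
  using scale_left[of 0 0 y] scale_right[of x 0 0] by simp_all

lemma minus_left [simp]: "brk (- x) y = - brk x y" and minus_right [simp]: "brk x (- y) = - brk x y"
  using scale_left[of "-1" x y] scale_right[of x "-1" y] by simp_all

lemma diff_left: "brk (x - y) z = brk x z - brk y z"
  and diff_right: "brk x (y - z) = brk x y - brk x z"
  using add_left[of x "- y" z] add_right[of x y "- z"] by simp_all

lemma sum_left: "brk (\<Sum>a\<in>A. u a) y = (\<Sum>a\<in>A. brk (u a) y)"
  by (induction A rule: infinite_finite_induct) (simp_all add: add_left)

lemma sum_right: "brk y (\<Sum>a\<in>A. u a) = (\<Sum>a\<in>A. brk y (u a))"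
  by (induction A rule: infinite_finite_induct) (simp_all add: add_right)

section \<open>Evaluation of the free algebra in a bracket on vectors\<close>

primrec word_eval :: "('x \<Rightarrow> 'k^'i) \<Rightarrow> 'x word \<Rightarrow> 'k^'i" where
  "word_eval g (Gen x) = g x"
| "word_eval g (Br v w) = brk (word_eval g v) (word_eval g w)"

definition lin_eval :: "('x \<Rightarrow> 'k^'i) \<Rightarrow> ('x word \<Rightarrow>\<^sub>0 'k) \<Rightarrow> 'k^'i" where
  "lin_eval g a = (\<Sum>w\<in>Poly_Mapping.keys a. Poly_Mapping.lookup a w *s word_eval g w)"

lemma lin_eval_superset:
  assumes "finite A" "Poly_Mapping.keys a \<subseteq> A"
  shows "lin_eval g a = (\<Sum>w\<in>A. Poly_Mapping.lookup a w *s word_eval g w)"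
  unfolding lin_eval_def using assms
  by (intro sum.mono_neutral_left) (auto simp: in_keys_iff)

lemma lin_eval_add: "lin_eval g (a + b) = lin_eval g a + lin_eval g b"
proof -
  let ?A = "Poly_Mapping.keys a \<union> Poly_Mapping.keys b"
  have "Poly_Mapping.keys (a + b) \<subseteq> ?A" by (rule Poly_Mapping.keys_add)
  then show ?thesis
    by (simp add: lin_eval_superset[of ?A] lookup_add vec.scale_left_distrib sum.distrib)
qed

lemma lin_eval_scale: "lin_eval g (free_scale c a) = c *s lin_eval g a"
proof -
  have "lin_eval g (free_scale c a) =
      (\<Sum>w\<in>Poly_Mapping.keys a. Poly_Mapping.lookup (free_scale c a) w *s word_eval g w)"
    by (rule lin_eval_superset) (simp_all add: keys_free_scale)
  then show ?thesis by (simp add: lin_eval_def vec.scale_sum_right)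
qed

lemma lin_eval_diff: "lin_eval g (a - b) = lin_eval g a - lin_eval g b"
  using lin_eval_add[of g "a - b" b] by (simp add: eq_diff_eq)

lemma lin_eval_sum: "lin_eval g (\<Sum>x\<in>A. u x) = (\<Sum>x\<in>A. lin_eval g (u x))"
  by (induction A rule: infinite_finite_induct) (simp_all add: lin_eval_add, simp_all add: lin_eval_def)

lemma lin_eval_word: "lin_eval g (word_mon w) = word_eval g w"
  by (simp add: lin_eval_def)

lemma lin_eval_single: "lin_eval g (Poly_Mapping.single w r) = r *s word_eval g w"
  by (cases "r = 0") (simp_all add: lin_eval_def)

lemma lin_eval_gen: "lin_eval g (free_gen x) = g x"
  by (simp add: free_gen_def lin_eval_word)

lemma lin_eval_bracket: "lin_eval g (free_bracket a b) = brk (lin_eval g a) (lin_eval g b)"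
proof -
  have "lin_eval g (free_bracket a b) = (\<Sum>v\<in>Poly_Mapping.keys a. \<Sum>w\<in>Poly_Mapping.keys b.
      (Poly_Mapping.lookup a v * Poly_Mapping.lookup b w) *s brk (word_eval g v) (word_eval g w))"
    by (simp add: free_bracket_def lin_eval_sum lin_eval_single)
  also have "\<dots> = brk (lin_eval g a) (lin_eval g b)"
    unfolding lin_eval_def sum_left
    by (simp add: sum_right scale_left scale_right vec.scale_sum_right mult.commute)
  finally show ?thesis .
qed

end

text \<open>Homogeneity is a condition on the support. The index type \<open>'d\<close> is
  arbitrary, so the same definition serves for parity, for weights in the root lattice and for the
  integer grading by a root.\<close>

definition graded_part :: "('k::zero^'i) set \<Rightarrow> ('i \<Rightarrow> 'd) \<Rightarrow> 'd \<Rightarrow> ('k^'i) set" where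
  "graded_part S gr d = {x \<in> S. \<forall>i. x $ i \<noteq> 0 \<longrightarrow> gr i = d}"

definition vec_superalgebra ::
  "('k::field^'i) set \<Rightarrow> ('k^'i \<Rightarrow> 'k^'i \<Rightarrow> 'k^'i) \<Rightarrow> ('i \<Rightarrow> bit) \<Rightarrow> ('k, 'k^'i) superalgebra" where
  "vec_superalgebra S brk ip = \<lparr>carrier = S, mult = brk, one = undefined, zero = 0, add = (+),
     smult = (*s), part = graded_part S ip\<rparr>"

lemma vec_superalgebra_simps [simp]:
  "carrier (vec_superalgebra S brk ip) = S" "x \<otimes>\<^bsub>vec_superalgebra S brk ip\<^esub> y = brk x y"
  "\<zero>\<^bsub>vec_superalgebra S brk ip\<^esub> = 0" "x \<oplus>\<^bsub>vec_superalgebra S brk ip\<^esub> y = x + y"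
  "c \<odot>\<^bsub>vec_superalgebra S brk ip\<^esub> x = c *s x"
  "part (vec_superalgebra S brk ip) p = graded_part S ip p"
  by (simp_all add: vec_superalgebra_def)

lemma (in vec_bracket) vec_super:
  assumes S: "vec.subspace S" and c: "\<And>x y. x \<in> S \<Longrightarrow> y \<in> S \<Longrightarrow> brk x y \<in> S"
  shows "super_nonassoc_algebra (vec_superalgebra S brk ip)"
proof -
  let ?M = "vec_superalgebra S brk ip"
  have cl: "x \<in> S \<Longrightarrow> y \<in> S \<Longrightarrow> x + y \<in> S" "x \<in> S \<Longrightarrow> c *s x \<in> S" "x \<in> S \<Longrightarrow> - x \<in> S" "0 \<in> S"
    for x y c
    using S by (auto simp: vec.subspace_add vec.subspace_scale vec.subspace_neg vec.subspace_0)
  have ab: "abelian_group ?M"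
  proof (rule abelian_groupI)
    fix x assume "x \<in> carrier ?M"
    then show "\<exists>y\<in>carrier ?M. y \<oplus>\<^bsub>?M\<^esub> x = \<zero>\<^bsub>?M\<^esub>"
      by (intro bexI[of _ "- x"]) (simp_all add: cl)
  qed (simp_all add: cl add.assoc add.commute)
  have "module scalars ?M"
    by (rule moduleI)
      (use ab cl in \<open>auto intro: cring_from_type_algebra simp: vec.scale_left_distrib vec.scale_right_distrib\<close>)
  then show ?thesis
    unfolding super_nonassoc_algebra_def nonassoc_algebra_def
      nonassoc_algebra_axioms_def super_nonassoc_algebra_axioms_def
    by (simp add: c add_left add_right scale_left scale_right) (auto simp: graded_part_def)
qed

lemma graded_part_subspace: "vec.subspace S \<Longrightarrow> vec.subspace (graded_part S gr d)"
  unfolding vec.subspace_def graded_part_def by (auto, metis add.left_neutral)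

text \<open>What identifies an algebra as contragredient: it satisfies the relations, it is
  generated by the images of the generators (\<open>gen\<close>, stated as minimality among closed
  subspaces), the Cartan part embeds (\<open>hm_inj\<close>), and every nonzero vector of nonzero
  weight is brought to a nonzero vector of weight 0 by a single bracket (\<open>nondeg\<close>). The
  last two identify the kernel of evaluation as the greatest ideal.\<close>

locale cartan_model = cartan_presentation par R + vec_bracket brk
  for par :: "'n::finite \<Rightarrow> bit" and R :: "('k::field, 'n, 'h::ab_group_add) cartan_data"
    and brk :: "'k^'i::finite \<Rightarrow> 'k^'i \<Rightarrow> 'k^'i" +
  fixes S :: "('k^'i) set" and ip :: "'i \<Rightarrow> bit" and wt :: "'i \<Rightarrow> int^'n"
    and e f :: "'n \<Rightarrow> 'k^'i" and hm :: "'h \<Rightarrow> 'k^'i"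
  assumes S: "vec.subspace S"
    and ip_brk: "x \<in> graded_part S ip p \<Longrightarrow> y \<in> graded_part S ip q \<Longrightarrow> brk x y \<in> graded_part S ip (p + q)"
    and wt_brk: "x \<in> graded_part S wt d \<Longrightarrow> y \<in> graded_part S wt d' \<Longrightarrow> brk x y \<in> graded_part S wt (d + d')"
    and S_brk: "x \<in> S \<Longrightarrow> y \<in> S \<Longrightarrow> brk x y \<in> S"
    and anti: "x \<in> graded_part S ip p \<Longrightarrow> y \<in> graded_part S ip q \<Longrightarrow>
      brk x y + koszul_sign p q *s brk y x = 0"
    and jacobi: "x \<in> graded_part S ip p \<Longrightarrow> y \<in> graded_part S ip q \<Longrightarrow> z \<in> graded_part S ip r \<Longrightarrow>
      brk x (brk y z) = brk (brk x y) z + koszul_sign p q *s brk y (brk x z)"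
    and cube: "x \<in> graded_part S ip 1 \<Longrightarrow> brk x (brk x x) = 0"
    and e_part: "e i \<in> graded_part S ip (par i)" "e i \<in> graded_part S wt (axis i 1)"
    and f_part: "f i \<in> graded_part S ip (par i)" "f i \<in> graded_part S wt (- axis i 1)"
    and h_part: "hm v \<in> graded_part S ip 0" "hm v \<in> graded_part S wt 0"
    and hm_add: "hm (v + w) = hm v + hm w" and hm_scale: "hm (hscale R c v) = c *s hm v"
    and hm_inj: "hm v = 0 \<Longrightarrow> v = 0"
    and rel_ef: "brk (e i) (f j) = (if i = j then hm (coroot R i) else 0)"
    and rel_he: "brk (hm v) (e j) = root R j v *s e j"
    and rel_hf: "brk (hm v) (f j) = - (root R j v *s f j)"
    and rel_hh: "brk (hm v) (hm w) = 0"
    and gen: "vec.subspace T \<Longrightarrow> (\<And>x y. x \<in> T \<Longrightarrow> y \<in> T \<Longrightarrow> brk x y \<in> T) \<Longrightarrow>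
      (\<And>i. e i \<in> T) \<Longrightarrow> (\<And>i. f i \<in> T) \<Longrightarrow> (\<And>v. hm v \<in> T) \<Longrightarrow> S \<subseteq> T"
    and nondeg: "d \<noteq> 0 \<Longrightarrow> x \<in> graded_part S wt d \<Longrightarrow> x \<noteq> 0 \<Longrightarrow>
      \<exists>y\<in>graded_part S wt (- d). brk y x \<noteq> 0"
begin

abbreviation "M \<equiv> vec_superalgebra S brk ip"

abbreviation "FF \<equiv> free_superalgebra (gen_parity par) :: ('k, ('n, 'h) cartan_gen word \<Rightarrow>\<^sub>0 'k) superalgebra"

primrec gmap :: "('n, 'h) cartan_gen \<Rightarrow> 'k^'i" where
  "gmap (E i) = e i" | "gmap (F i) = f i" | "gmap (H v) = hm v"

abbreviation "ev \<equiv> lin_eval gmap"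

lemma M_super: "super_nonassoc_algebra M"
  using S S_brk by (rule vec_super)

lemma word_eval_part: "word_eval gmap w \<in> graded_part S ip (word_degree (gen_parity par) w)"
proof (induction w)
  case (Gen x)
  then show ?case using e_part f_part h_part by (cases x) auto
next
  case (Br v w)
  then show ?case using ip_brk[OF Br] by (simp only: word_eval.simps word_degree.simps)
qed

lemma word_eval_weight: "word_eval gmap w \<in> graded_part S wt (word_degree gen_weight w)"
proof (induction w)
  case (Gen x)
  then show ?case using e_part f_part h_part by (cases x) auto
qed (simp add: wt_brk)

lemma ev_graded:
  assumes g: "\<And>w. word_eval gmap w \<in> graded_part S gi (word_degree gr w)" and a: "a \<in> free_part gr d"
  shows "ev a \<in> graded_part S gi d"
  unfolding lin_eval_def
proof (rule vec.subspace_sum[OF graded_part_subspace[OF S]])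
  fix w assume "w \<in> Poly_Mapping.keys a"
  then have "word_degree gr w = d" using a by (simp add: free_part_def)
  then show "Poly_Mapping.lookup a w *s word_eval gmap w \<in> graded_part S gi d"
    using g[of w] by (intro vec.subspace_scale[OF graded_part_subspace[OF S]]) simp
qed

lemma ev_S: "ev a \<in> S"
  unfolding lin_eval_def using word_eval_part
  by (intro vec.subspace_sum[OF S] vec.subspace_scale[OF S]) (simp add: graded_part_def)

definition component ::
  "(('n, 'h) cartan_gen \<Rightarrow> 'd::monoid_add) \<Rightarrow> 'd \<Rightarrow> (('n, 'h) cartan_gen word \<Rightarrow>\<^sub>0 'k) \<Rightarrow>
    (('n, 'h) cartan_gen word \<Rightarrow>\<^sub>0 'k)" where
  "component gr d a = (\<Sum>w | w \<in> Poly_Mapping.keys a \<and> word_degree gr w = d.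
     free_scale (Poly_Mapping.lookup a w) (word_mon w))"

lemma free_part_subspace: "free.subspace (free_part gr d :: ('x word \<Rightarrow>\<^sub>0 'b::field) set)"
  unfolding free.subspace_def
proof (intro conjI ballI allI)
  show "0 \<in> free_part gr d" by (simp add: free_part_def)
  fix x y :: "'x word \<Rightarrow>\<^sub>0 'b" and c :: 'b
  assume x: "x \<in> free_part gr d"
  then show "free_scale c x \<in> free_part gr d"
    using keys_free_scale[of c x] unfolding free_part_def by blast
  assume "y \<in> free_part gr d"
  then show "x + y \<in> free_part gr d"
    using x Poly_Mapping.keys_add[of x y] unfolding free_part_def by blast
qed

lemma component_part: "component gr d a \<in> free_part gr d"
  unfolding component_def
proof (rule free.subspace_sum[OF free_part_subspace])
  fix w assume "w \<in> {w \<in> Poly_Mapping.keys a. word_degree gr w = d}"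
  then show "free_scale (Poly_Mapping.lookup a w) (word_mon w) \<in> free_part gr d"
    using word_mon_part[of w gr] by (intro free.subspace_scale[OF free_part_subspace]) simp
qed

lemma component_sum:
  "a = (\<Sum>d\<in>word_degree gr ` Poly_Mapping.keys a. component gr d a)"
proof -
  have "(\<Sum>w\<in>Poly_Mapping.keys a. free_scale (Poly_Mapping.lookup a w) (word_mon w)) =
      (\<Sum>d\<in>word_degree gr ` Poly_Mapping.keys a. component gr d a)"
    unfolding component_def by (rule sum.image_gen) simp
  then show ?thesis using free_expand[of "Poly_Mapping.keys a" a] by simp
qed

text \<open>Evaluation respects the grading word by word, so taking a component of \<open>a\<close>
  amounts to restricting the coordinates of its value. Hence the components of an element of the
  kernel lie in the kernel, and a homogeneous value that is attained has a homogeneous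
  preimage.\<close>

lemma ev_component:
  assumes g: "\<And>w. word_eval gmap w \<in> graded_part S gi (word_degree gr w)"
  shows "ev (component gr d a) $ i = (if gi i = d then ev a $ i else 0)"
proof -
  have z: "word_degree gr w = gi i" if "word_eval gmap w $ i \<noteq> 0" for w
    using g[of w] that by (auto simp: graded_part_def)
  have 1: "ev (component gr d a) $ i = (\<Sum>w | w \<in> Poly_Mapping.keys a \<and> word_degree gr w = d.
      Poly_Mapping.lookup a w * word_eval gmap w $ i)"
    by (simp add: component_def lin_eval_sum lin_eval_scale lin_eval_word)
  show ?thesis
  proof (cases "gi i = d")
    case True
    have "(\<Sum>w | w \<in> Poly_Mapping.keys a \<and> word_degree gr w = d.
        Poly_Mapping.lookup a w * word_eval gmap w $ i) =
      (\<Sum>w\<in>Poly_Mapping.keys a. Poly_Mapping.lookup a w * word_eval gmap w $ i)"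
      using z True by (intro sum.mono_neutral_left) auto
    then show ?thesis using 1 True by (simp add: lin_eval_def)
  next
    case False
    then have "(\<Sum>w | w \<in> Poly_Mapping.keys a \<and> word_degree gr w = d.
        Poly_Mapping.lookup a w * word_eval gmap w $ i) = 0"
      using z by (intro sum.neutral) auto
    then show ?thesis using 1 False by simp
  qed
qed

lemma ev_component_id:
  assumes "\<And>w. word_eval gmap w \<in> graded_part S gi (word_degree gr w)"
    and "ev a \<in> graded_part S gi d"
  shows "ev (component gr d a) = ev a"
  using assms(2) by (auto simp: vec_eq_iff ev_component[OF assms(1)] graded_part_def)

lemma ev_lin: "ev \<in> lin_maps FF M"
  unfolding lin_maps_def using ev_S by (simp add: lin_eval_add lin_eval_scale)

lemma ev_relators: "a \<in> lie_super_relators FF \<union> cartan_relators R \<Longrightarrow> ev a = 0"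
proof (erule UnE)
  note pt = ev_graded[OF word_eval_part]
  assume "a \<in> lie_super_relators FF"
  then consider
      (Anti) x y p q where "x \<in> free_part (gen_parity par) p" "y \<in> free_part (gen_parity par) q"
        "a = free_bracket x y + free_scale (koszul_sign p q) (free_bracket y x)"
    | (Jac) x y z p q r where "x \<in> free_part (gen_parity par) p" "y \<in> free_part (gen_parity par) q"
        "z \<in> free_part (gen_parity par) r"
        "a = free_bracket x (free_bracket y z) - (free_bracket (free_bracket x y) z +
          free_scale (koszul_sign p q) (free_bracket y (free_bracket x z)))"
    | (Cube) x where "x \<in> free_part (gen_parity par) 1" "a = free_bracket x (free_bracket x x)"
    unfolding lie_super_relators_def by (simp, blast)
  then show "ev a = 0"
  proof cases
    case Anti
    then show ?thesis
      using anti[OF pt[OF Anti(1)] pt[OF Anti(2)]] by (simp add: lin_eval_add lin_eval_scale lin_eval_bracket)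
  next
    case Jac
    then show ?thesis
      using jacobi[OF pt[OF Jac(1)] pt[OF Jac(2)] pt[OF Jac(3)]] by (simp add: lin_eval_add lin_eval_diff lin_eval_scale lin_eval_bracket)
  next
    case Cube
    then show ?thesis using cube[OF pt[OF Cube(1)]] by (simp add: lin_eval_bracket)
  qed
next
  have z: "lin_eval gmap 0 = 0" by (simp add: lin_eval_def)
  note s = lin_eval_add lin_eval_diff lin_eval_scale lin_eval_bracket lin_eval_gen
  assume "a \<in> cartan_relators R"
  then show "ev a = 0"
    unfolding cartan_relators_def
    by (elim UnE CollectE exE conjE)
      (simp_all add: s z hm_add hm_scale rel_ef rel_he rel_hf rel_hh)
qed

lemma I_kernel: "a \<in> I \<Longrightarrow> ev a = 0"
proof -
  have "bracket_ideal FF {a \<in> carrier FF. ev a = \<zero>\<^bsub>M\<^esub>}"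
    using free_super M_super ev_lin
    by (intro kernel_ideal) (auto simp: super_nonassoc_algebra_def lin_eval_bracket)
  then have "I \<subseteq> {a \<in> carrier FF. ev a = \<zero>\<^bsub>M\<^esub>}"
    unfolding cartan_ideal_def ideal_generated_def using ev_relators by (intro Inter_lower) auto
  then show "a \<in> I \<Longrightarrow> ev a = 0" by auto
qed

section \<open>The kernel of evaluation as the greatest ideal\<close>

abbreviation "G \<equiv> gtilde par R"

abbreviation cls :: "(('n, 'h) cartan_gen word \<Rightarrow>\<^sub>0 'k) \<Rightarrow> (('n, 'h) cartan_gen word \<Rightarrow>\<^sub>0 'k) set" where
  "cls \<equiv> gtilde_class par R"

lemma G_super: "super_nonassoc_algebra G"
  unfolding gtilde_def
  by (rule super_nonassoc_algebra.quotient_super[OF free_super I_bracket_ideal])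

lemma G_carrier: "carrier G = range cls"
  and G_part: "part G p = cls ` free_part (gen_parity par) p"
  and cls_add: "cls a \<oplus>\<^bsub>G\<^esub> cls b = cls (a + b)"
  and cls_mult: "cls a \<otimes>\<^bsub>G\<^esub> cls b = cls (free_bracket a b)"
  and cls_zero: "\<zero>\<^bsub>G\<^esub> = cls 0"
  and cls_eq: "cls a = cls b \<longleftrightarrow> a - b \<in> I"
proof -
  interpret F: super_nonassoc_algebra FF by (rule free_super)
  show "carrier G = range cls" "part G p = cls ` free_part (gen_parity par) p"
    by (simp_all add: gtilde_def F.quotient_carrier F.quotient_part gtilde_class_def)
  note ops = F.quotient_ops[OF I_bracket_ideal, simplified]
  show "cls a \<oplus>\<^bsub>G\<^esub> cls b = cls (a + b)" "cls a \<otimes>\<^bsub>G\<^esub> cls b = cls (free_bracket a b)"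
    "\<zero>\<^bsub>G\<^esub> = cls 0"
    by (simp_all only: gtilde_def gtilde_class_def ops)
  show "cls a = cls b \<longleftrightarrow> a - b \<in> I"
    using F.coset_eq_iff[OF I_bracket_ideal, of a b] by (simp add: gtilde_class_def)
qed

text \<open>The kernel \<open>K\<close> of evaluation on the presented algebra is graded and meets
  the Cartan part in 0. Conversely, let \<open>J\<close> be another such ideal. Its elements of
  weight 0 are Cartan elements, hence 0. If an element of another weight had nonzero value,
  \<open>nondeg\<close> would provide a bracket of weight 0, still in \<open>J\<close>, with nonzero
  value. So \<open>J\<close> lies in \<open>K\<close>.\<close>

theorem model_iso:
  obtains v where "v \<in> lin_maps (contragredient par R) M"
    "\<And>x y. x \<in> carrier (contragredient par R) \<Longrightarrow> y \<in> carrier (contragredient par R) \<Longrightarrow>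
       v (x \<otimes>\<^bsub>contragredient par R\<^esub> y) = brk (v x) (v y)"
    "bij_betw v (carrier (contragredient par R)) S"
    "\<And>p. v ` part (contragredient par R) p = graded_part S ip p"
    "\<And>i. contragredient_e par R i \<in> carrier (contragredient par R)"
    "\<And>i. v (contragredient_e par R i) = e i"
    "super_nonassoc_algebra (contragredient par R)"
proof -
  interpret M: super_nonassoc_algebra M by (rule M_super)
  interpret G: super_nonassoc_algebra G by (rule G_super)
  obtain u where u: "\<And>a. u (cls a) = ev a" "u \<in> lin_maps G M"
    "\<And>C C'. C \<in> carrier G \<Longrightarrow> C' \<in> carrier G \<Longrightarrow> u (C \<otimes>\<^bsub>G\<^esub> C') = brk (u C) (u C')"
    using quotient_hom[OF free_super M.nonassoc_algebra_axioms I_bracket_ideal ev_lin]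
    unfolding gtilde_def[symmetric] gtilde_class_def
    by (simp add: lin_eval_bracket I_kernel) blast
  define K where "K = {C \<in> carrier G. u C = \<zero>\<^bsub>M\<^esub>}"
  have K_ideal: "bracket_ideal G K"
    unfolding K_def
    by (rule kernel_ideal[OF G.nonassoc_algebra_axioms M.nonassoc_algebra_axioms u(2)]) (simp add: u(3))
  have K_cls: "cls a \<in> K \<longleftrightarrow> ev a = 0" for a
    by (simp add: K_def G_carrier u(1))
  have zero_ideal: "\<zero>\<^bsub>G\<^esub> \<in> J" if "bracket_ideal G J" for J
    using G.ideal_props(2)[OF that] .
  have surj: "S \<subseteq> range ev"
  proof (rule gen)
    show "vec.subspace (range ev)"
      unfolding vec.subspace_def
      by (auto simp: lin_eval_add[symmetric] lin_eval_scale[symmetric] intro!: range_eqI[of _ _ 0])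
        (simp add: lin_eval_def)
    show "brk x y \<in> range ev" if "x \<in> range ev" "y \<in> range ev" for x y
      using that by (auto simp: lin_eval_bracket[symmetric])
    show "e i \<in> range ev" "f i \<in> range ev" "hm v \<in> range ev" for i v
      using lin_eval_gen[of gmap "E i"] lin_eval_gen[of gmap "F i"] lin_eval_gen[of gmap "H v"]
      by (metis gmap.simps rangeI)+
  qed
  have graded: "graded_ideal par R K"
    unfolding graded_ideal_def
  proof (intro conjI K_ideal subset_antisym)
    show "lin_span G (\<Union>d. K \<inter> weight_space par R d) \<subseteq> K"
      using K_ideal by (intro G.lin_span_least) (auto simp: bracket_ideal_def)
    show "K \<subseteq> lin_span G (\<Union>d. K \<inter> weight_space par R d)"
      unfolding lin_span_def
    proof (intro subsetI InterI, clarify)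
      fix C W assume C: "C \<in> K" and W: "submodule W scalars G" "(\<Union>d. K \<inter> weight_space par R d) \<subseteq> W"
      obtain a where a: "C = cls a" using C by (auto simp: K_def G_carrier)
      have ea: "ev a = 0" using C K_cls a by simp
      have "ev (component gen_weight d a) = 0" for d
        using ea by (simp add: vec_eq_iff ev_component[OF word_eval_weight])
      then have "cls (component gen_weight d a) \<in> K \<inter> weight_space par R d" for d
        using component_part[of gen_weight d a] by (simp add: K_cls weight_space_def)
      then have comp: "cls (component gen_weight d a) \<in> W" for d
        using W(2) by blast
      interpret W: submodule W scalars G by (rule W(1))
      have W0: "cls 0 \<in> W" using W.one_closed by (simp add: cls_zero)
      have "cls (\<Sum>d\<in>D. component gen_weight d a) \<in> W" if "finite D" for D
        using that
      proof (induction D rule: finite_induct)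
        case empty
        then show ?case using W0 by simp
      next
        case (insert d D)
        have "cls (component gen_weight d a) \<oplus>\<^bsub>G\<^esub> cls (\<Sum>d\<in>D. component gen_weight d a) \<in> W"
          using W.m_closed[OF comp insert.IH] by simp
        then show ?case using insert by (simp add: cls_add)
      qed
      from this[of "word_degree gen_weight ` Poly_Mapping.keys a"]
      show "C \<in> W" unfolding a using component_sum[of a gen_weight] by simp
    qed
  qed
  have K_h: "K \<inter> htilde par R = {\<zero>\<^bsub>G\<^esub>}"
  proof
    show "K \<inter> htilde par R \<subseteq> {\<zero>\<^bsub>G\<^esub>}"
    proof
      fix C assume C: "C \<in> K \<inter> htilde par R"
      then obtain v where v: "C = cls (free_gen (H v))" by (auto simp: htilde_def)
      then have "hm v = 0" using C K_cls[of "free_gen (H v)"] by (simp add: lin_eval_gen)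
      then have "v = 0" by (rule hm_inj)
      moreover have "free_gen (H 0) - 0 \<in> I"
        using I_closed(3)[OF I_cartan(1)[of 0 0]] by simp
      ultimately show "C \<in> {\<zero>\<^bsub>G\<^esub>}" using v by (simp add: cls_zero cls_eq)
    qed
    have "cls (free_gen (H 0)) = cls 0"
      using I_closed(3)[OF I_cartan(1)[of 0 0]] by (simp add: cls_eq)
    then have "\<zero>\<^bsub>G\<^esub> \<in> htilde par R" by (simp add: htilde_def cls_zero image_iff) metis
    then show "{\<zero>\<^bsub>G\<^esub>} \<subseteq> K \<inter> htilde par R" using zero_ideal[OF K_ideal] by simp
  qed
  have maximal: "J \<subseteq> K" if J: "graded_ideal par R J" "J \<inter> htilde par R = {\<zero>\<^bsub>G\<^esub>}" for J
  proof -
    have Ji: "bracket_ideal G J" and Js: "J = lin_span G (\<Union>d. J \<inter> weight_space par R d)"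
      using J(1) by (auto simp: graded_ideal_def)
    have zero: "ev a = 0" if a: "cls a \<in> J" "a \<in> free_part gen_weight 0" for a
    proof -
      obtain v where v: "a - free_gen (H v) \<in> I" using weight_zero[OF a(2)] by blast
      then have "cls a \<in> htilde par R" by (auto simp: htilde_def cls_eq)
      then have "cls a = cls 0" using a(1) J(2) cls_zero by auto
      then show ?thesis using I_kernel by (simp add: cls_eq)
    qed
    have "C \<in> K" if C: "C \<in> J \<inter> weight_space par R d" for C d
    proof -
      obtain a where a: "C = cls a" "a \<in> free_part gen_weight d" using C by (auto simp: weight_space_def)
      have "ev a = 0"
      proof (cases "d = 0")
        case True
        then show ?thesis using zero C a by auto
      next
        case False
        show ?thesis
        proof (rule ccontr)
          assume n: "ev a \<noteq> 0"
          from nondeg[OF False ev_graded[OF word_eval_weight a(2)] n]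
          obtain y where y: "y \<in> graded_part S wt (- d)" "brk y (ev a) \<noteq> 0" by blast
          obtain b where b: "ev b = y"
            using y(1) surj by (auto simp: graded_part_def)
          \<comment> \<open>An arbitrary preimage of \<open>y\<close> may have components of other
            weights; cutting it down to weight \<open>- d\<close> keeps the value and puts the
            bracket with \<open>a\<close> in weight 0.\<close>
          define b' where "b' = component gen_weight (- d) b"
          have b': "ev b' = y" "b' \<in> free_part gen_weight (- d)"
            using ev_component_id[OF word_eval_weight, of b "- d"] b y(1) component_part
            by (auto simp: b'_def)
          have "cls (free_bracket b' a) \<in> J"
            using G.ideal_props(6)[OF Ji, of "cls b'" "cls a"] C a(1) by (simp add: cls_mult G_carrier)
          moreover have "free_bracket b' a \<in> free_part gen_weight 0"
          proof -
            have "word_degree gen_weight (Br v w) = 0"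
              if "v \<in> Poly_Mapping.keys b'" "w \<in> Poly_Mapping.keys a" for v w
              using that b'(2) a(2) by (simp add: free_part_def)
            then show ?thesis
              unfolding free_bracket_def
              by (intro free.subspace_sum[OF free_part_subspace]) (auto simp: free_part_def)
          qed
          ultimately have "ev (free_bracket b' a) = 0" by (rule zero)
          then show False using y(2) b'(1) by (simp add: lin_eval_bracket)
        qed
      qed
      then show ?thesis using a K_cls by simp
    qed
    then have "lin_span G (\<Union>d. J \<inter> weight_space par R d) \<subseteq> K"
      using K_ideal by (intro G.lin_span_least) (auto simp: bracket_ideal_def)
    then show ?thesis using Js by simp
  qed
  have max: "max_ideal par R = K"
    unfolding max_ideal_def using graded K_h maximal by (intro Greatest_equality) auto
  have parts: "u ` part G p = part M p" for p
  proof -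
    have "ev ` free_part (gen_parity par) p = graded_part S ip p"
    proof
      show "ev ` free_part (gen_parity par) p \<subseteq> graded_part S ip p"
        using ev_graded[OF word_eval_part] by auto
      show "graded_part S ip p \<subseteq> ev ` free_part (gen_parity par) p"
      proof
        fix x assume x: "x \<in> graded_part S ip p"
        then obtain a where "x = ev a" using surj by (auto simp: graded_part_def)
        then have "x = ev (component (gen_parity par) p a)"
          using ev_component_id[OF word_eval_part] x by simp
        then show "x \<in> ev ` free_part (gen_parity par) p" using component_part by blast
      qed
    qed
    then show ?thesis by (simp add: G_part image_image u(1))
  qed
  have surj': "carrier M \<subseteq> u ` carrier G"
    using surj by (simp add: G_carrier image_image u(1))
  obtain v where v: "\<And>C. C \<in> carrier G \<Longrightarrow> v (K +>\<^bsub>G\<^esub> C) = u C"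
    "v \<in> lin_maps (quotient_superalgebra G K) M"
    "\<And>x y. x \<in> carrier (quotient_superalgebra G K) \<Longrightarrow> y \<in> carrier (quotient_superalgebra G K) \<Longrightarrow>
       v (x \<otimes>\<^bsub>quotient_superalgebra G K\<^esub> y) = v x \<otimes>\<^bsub>M\<^esub> v y"
    "bij_betw v (carrier (quotient_superalgebra G K)) (carrier M)"
    "\<And>p. v ` part (quotient_superalgebra G K) p = part M p"
    by (rule quotient_iso[OF G_super M.nonassoc_algebra_axioms u(2) _ K_def surj' parts]) (auto simp: u(3))
  have c: "contragredient par R = quotient_superalgebra G K" by (simp add: contragredient_def max)
  have ce: "contragredient_e par R i = K +>\<^bsub>G\<^esub> cls (free_gen (E i))" for i
    by (simp add: contragredient_e_def max)
  show ?thesis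
  proof (rule that[of v])
    show "super_nonassoc_algebra (contragredient par R)"
      unfolding c by (rule G.quotient_super[OF K_ideal])
    show "contragredient_e par R i \<in> carrier (contragredient par R)" for i
      unfolding c ce by (simp add: G.quotient_carrier G_carrier)
    show "v (contragredient_e par R i) = e i" for i
      unfolding ce by (simp add: v(1) G_carrier u(1) lin_eval_gen)
  qed (use v(2-5) in \<open>simp_all add: c\<close>)
qed

end

no_notation fps_nth (infixl \<open>$\<close> 75)

section \<open>The Lie algebra of a simply laced lattice\<close>

locale even_lattice =
  fixes gram :: "int^'n::finite^'n"
  assumes pos_def: "v \<noteq> 0 \<Longrightarrow> (\<Sum>i\<in>UNIV. \<Sum>j\<in>UNIV. gram $ i $ j * v $ i * v $ j) > 0"
begin

text \<open>The number \<open>m v v\<close> is half the norm, so roots have value 1. The matrix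
  \<open>gram\<close> may be asymmetric, which allows the parity of \<open>m v w\<close> to carry
  the sign cocycle of the bracket.\<close>

definition m :: "int^'n \<Rightarrow> int^'n \<Rightarrow> int" where
  "m v w = (\<Sum>i\<in>UNIV. \<Sum>j\<in>UNIV. gram $ i $ j * v $ i * w $ j)"

definition pair :: "int^'n \<Rightarrow> int^'n \<Rightarrow> int" where
  "pair v w = m v w + m w v"

definition is_root :: "int^'n \<Rightarrow> bool" where
  "is_root v \<longleftrightarrow> m v v = 1"

lemma m_bilinear [simp]:
  "m (u + v) w = m u w + m v w" "m w (u + v) = m w u + m w v"
  "m (- v) w = - m v w" "m w (- v) = - m w v" "m 0 v = 0" "m v 0 = 0"
  "m (u - v) w = m u w - m v w" "m w (u - v) = m w u - m w v"
  by (simp_all add: m_def algebra_simps sum.distrib sum_negf sum_subtractf)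

lemma pair_bilinear [simp]:
  "pair (u + v) w = pair u w + pair v w" "pair w (u + v) = pair w u + pair w v"
  "pair (- v) w = - pair v w" "pair w (- v) = - pair w v" "pair 0 v = 0" "pair v 0 = 0"
  "pair (u - v) w = pair u w - pair v w" "pair w (u - v) = pair w u - pair w v"
  by (simp_all add: pair_def)

lemma pair_sym: "pair v w = pair w v"
  by (simp add: pair_def)

lemma m_pos: "v \<noteq> 0 \<Longrightarrow> m v v > 0"
  using pos_def[of v] by (simp add: m_def)

lemma m_nonneg: "m v v \<ge> 0"
  using m_pos[of v] by (cases "v = 0") auto

lemma m_triple: "m (c + c + c) (c + c + c) = 9 * m c c"
  unfolding m_bilinear by simp

section \<open>Pairings of roots and reduction modulo 3\<close>

lemma root_pair_self: "is_root v \<Longrightarrow> pair v v = 2"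
  by (simp add: is_root_def pair_def)

lemma root_nonzero: "is_root v \<Longrightarrow> v \<noteq> 0"
  by (auto simp: is_root_def)

lemma root_neg [simp]: "is_root (- v) \<longleftrightarrow> is_root v"
  by (simp add: is_root_def)

lemma root_sum_iff: "is_root v \<Longrightarrow> is_root w \<Longrightarrow> is_root (v + w) \<longleftrightarrow> pair v w = -1"
  by (auto simp: is_root_def pair_def)

lemma root_diff_iff: "is_root v \<Longrightarrow> is_root w \<Longrightarrow> is_root (v - w) \<longleftrightarrow> pair v w = 1"
  by (auto simp: is_root_def pair_def)

text \<open>At the sum and the difference of two roots the quadratic form takes the values
  \<open>2 + pair v w\<close> and \<open>2 - pair v w\<close>; both are nonnegative and vanish only
  if the argument does.\<close>

lemma root_pair_bounds:
  assumes "is_root v" "is_root w"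
  shows "-2 \<le> pair v w" "pair v w \<le> 2"
    "pair v w = 2 \<longleftrightarrow> v = w" "pair v w = -2 \<longleftrightarrow> w = - v"
proof -
  have 1: "m (v + w) (v + w) = 2 + pair v w" "m (v - w) (v - w) = 2 - pair v w"
    using assms by (simp_all add: is_root_def pair_def)
  show "-2 \<le> pair v w" "pair v w \<le> 2"
    using 1 m_nonneg[of "v + w"] m_nonneg[of "v - w"] by linarith+
  show "pair v w = 2 \<longleftrightarrow> v = w"
    using 1 m_pos[of "v - w"] root_pair_self[OF assms(1)] by fastforce
  have "pair v w = -2 \<Longrightarrow> v + w = 0"
    using 1 m_pos[of "v + w"] by fastforce
  then show "pair v w = -2 \<longleftrightarrow> w = - v"
    using root_pair_self[OF assms(1)] by (metis add.commute eq_neg_iff_add_eq_0 pair_bilinear(4))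
qed

lemma divisible_by_3:
  fixes v :: "int^'n"
  assumes "\<And>i. 3 dvd v $ i"
  obtains c where "v = c + c + c"
proof (rule that[of "\<chi> i. v $ i div 3"])
  show "v = (\<chi> i. v $ i div 3) + (\<chi> i. v $ i div 3) + (\<chi> i. v $ i div 3)"
    using assms by (auto simp: vec_eq_iff)
qed

text \<open>If all coordinates were divisible by 3, then \<open>v = c + c + c\<close> and
  \<open>m v v\<close> would be 9 times \<open>m c c\<close>.\<close>

lemma not_divisible_by_3:
  fixes v :: "int^'n"
  assumes "\<not> 9 dvd m v v"
  obtains i where "\<not> 3 dvd v $ i"
  using assms divisible_by_3[of v] m_triple by (metis dvd_triv_left)

text \<open>Reduction modulo 3 is injective on roots, since the difference of two roots has norm
  at most 4 with respect to \<open>m\<close>.\<close>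

lemma finite_roots: "finite {v. is_root v}"
proof -
  let ?r = "\<lambda>v::int^'n. (\<chi> i. v $ i mod 3)"
  have "inj_on ?r {v. is_root v}"
  proof (rule inj_onI, clarify)
    fix v w :: "int^'n" assume vw: "is_root v" "is_root w" "?r v = ?r w"
    have "(3::int) dvd (v - w) $ i" for i
      using vw(3) by (simp add: vec_eq_iff mod_eq_dvd_iff)
    then obtain c where c: "v - w = c + c + c" by (rule divisible_by_3)
    have "9 * m c c = m (v - w) (v - w)" unfolding c m_triple ..
    also have "\<dots> = 2 - pair v w" using vw by (simp add: is_root_def pair_def)
    finally have "m c c = 0" using root_pair_bounds(1)[OF vw(1,2)] m_nonneg[of c] by linarith
    then have "c = 0" using m_pos[of c] by fastforce
    then show "v = w" using c by simp
  qed
  moreover have "?r ` {v. is_root v} \<subseteq> vec_lambda ` (\<Pi>\<^sub>E i\<in>UNIV. {0..2})"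
  proof (clarify)
    fix v :: "int^'n"
    have "v $ i mod 3 \<le> 2" for i using pos_mod_bound[of 3 "v $ i"] by linarith
    then show "?r v \<in> vec_lambda ` (\<Pi>\<^sub>E i\<in>UNIV. {0..2})" by (intro imageI) (simp add: PiE_UNIV_domain)
  qed
  ultimately show ?thesis
    by (meson finite_imageD finite_subset finite_imageI finite_PiE finite finite_atLeastAtMost_int)
qed

end

text \<open>The roots are enumerated by a finite type \<open>'r\<close> so that a coordinate vector
  over \<open>'n + 'r\<close> can hold the Cartan part and one coordinate per root.\<close>

locale simply_laced = even_lattice gram
  for gram :: "int^'n::finite^'n" +
  fixes rt :: "'r::finite \<Rightarrow> int^'n"
  assumes rt_inj: "inj rt" and rt_range: "range rt = {v. is_root v}"
begin

lemma rt_root [simp]: "is_root (rt r)"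
  using rt_range by auto

text \<open>The sign of Frenkel and Kac: bimultiplicative, with value -1 at \<open>v, v\<close> for
  a root \<open>v\<close>, and changed by an exchange of the arguments precisely when
  \<open>pair v w\<close> is odd.\<close>

definition eps :: "int^'n \<Rightarrow> int^'n \<Rightarrow> 'k::field" where
  "eps v w = (if even (m v w) then 1 else -1)"

lemma eps_simps [simp]:
  "eps (u + v) w = eps u w * (eps v w :: 'k::field)" "eps w (u + v) = eps w u * (eps w v :: 'k)"
  "eps (- v) w = (eps v w :: 'k)" "eps w (- v) = (eps w v :: 'k)"
  "eps v w * eps v w = (1 :: 'k)" "eps v w * (eps v w * c) = (c :: 'k)"
  "eps v w \<noteq> (0 :: 'k)"
  by (auto simp: eps_def)

lemma eps_self: "is_root v \<Longrightarrow> eps v v = (-1 :: 'k::field)"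
  by (simp add: eps_def is_root_def)

lemma eps_swap: "eps w v = (if even (pair v w) then eps v w else - eps v w :: 'k::field)"
  by (auto simp: eps_def pair_def)

text \<open>The value 0 off the roots lets homogeneity and the action of the Cartan part be stated
  for every lattice vector.\<close>

definition evec :: "int^'n \<Rightarrow> 'k::field^('n + 'r)" where
  "evec v = (if is_root v then axis (Inr (inv_into UNIV rt v)) 1 else 0)"

definition hvec :: "'k::field^'n \<Rightarrow> 'k^('n + 'r)" where
  "hvec c = (\<chi> i. case i of Inl j \<Rightarrow> c $ j | Inr r \<Rightarrow> 0)"

definition red :: "int^'n \<Rightarrow> 'k::field^'n" where
  "red v = (\<chi> i. of_int (v $ i))"

text \<open>The value of the weight \<open>v\<close> on the Cartan element with coordinates
  \<open>c\<close>. Roots and coroots are identified through \<open>pair\<close>, as all roots have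
  norm 2.\<close>

definition hpair :: "'k::field^'n \<Rightarrow> int^'n \<Rightarrow> 'k" where
  "hpair c v = (\<Sum>i\<in>UNIV. c $ i * of_int (pair (axis i 1) v))"

text \<open>For opposite roots the sign comes from \<open>eps a (- a) = eps a a = -1\<close>: the
  bracket is minus the coroot. This is why the lowering generators are later taken to be
  \<open>- evec (- simple i)\<close>.\<close>

fun base_brk :: "'n + 'r \<Rightarrow> 'n + 'r \<Rightarrow> 'k::field^('n + 'r)" where
  "base_brk (Inl i) (Inl j) = 0"
| "base_brk (Inl i) (Inr b) = of_int (pair (axis i 1) (rt b)) *s axis (Inr b) 1"
| "base_brk (Inr a) (Inl j) = - (of_int (pair (axis j 1) (rt a)) *s axis (Inr a) 1)"
| "base_brk (Inr a) (Inr b) =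
    (if pair (rt a) (rt b) = -1 then eps (rt a) (rt b) *s evec (rt a + rt b)
     else if pair (rt a) (rt b) = -2 then - hvec (red (rt a)) else 0)"

definition brk :: "'k::field^('n + 'r) \<Rightarrow> 'k^('n + 'r) \<Rightarrow> 'k^('n + 'r)" where
  "brk x y = (\<Sum>i\<in>UNIV. \<Sum>j\<in>UNIV. (x $ i * y $ j) *s base_brk i j)"

sublocale vec_bracket brk
  by unfold_locales
    (simp_all add: brk_def distrib_right distrib_left vec.scale_left_distrib sum.distrib
      vec.scale_sum_right mult.assoc mult.left_commute)

lemma brk_axis: "brk (axis i 1) (axis j 1) = base_brk i j"
proof -
  have "brk (axis i 1) (axis j 1) =
      (\<Sum>i'\<in>UNIV. \<Sum>j'\<in>UNIV. if j = j' then (if i = i' then base_brk i' j' else 0) else 0)"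
    unfolding brk_def by (intro sum.cong refl) (simp add: axis_def)
  then show ?thesis by simp
qed

lemma evec_rt: "evec (rt r) = axis (Inr r) 1"
  by (simp add: evec_def rt_inj inv_f_f)

lemma root_rt: "is_root v \<Longrightarrow> \<exists>r. v = rt r"
  using rt_range by blast

lemma hvec_linear: "hvec (c + d) = hvec c + hvec d" "hvec (k *s c) = k *s hvec c" "hvec 0 = 0"
  "hvec (- c) = - hvec c" "hvec (c - d) = hvec c - hvec d"
  by (auto simp: hvec_def vec_eq_iff split: sum.splits)

lemma hvec_sum: "hvec (\<Sum>a\<in>A. u a) = (\<Sum>a\<in>A. hvec (u a))"
  by (induction A rule: infinite_finite_induct) (simp_all add: hvec_linear)

lemma red_linear: "red (v + w) = red v + red w" "red (- v) = - red v" "red 0 = 0" "red (v - w) = red v - red w"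
  by (auto simp: red_def vec_eq_iff)

lemma hvec_expand:
  fixes c :: "'k::field^'n"
  shows "hvec c = (\<Sum>i\<in>UNIV. c $ i *s axis (Inl i) 1)"
proof (rule vec_eq_iff[THEN iffD2], rule allI)
  fix k :: "'n + 'r"
  show "hvec c $ k = (\<Sum>i\<in>UNIV. c $ i *s axis (Inl i) 1) $ k"
  proof (cases k)
    case (Inl j)
    show ?thesis by (simp add: Inl hvec_def axis_def if_distrib cong: if_cong)
  qed (simp add: hvec_def axis_def)
qed

lemma vec_expand:
  fixes x :: "'k::field^('n + 'r)"
  shows "x = hvec (\<chi> i. x $ Inl i) + (\<Sum>r\<in>UNIV. x $ Inr r *s evec (rt r))"
proof (rule vec_eq_iff[THEN iffD2], rule allI)
  fix k :: "'n + 'r"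
  show "x $ k = (hvec (\<chi> i. x $ Inl i) + (\<Sum>r\<in>UNIV. x $ Inr r *s evec (rt r))) $ k"
  proof (cases k)
    case (Inr j)
    show ?thesis by (simp add: Inr hvec_def evec_rt axis_def if_distrib cong: if_cong)
  qed (simp add: hvec_def evec_rt axis_def)
qed

lemma vec_induct:
  assumes "vec.subspace T" "\<And>c. hvec c \<in> T" "\<And>v. is_root v \<Longrightarrow> evec v \<in> T"
  shows "x \<in> T"
  by (subst vec_expand)
    (intro vec.subspace_add[OF assms(1)] vec.subspace_sum[OF assms(1)] vec.subspace_scale[OF assms(1)]
      assms(2,3) rt_root)

lemma brk_hh: "brk (hvec c) (hvec d) = 0"
  by (simp add: hvec_expand sum_left sum_right scale_left scale_right brk_axis)

lemma brk_he: "brk (hvec c) (evec v) = hpair c v *s evec v"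
proof (cases "is_root v")
  case True
  then obtain r where r: "v = rt r" using root_rt by blast
  show ?thesis
    by (simp add: r evec_rt hvec_expand sum_left scale_left brk_axis hpair_def vec.scale_sum_left)
qed (simp add: evec_def)

lemma brk_eh: "brk (evec v) (hvec c) = - (hpair c v *s evec v)"
proof (cases "is_root v")
  case True
  then obtain r where r: "v = rt r" using root_rt by blast
  show ?thesis
    by (simp add: r evec_rt hvec_expand sum_right scale_right brk_axis hpair_def vec.scale_sum_left sum_negf)
qed (simp add: evec_def)

lemma brk_ee:
  assumes "is_root v" "is_root w"
  shows "brk (evec v) (evec w) = (if pair v w = -1 then eps v w *s evec (v + w)
     else if pair v w = -2 then - hvec (red v) else 0)"
  using assms[THEN root_rt] by (auto simp: evec_rt brk_axis)

lemma evec_nonroot: "\<not> is_root v \<Longrightarrow> evec v = 0"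
  by (simp add: evec_def)

lemma pair_expand:
  fixes v :: "int^'n"
  shows "pair v w = (\<Sum>i\<in>UNIV. v $ i * pair (axis i 1) w)"
proof -
  have a: "(\<Sum>i'\<in>UNIV. \<Sum>j\<in>UNIV. gram $ i' $ j * axis i 1 $ i' * w $ j) = (\<Sum>j\<in>UNIV. gram $ i $ j * w $ j)" for i
  proof -
    have "(\<Sum>i'\<in>UNIV. \<Sum>j\<in>UNIV. gram $ i' $ j * axis i 1 $ i' * w $ j) =
      (\<Sum>i'\<in>UNIV. if i = i' then (\<Sum>j\<in>UNIV. gram $ i' $ j * w $ j) else 0)"
      by (intro sum.cong refl) (simp add: axis_def)
    then show ?thesis by simp
  qed
  have b: "(\<Sum>i'\<in>UNIV. \<Sum>j\<in>UNIV. gram $ i' $ j * w $ i' * axis i 1 $ j) = (\<Sum>j\<in>UNIV. gram $ j $ i * w $ j)" for i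
  proof -
    have "(\<Sum>j\<in>UNIV. gram $ i' $ j * w $ i' * axis i 1 $ j) =
      (\<Sum>j\<in>UNIV. if i = j then gram $ i' $ j * w $ i' else 0)" for i'
      by (intro sum.cong refl) (simp add: axis_def)
    then show ?thesis by simp
  qed
  have "m v w = (\<Sum>i\<in>UNIV. v $ i * (\<Sum>j\<in>UNIV. gram $ i $ j * w $ j))"
    by (simp add: m_def sum_distrib_left algebra_simps)
  moreover have "m w v = (\<Sum>i\<in>UNIV. v $ i * (\<Sum>j\<in>UNIV. gram $ j $ i * w $ j))"
    unfolding m_def by (subst sum.swap) (simp add: sum_distrib_left algebra_simps)
  ultimately show ?thesis
    unfolding pair_def[of v] pair_def[of "axis _ 1"] by (simp add: m_def a b distrib_left sum.distrib)
qed

lemma hpair_red: "hpair (red v) w = of_int (pair v w)"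
  by (simp add: hpair_def red_def pair_expand[of v w])

lemma hpair_linear: "hpair c (v + w) = hpair c v + hpair c w" "hpair c (- v) = - hpair c v" "hpair c 0 = 0"
  "hpair (c + d) v = hpair c v + hpair d v" "hpair (k *s c) v = k * hpair c v"
  "hpair (- c) v = - hpair c v" "hpair c (v - w) = hpair c v - hpair c w"
  by (simp_all add: hpair_def algebra_simps sum.distrib sum_negf sum_distrib_left sum_subtractf)

section \<open>Antisymmetry and the Jacobi identity\<close>

lemma brk_anti: "brk x y = - brk y x"
proof -
  have 1: "base_brk i j = - (base_brk j i :: 'k::field^('n + 'r))" for i j
  proof (cases "(i, j)" rule: base_brk.cases)
    case (4 a b)
    have "rt b = - rt a" if "pair (rt a) (rt b) = -2"
      using root_pair_bounds(4)[of "rt a" "rt b"] that by simp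
    then show ?thesis
      using 4 by (auto simp: pair_sym[of "rt b"] eps_swap[of "rt a"] add.commute red_linear hvec_linear)
  qed auto
  have "brk x y = (\<Sum>j\<in>UNIV. \<Sum>i\<in>UNIV. (x $ i * y $ j) *s base_brk i j)"
    unfolding brk_def by (rule sum.swap)
  also have "\<dots> = - brk y x"
    unfolding brk_def sum_negf[symmetric]
    by (intro sum.cong refl) (subst 1, simp add: mult.commute)
  finally show ?thesis .
qed

text \<open>A closed form for double brackets of root vectors, with cases decided by pairings alone;
  the Jacobi identity for roots becomes a case distinction over it.\<close>

lemma brk_ee2:
  assumes "is_root a" "is_root b" "is_root c"
  shows "brk (evec a) (brk (evec b) (evec c)) =
    (if pair b c = -1 then
       (if pair a b + pair a c = -1 then (eps b c * eps a b * eps a c) *s evec (a + b + c)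
        else if pair a b + pair a c = -2 then - (eps b c *s hvec (red a)) else 0)
     else if pair b c = -2 then of_int (pair a b) *s evec a else 0)"
proof -
  have "is_root (b + c)" if "pair b c = -1" using that assms root_sum_iff by simp
  then show ?thesis
    using assms by (simp add: brk_ee scale_right brk_eh hpair_red pair_sym[of b a] add.assoc mult.assoc)
qed

definition cyc :: "'k::field^('n + 'r) \<Rightarrow> 'k^('n + 'r) \<Rightarrow> 'k^('n + 'r) \<Rightarrow> 'k^('n + 'r)" where
  "cyc x y z = brk x (brk y z) + brk y (brk z x) + brk z (brk x y)"

lemma cyc_rotate: "cyc x y z = cyc y z x"
  by (simp add: cyc_def algebra_simps)

lemma cyc_linear: "cyc (x + x') y z = cyc x y z + cyc x' y z" "cyc (c *s x) y z = c *s cyc x y z"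
  "cyc 0 y z = 0"
  by (simp_all add: cyc_def add_left add_right scale_left scale_right vec.scale_right_distrib add_ac)

text \<open>The inner bracket of an opposite pair is a Cartan element, so this case is settled
  separately, by the five possible values of \<open>pair a b\<close>.\<close>

lemma cyc_opposite:
  assumes a: "is_root a" and b: "is_root b"
  shows "cyc (evec a) (evec b) (evec (- b)) = (0 :: 'k::field^('n + 'r))"
proof -
  note [simp] = root_pair_self[OF a] root_pair_self[OF b]
  have q: "pair b (- b) = -2" by simp
  consider "pair a b = 0" | "pair a b = 1" | "pair a b = -1" | "pair a b = 2" | "pair a b = -2"
    using root_pair_bounds(1,2)[OF a b] by linarith
  then show ?thesis
  proof cases
    case 1
    then show ?thesis using a b by (simp add: cyc_def brk_ee2 pair_sym[of b a])
  next
    case 2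
    then show ?thesis using a b by (simp add: cyc_def brk_ee2 pair_sym[of b a] eps_self)
  next
    case 3
    then show ?thesis using a b
      by (simp add: cyc_def brk_ee2 pair_sym[of b a] eps_self eps_swap[of b a] mult.commute)
  next
    case 4
    then have "b = a" using root_pair_bounds(3)[OF a b] by simp
    then show ?thesis using a by (simp add: cyc_def brk_ee2)
  next
    case 5
    then have "b = - a" using root_pair_bounds(4)[OF a b] by simp
    then show ?thesis using a by (simp add: cyc_def brk_ee2)
  qed
qed

text \<open>If no two of the roots are opposite and no pairing is -1, all brackets vanish; otherwise
  rotation puts a pairing -1 at \<open>b, c\<close>. Then either three terms meet in the Cartan
  part, or two terms cancel by the sign rule, or every term vanishes.\<close>

lemma cyc_roots:
  assumes a: "is_root a" and b: "is_root b" and c: "is_root c"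
  shows "cyc (evec a) (evec b) (evec c) = (0 :: 'k::field^('n + 'r))"
proof -
  have main: "cyc (evec a) (evec b) (evec c) = (0 :: 'k::field^('n + 'r))"
    if r: "is_root a" "is_root b" "is_root c" and n: "pair a b > -2" "pair b c > -2" "pair c a > -2"
      and bc: "pair b c = -1" for a b c
  proof -
    consider "pair a b = -1" "pair c a = -1" | "pair a b = -1" "pair c a = 0" | "pair a b = 0" "pair c a = -1"
      | "pair a b + pair c a \<ge> 0"
      using n by linarith
    then show ?thesis
    proof cases
      case 1
      \<comment> \<open>Three pairings equal to -1 make the quadratic form vanish at the sum. The
        roots then add up to 0, the three terms carry the same sign, and together they give the
        Cartan element of \<open>a + b + c\<close> up to sign.\<close>
      have "m (a + b + c) (a + b + c) = 3 + (pair a b + pair b c + pair c a)"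
        using r by (simp add: is_root_def pair_def)
      then have "a + b + c = 0" using m_pos[of "a + b + c"] 1 bc by fastforce
      then have c: "c = - (a + b)" by (metis add.commute eq_neg_iff_add_eq_0)
      have s3: "eps a b = - (eps b a :: 'k)"
        using 1 eps_swap[of a b, where 'k='k] by (simp add: pair_sym[of b a])
      have s1: "eps b c = - (eps b a :: 'k)"
        unfolding c eps_simps(4) eps_simps(2) eps_self[OF r(2)] by simp
      have s2: "eps c a = - (eps b a :: 'k)"
        unfolding c eps_simps(3) eps_simps(1) eps_self[OF r(1)] by simp
      note s = s1 s2 s3
      have "hvec (red a) + hvec (red b) + hvec (red c) = (0 :: 'k^('n + 'r))"
        unfolding hvec_linear(1)[symmetric] red_linear(1)[symmetric] \<open>a + b + c = 0\<close>
        by (simp add: red_linear hvec_linear)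
      then have "eps b a *s (hvec (red a) + hvec (red b) + hvec (red c)) = (0 :: 'k^('n + 'r))" by simp
      then show ?thesis
        using r 1 bc by (simp add: cyc_def brk_ee2 pair_sym[of a c] pair_sym[of b a] pair_sym[of c b] s
            vec.scale_right_distrib)
    next
      case 2
      have "eps a c = (eps c a :: 'k)" "eps c b = - (eps b c :: 'k)"
        using 2 bc eps_swap[of a c, where 'k='k] eps_swap[of c b, where 'k='k] by (simp_all add: pair_sym)
      then show ?thesis
        using r 2 bc by (simp add: cyc_def brk_ee2 pair_sym[of a c] pair_sym[of b a] pair_sym[of c b] algebra_simps
            flip: vec.scale_left_distrib)
    next
      case 3
      have "eps b a = (eps a b :: 'k)" "eps c a = - (eps a c :: 'k)"
        using 3 bc eps_swap[of b a, where 'k='k] eps_swap[of c a, where 'k='k] by (simp_all add: pair_sym)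
      then show ?thesis
        using r 3 bc by (simp add: cyc_def brk_ee2 pair_sym[of a c] pair_sym[of b a] pair_sym[of c b] algebra_simps
            flip: vec.scale_left_distrib)
    next
      case 4
      then show ?thesis
        using r n bc by (simp add: cyc_def brk_ee2 pair_sym[of a c] pair_sym[of b a] pair_sym[of c b])
    qed
  qed
  have b': "pair a b \<ge> -2" "pair b c \<ge> -2" "pair c a \<ge> -2"
    using root_pair_bounds(1) a b c by blast+
  consider "pair b c = -2" | "pair c a = -2" | "pair a b = -2"
    | "pair a b > -2" "pair b c > -2" "pair c a > -2" using b' by linarith
  then show ?thesis
  proof cases
    case 1
    then have "c = - b" using root_pair_bounds(4)[OF b c] by simp
    then show ?thesis using cyc_opposite[OF a b] by simp
  next
    case 2
    then have "a = - c" using root_pair_bounds(4)[OF c a] by simp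
    then show ?thesis using cyc_opposite[OF b c] cyc_rotate by metis
  next
    case 3
    then have "b = - a" using root_pair_bounds(4)[OF a b] by simp
    then show ?thesis using cyc_opposite[OF c a] cyc_rotate by metis
  next
    case 4
    consider "pair b c = -1" | "pair c a = -1" | "pair a b = -1"
      | "pair b c \<ge> 0" "pair c a \<ge> 0" "pair a b \<ge> 0" using 4 by linarith
    then show ?thesis
    proof cases
      case 1
      then show ?thesis using main a b c 4 by blast
    next
      case 2
      then show ?thesis using main[of b c a] a b c 4 cyc_rotate by metis
    next
      case 3
      then show ?thesis using main[of c a b] a b c 4 cyc_rotate by metis
    next
      case 4
      then show ?thesis using a b c by (simp add: cyc_def brk_ee2)
    qed
  qed
qed

lemma cyc_hhe: "cyc (hvec c) (hvec d) (evec v) = 0"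
  by (simp add: cyc_def brk_he brk_eh brk_hh scale_right mult.commute)

lemma cyc_hee:
  assumes "is_root v" "is_root w"
  shows "cyc (hvec c) (evec v) (evec w) = (0 :: 'k::field^('n + 'r))"
proof -
  consider "pair v w = -1" | "pair v w = -2" "w = - v" | "pair v w \<noteq> -1" "pair v w \<noteq> -2"
    using root_pair_bounds(4)[OF assms] by blast
  then show ?thesis
  proof cases
    case 1
    then have "eps w v = - (eps v w :: 'k)" by (simp add: eps_swap[of w v])
    then show ?thesis
      using assms 1
      by (simp add: cyc_def brk_he brk_eh brk_ee scale_right pair_sym[of w v] hpair_linear add.commute
          vec.scale_left_distrib algebra_simps)
  next
    case 2
    then show ?thesis
      using assms by (simp add: cyc_def brk_he brk_eh brk_hh brk_ee scale_right hpair_linear red_linear hvec_linear root_pair_self)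
  next
    case 3
    then show ?thesis
      using assms by (simp add: cyc_def brk_he brk_eh brk_ee scale_right pair_sym[of w v])
  qed
qed

text \<open>The identity spreads from generators to all vectors one argument at a time: linearity is
  used in the first argument, with rotations in between.\<close>

lemma cyc_zero: "cyc x y z = (0 :: 'k::field^('n + 'r))"
proof -
  have sub: "vec.subspace {x. cyc x y z = (0 :: 'k^('n + 'r))}" for y z
    unfolding vec.subspace_def by (simp add: cyc_linear)
  have r2: "cyc x y z = cyc z x y" for x y z :: "'k^('n + 'r)"
    using cyc_rotate by metis
  define gens :: "('k^('n + 'r)) set" where "gens = range hvec \<union> evec ` {v. is_root v}"
  have base: "cyc x y z = 0" if "x \<in> gens" "y \<in> gens" "z \<in> gens" for x y z :: "'k^('n + 'r)"
  proof -
    have hhe: "cyc (hvec c) (hvec d) (evec v) = 0" "cyc (hvec c) (evec v) (hvec d) = 0"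
      "cyc (evec v) (hvec c) (hvec d) = 0" for c d :: "'k^'n" and v
      using cyc_hhe[of c d v] cyc_hhe[of d c v] r2[of "hvec c" "evec v" "hvec d"]
        cyc_rotate[of "evec v" "hvec c" "hvec d"] by simp_all
    have hee: "cyc (hvec c) (evec v) (evec w) = 0" "cyc (evec v) (hvec c) (evec w) = 0"
      "cyc (evec v) (evec w) (hvec c) = 0" if "is_root v" "is_root w" for c :: "'k^'n" and v w
      using cyc_hee[OF that] cyc_hee[OF that(2,1)] r2[of "evec v" "evec w" "hvec c"]
        cyc_rotate[of "evec v" "hvec c" "evec w"] by simp_all
    have hhh: "cyc (hvec c) (hvec d) (hvec e) = 0" for c d e :: "'k^'n"
      by (simp add: cyc_def brk_hh)
    show ?thesis
      using that unfolding gens_def by (elim UnE imageE) (simp_all add: hhh hhe hee cyc_roots)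
  qed
  have ind: "cyc x y z = 0" if "\<And>x. x \<in> gens \<Longrightarrow> cyc x y z = 0" for x y z :: "'k^('n + 'r)"
  proof -
    have "x \<in> {x. cyc x y z = 0}"
      by (rule vec_induct[OF sub]) (use that in \<open>simp_all add: gens_def\<close>)
    then show ?thesis by simp
  qed
  have 1: "cyc x y z = 0" if "y \<in> gens" "z \<in> gens" for x y z :: "'k^('n + 'r)"
    by (rule ind) (rule base[OF _ that])
  have 2: "cyc x y z = 0" if "z \<in> gens" for x y z :: "'k^('n + 'r)"
  proof -
    have "cyc y z x = 0"
    proof (rule ind)
      show "cyc y' z x = 0" if "y' \<in> gens" for y'
        using 1[OF that \<open>z \<in> gens\<close>, of x] cyc_rotate[of x y' z] by simp
    qed
    then show ?thesis using cyc_rotate[of x y z] by simp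
  qed
  have "cyc z x y = 0"
  proof (rule ind)
    show "cyc z' x y = 0" if "z' \<in> gens" for z'
      using 2[OF that, of x y] cyc_rotate[of z' x y] by simp
  qed
  then show ?thesis using r2[of x y z] by simp
qed

lemma brk_jacobi: "brk x (brk y z) = brk (brk x y) z + brk y (brk x z)"
proof -
  have "brk x (brk y z) + brk y (brk z x) + brk z (brk x y) = 0"
    using cyc_zero[of x y z] by (simp add: cyc_def)
  moreover have "brk y (brk z x) = - brk y (brk x z)"
    using brk_anti[of z x] by simp
  moreover have "brk z (brk x y) = - brk (brk x y) z" by (rule brk_anti)
  ultimately show ?thesis by (simp add: algebra_simps)
qed

section \<open>Gradings by additive functions of the weight\<close>

definition wt :: "'n + 'r \<Rightarrow> int^'n" where
  "wt i = (case i of Inl j \<Rightarrow> 0 | Inr r \<Rightarrow> rt r)"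

lemma hvec_graded: "d = 0 \<Longrightarrow> hvec c \<in> graded_part UNIV wt d"
  by (auto simp: graded_part_def wt_def hvec_def split: sum.splits)

lemma evec_graded: "evec v \<in> graded_part UNIV wt v"
proof (cases "is_root v")
  case True
  then obtain r where "v = rt r" using root_rt by blast
  then show ?thesis by (auto simp: evec_rt graded_part_def wt_def axis_def split: if_splits)
qed (simp add: evec_def graded_part_def)

lemma base_brk_graded: "base_brk i j \<in> graded_part UNIV wt (wt i + wt j)"
proof (cases "(i, j)" rule: base_brk.cases)
  case (4 a b)
  have "rt a + rt b = 0" if "pair (rt a) (rt b) = -2"
    using root_pair_bounds(4)[of "rt a" "rt b"] that by simp
  then show ?thesis
    using 4 evec_graded[of "rt a + rt b"] hvec_graded[of "rt a + rt b" "red (rt a)"]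
    by (auto simp: graded_part_def wt_def)
qed (auto simp: graded_part_def wt_def axis_def split: if_splits)

text \<open>One statement for every additive \<open>t\<close>: the identity gives the grading by the
  root lattice, the pairing with a fixed root the integer grading, and forgetting a coordinate the
  weights of the superalgebra.\<close>

lemma brk_graded:
  assumes t: "\<And>v w. t (v + w) = t v + (t w :: 'd::ab_group_add)"
    and x: "x \<in> graded_part UNIV (t \<circ> wt) d" and y: "y \<in> graded_part UNIV (t \<circ> wt) d'"
  shows "brk x y \<in> graded_part UNIV (t \<circ> wt) (d + d')"
proof -
  have "t (wt k) = d + d'" if k: "brk x y $ k \<noteq> 0" for k
  proof -
    have "(\<Sum>i\<in>UNIV. \<Sum>j\<in>UNIV. x $ i * y $ j * base_brk i j $ k) \<noteq> 0"
      using k by (simp add: brk_def)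
    then obtain i where "(\<Sum>j\<in>UNIV. x $ i * y $ j * base_brk i j $ k) \<noteq> 0"
      by (rule sum.not_neutral_contains_not_neutral)
    then obtain j where j: "x $ i * y $ j * base_brk i j $ k \<noteq> 0"
      by (rule sum.not_neutral_contains_not_neutral)
    then have "t (wt i) = d" "t (wt j) = d'" "wt k = wt i + wt j"
      using x y base_brk_graded[of i j, where 'a='a] by (auto simp: graded_part_def)
    then show ?thesis by (simp add: t)
  qed
  then show ?thesis by (simp add: graded_part_def)
qed

end

section \<open>Coordinates on a realization\<close>

lemma full_rank:
  fixes A :: "'k::field^'n::finite^'n"
  assumes "\<And>x. A *v x = 0 \<Longrightarrow> x = 0"
  shows "rank A = CARD('n)"
proof -
  have "inj ((*v) A)"
  proof (rule injI)
    fix x y assume "A *v x = A *v y"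
    then have "A *v (x - y) = 0" by (simp add: matrix_vector_mult_diff_distrib)
    then show "x = y" using assms by fastforce
  qed
  then have "\<exists>B. B ** A = mat 1" by (simp add: matrix_left_invertible_injective)
  then have "vec.span (rows A) = UNIV" by (simp add: matrix_left_invertible_span_rows_gen)
  then show ?thesis
    unfolding row_rank_def_gen using vec.dim_span[of "rows A"] by (simp add: card_cart_basis)
qed

text \<open>Full rank \<open>n\<close> gives the Cartan space the dimension
  \<open>2n - n = n\<close>, so the independent coroots are a basis, and \<open>hc\<close> gives
  coordinates in it. The values of the roots are then determined by the matrix.\<close>

lemma realizes_coords:
  fixes A :: "int^'n::finite^'n" and R :: "('k::field, 'n, 'h::ab_group_add) cartan_data"
  assumes R: "realizes A R" and rk: "rank (reduced_matrix A :: 'k^'n^'n) = CARD('n)"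
  obtains hc :: "'h \<Rightarrow> 'k^'n" where
    "\<And>v w. hc (v + w) = hc v + hc w" "\<And>c v. hc (hscale R c v) = c *s hc v"
    "\<And>v. hc v = 0 \<Longrightarrow> v = 0" "\<And>i. hc (coroot R i) = axis i 1"
    "\<And>j v. root R j v = (\<Sum>i\<in>UNIV. hc v $ i * of_int (A $ i $ j))"
proof -
  interpret vs: vector_space "hscale R" using R by (simp add: realizes_def)
  have d: "vs.dim UNIV = CARD('n)" using R rk by (simp add: realizes_def)
  have ind: "(\<Sum>i\<in>UNIV. hscale R (c i) (coroot R i)) = 0 \<Longrightarrow> c i = 0" for c i
    using R by (simp add: realizes_def)
  obtain B0 where B0: "finite B0" "vs.span B0 = UNIV" using R by (auto simp: realizes_def)
  obtain B where B: "B \<subseteq> B0" "vs.independent B" "vs.span B0 \<subseteq> vs.span B"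
    using vs.maximal_independent_subset[of B0] vs.span_mono[of _ B0] 
    by (metis vs.span_span vs.span_minimal vs.subspace_span)
  interpret fd: finite_dimensional_vector_space "hscale R" B
    by unfold_locales (use B B0 finite_subset in auto)
  have inj: "inj (coroot R)"
  proof (rule injI, rule ccontr)
    fix i j assume ij: "coroot R i = coroot R j" "i \<noteq> j"
    \<comment> \<open>Equal coroots at distinct indices would satisfy the relation with coefficients
      1 and -1.\<close>
    define c where "c = (\<lambda>k. if k = i then 1 else if k = j then - 1 else (0::'k))"
    have "(\<Sum>k\<in>UNIV. hscale R (c k) (coroot R k)) = (\<Sum>k\<in>{i, j}. hscale R (c k) (coroot R k))"
      by (rule sum.mono_neutral_right) (auto simp: c_def)
    also have "\<dots> = 0" using ij by (simp add: c_def)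
    finally show False using ind[of c i] by (simp add: c_def)
  qed
  have indep: "vs.independent (range (coroot R))"
  proof (rule vs.independent_if_scalars_zero)
    fix f x assume f: "(\<Sum>x\<in>range (coroot R). hscale R (f x) x) = 0" "x \<in> range (coroot R)"
    then have "(\<Sum>i\<in>UNIV. hscale R (f (coroot R i)) (coroot R i)) = 0"
      by (simp add: sum.reindex[OF inj])
    then show "f x = 0" using ind[of "\<lambda>i. f (coroot R i)"] f(2) by auto
  qed simp
  have "card (range (coroot R)) = CARD('n)" by (simp add: card_image inj)
  then have span: "vs.span (range (coroot R)) = UNIV"
    using fd.card_ge_dim_independent[of "range (coroot R)" UNIV] indep d by auto
  have ex: "\<exists>c. v = (\<Sum>i\<in>UNIV. hscale R (c $ i) (coroot R i))" for v
  proof -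
    have "v \<in> vs.span (range (coroot R))" by (simp add: span)
    then obtain f where "v = (\<Sum>x\<in>range (coroot R). hscale R (f x) x)"
      by (auto simp: vs.span_finite)
    then show ?thesis
      by (intro exI[of _ "\<chi> i. f (coroot R i)"]) (simp add: sum.reindex[OF inj])
  qed
  define hc where "hc v = (SOME c :: 'k^'n. v = (\<Sum>i\<in>UNIV. hscale R (c $ i) (coroot R i)))" for v
  have hc: "v = (\<Sum>i\<in>UNIV. hscale R (hc v $ i) (coroot R i))" for v
    unfolding hc_def by (rule someI_ex[OF ex])
  have uniq: "hc v = c" if "v = (\<Sum>i\<in>UNIV. hscale R (c $ i) (coroot R i))" for v c
  proof -
    have "(\<Sum>i\<in>UNIV. hscale R (hc v $ i - c $ i) (coroot R i)) = 0"
      unfolding vs.scale_left_diff_distrib sum_subtractf using that hc[of v] by simp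
    from ind[OF this] show ?thesis by (simp add: vec_eq_iff)
  qed
  show ?thesis
  proof (rule that[of hc])
    show "hc (v + w) = hc v + hc w" for v w
      by (rule uniq) (simp add: vs.scale_left_distrib sum.distrib flip: hc)
    show "hc (hscale R c v) = c *s hc v" for c v
      by (rule uniq) (simp flip: vs.scale_scale vs.scale_sum_right hc)
    show "v = 0" if "hc v = 0" for v using hc[of v] that by simp
    show "hc (coroot R i) = axis i 1" for i
    proof (rule uniq)
      have "(\<Sum>i'\<in>UNIV. hscale R (axis i 1 $ i') (coroot R i')) =
          (\<Sum>i'\<in>UNIV. if i = i' then coroot R i' else 0)"
        by (intro sum.cong refl) (simp add: axis_def)
      then show "coroot R i = (\<Sum>i'\<in>UNIV. hscale R (axis i 1 $ i') (coroot R i'))" by simp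
    qed
    show "root R j v = (\<Sum>i\<in>UNIV. hc v $ i * of_int (A $ i $ j))" for j v
    proof -
      interpret l: Vector_Spaces.linear "hscale R" "(*)" "root R j"
        using R by (simp add: realizes_def)
      have "root R j v = root R j (\<Sum>i\<in>UNIV. hscale R (hc v $ i) (coroot R i))"
        using hc[of v] by simp
      also have "\<dots> = (\<Sum>i\<in>UNIV. hc v $ i * root R j (coroot R i))"
        by (simp add: l.sum l.scale)
      finally show ?thesis using R by (simp add: realizes_def reduced_matrix_def)
    qed
  qed
qed

section \<open>Simple roots\<close>

locale simply_laced_basis = simply_laced gram rt
  for gram :: "int^'n::finite^'n" and rt :: "'r::finite \<Rightarrow> int^'n" +
  assumes gram_diag: "gram $ i $ i = 1" and gram_off: "i \<noteq> j \<Longrightarrow> gram $ i $ j + gram $ j $ i \<le> 0"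
begin

abbreviation simple :: "'n \<Rightarrow> int^'n" where "simple i \<equiv> axis i 1"

lemma m_simple: "m (simple i) (simple j) = gram $ i $ j"
proof -
  have "m (simple i) (simple j) =
      (\<Sum>i'\<in>UNIV. \<Sum>j'\<in>UNIV. if j = j' then (if i = i' then gram $ i' $ j' else 0) else 0)"
    unfolding m_def by (intro sum.cong refl) (simp add: axis_def)
  then show ?thesis by simp
qed

lemma simple_root [simp]: "is_root (simple i)"
  by (simp add: is_root_def m_simple gram_diag)

lemma pair_simple: "pair (simple i) (simple j) = gram $ i $ j + gram $ j $ i"
  by (simp add: pair_def m_simple)

lemma pair_simple_le: "i \<noteq> j \<Longrightarrow> pair (simple i) (simple j) \<le> 0"
  using gram_off by (simp add: pair_simple)

text \<open>Write \<open>v = p - q\<close> with its positive and negative parts. Their supports are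
  disjoint, so \<open>pair p q \<le> 0\<close>, and if both were nonzero,
  \<open>m v v = m p p + m q q - pair p q\<close> would be at least 2.\<close>

lemma root_sign:
  assumes v: "is_root v"
  shows "(\<forall>i. v $ i \<ge> 0) \<or> (\<forall>i. v $ i \<le> 0)"
proof (rule ccontr)
  assume n: "\<not> ?thesis"
  define p q :: "int^'n" where "p = (\<chi> i. max (v $ i) 0)" and "q = (\<chi> i. max (- v $ i) 0)"
  have vpq: "v = p - q" by (auto simp: vec_eq_iff p_def q_def)
  have pq: "p \<noteq> 0" "q \<noteq> 0" using n by (auto simp: vec_eq_iff p_def q_def max_def not_le)
  have "pair p q = (\<Sum>i\<in>UNIV. \<Sum>j\<in>UNIV. p $ i * (q $ j * pair (simple j) (simple i)))"
    by (simp add: pair_expand[of p q] pair_sym[of "simple _" q] pair_expand[of q] sum_distrib_left)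
  also have "\<dots> \<le> 0"
  proof (intro sum_nonpos)
    fix i j
    show "p $ i * (q $ j * pair (simple j) (simple i)) \<le> 0"
    proof (cases "i = j")
      case True
      then show ?thesis by (auto simp: p_def q_def max_def)
    next
      case False
      then have "pair (simple j) (simple i) \<le> 0" using pair_simple_le by auto
      then have "q $ j * pair (simple j) (simple i) \<le> 0"
        by (rule mult_nonneg_nonpos[rotated]) (simp add: q_def)
      then show ?thesis by (rule mult_nonneg_nonpos[rotated]) (simp add: p_def)
    qed
  qed
  finally have "pair p q \<le> 0" .
  moreover have "m v v = m p p + m q q - pair p q" by (simp add: vpq pair_def)
  ultimately show False using m_pos[OF pq(1)] m_pos[OF pq(2)] v by (simp add: is_root_def)
qed

section \<open>Positive roots and induction on height\<close>

definition positive :: "int^'n \<Rightarrow> bool" where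
  "positive v \<longleftrightarrow> is_root v \<and> (\<forall>i. v $ i \<ge> 0)"

lemma positive_or_neg: "is_root v \<Longrightarrow> positive v \<or> positive (- v)"
  using root_sign[of v] by (auto simp: positive_def)

definition ht :: "int^'n \<Rightarrow> int" where "ht v = (\<Sum>i\<in>UNIV. v $ i)"

lemma ht_simps: "ht (v - w) = ht v - ht w" "ht (simple i) = 1"
  by (simp_all add: ht_def sum_subtractf axis_def)

lemma ht_nonneg: "positive v \<Longrightarrow> ht v \<ge> 0"
  by (simp add: ht_def positive_def sum_nonneg)

text \<open>Expanding \<open>pair v v = 2\<close> in coordinates yields a simple root with positive
  pairing; the pairing is 1 because \<open>v\<close> is not that root. If the difference were not
  positive, all its coordinates would be at most 0 by \<open>root_sign\<close>, leaving only
  \<open>v = simple i\<close>.\<close>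

lemma positive_step:
  assumes v: "positive v" and ns: "\<And>i. v \<noteq> simple i"
  obtains i where "pair v (simple i) = 1" "positive (v - simple i)"
proof -
  have r: "is_root v" and nn: "v $ i \<ge> 0" for i using v by (auto simp: positive_def)
  have "(\<Sum>i\<in>UNIV. v $ i * pair (simple i) v) = 2"
    using pair_expand[of v v] root_pair_self[OF r] by simp
  moreover have "(\<Sum>i\<in>UNIV. v $ i * pair (simple i) v) \<le> 0" if "\<forall>i. v $ i * pair (simple i) v \<le> 0"
    using that by (intro sum_nonpos) simp
  ultimately obtain i where "v $ i * pair (simple i) v > 0"
    by (metis not_le zero_less_numeral)
  then have "pair (simple i) v > 0" using nn[of i] by (simp add: zero_less_mult_iff)
  then have p: "pair v (simple i) = 1"
    using root_pair_bounds[OF r simple_root[of i]] ns[of i] by (auto simp: pair_sym[of "simple i"])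
  then have r': "is_root (v - simple i)" using root_diff_iff r by simp
  have "\<not> (\<forall>k. (v - simple i) $ k \<le> 0)"
  proof
    assume *: "\<forall>k. (v - simple i) $ k \<le> 0"
    have z: "v $ k = 0" if "k \<noteq> i" for k
      using *[rule_format, of k] nn[of k] that by (simp add: axis_def)
    have "v $ i \<le> 1" using *[rule_format, of i] by (simp add: axis_def)
    moreover have "v $ i \<noteq> 0"
    proof
      assume "v $ i = 0"
      then have "v $ k = 0" for k using z by (cases "k = i") simp_all
      then show False using root_nonzero[OF r] by (simp add: vec_eq_iff)
    qed
    ultimately have "v $ i = 1" using nn[of i] by linarith
    then have "v = simple i" using z by (simp add: vec_eq_iff axis_def)
    then show False using ns by simp
  qed
  then have "positive (v - simple i)" using root_sign[OF r'] r' by (auto simp: positive_def)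
  then show ?thesis using p that by blast
qed

text \<open>The hypothesis covers every positive root of smaller height, because the generation
  argument for the superalgebra subtracts \<theta> as well as a simple root.\<close>

lemma positive_induct [consumes 1, case_names simple step]:
  assumes v: "positive v" and s: "\<And>i. P (simple i)"
    and step: "\<And>v. positive v \<Longrightarrow> (\<And>i. v \<noteq> simple i) \<Longrightarrow>
      (\<And>w. positive w \<Longrightarrow> ht w < ht v \<Longrightarrow> P w) \<Longrightarrow> P v"
  shows "P v"
  using v
proof (induction "nat (ht v)" arbitrary: v rule: less_induct)
  case less
  show ?case
  proof (cases "\<exists>i. v = simple i")
    case False
    show ?thesis
    proof (rule step[OF less.prems])
      show "P w" if "positive w" "ht w < ht v" for w
        using less.hyps[of w] that ht_nonneg[of w] by simp
    qed (use False in auto)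
  qed (use s in auto)
qed

lemma evec_generated:
  assumes T: "vec.subspace T" "\<And>x y. x \<in> T \<Longrightarrow> y \<in> T \<Longrightarrow> brk x y \<in> T"
    and e: "\<And>i. evec (simple i) \<in> T" "\<And>i. evec (- simple i) \<in> T" and h: "\<And>c. hvec c \<in> T"
  shows "(x :: 'k::field^('n + 'r)) \<in> T"
proof (rule vec_induct[OF T(1) h])
  have step: "evec v \<in> T \<and> evec (- v) \<in> T" if "positive v" for v
    using that
  proof (induction rule: positive_induct)
    case (step v)
    obtain i where i: "pair v (simple i) = 1" "positive (v - simple i)"
      using positive_step[OF step(1,2)] by blast
    have r: "is_root v" "is_root (v - simple i)" using i step by (auto simp: positive_def)
    define w where "w = v - simple i"
    have v: "v = simple i + w" by (simp add: w_def)
    have IH: "evec w \<in> T" "evec (- w) \<in> T"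
      using step.IH[OF i(2)] by (simp_all add: ht_simps w_def)
    have w: "is_root w" "pair (simple i) w = -1"
      using i(1) r root_pair_self[OF simple_root[of i]] by (simp_all add: w_def pair_sym[of "simple i" v])
    have b: "brk (evec (simple i)) (evec w) = eps (simple i) w *s (evec v :: 'k^('n + 'r))"
      "brk (evec (- simple i)) (evec (- w)) = eps (simple i) w *s (evec (- v) :: 'k^('n + 'r))"
      using w by (simp_all add: brk_ee v)
    have "eps (simple i) w *s brk (evec (simple i)) (evec w) \<in> T"
      "eps (simple i) w *s brk (evec (- simple i)) (evec (- w)) \<in> T"
      by (intro vec.subspace_scale[OF T(1)] T(2) e IH)+
    then show ?case unfolding b by simp
  qed (use e in auto)
  show "evec v \<in> T" if "is_root v" for v
    using positive_or_neg[OF that] step[of v] step[of "- v"] by auto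
qed

text \<open>Applied to roots, where \<open>m v v = 1\<close>, and later to vectors
  \<open>w + w + \<theta>\<close>, where the value is 3; neither is divisible by 9.\<close>

lemma red_nonzero:
  assumes "CHAR('k::field) = 3" "\<not> 9 dvd m v v"
  shows "red v \<noteq> (0 :: 'k^'n)"
proof -
  obtain i where "\<not> 3 dvd v $ i" using not_divisible_by_3[OF assms(2)] by blast
  then have "red v $ i \<noteq> (0 :: 'k)" by (simp add: red_def of_int_eq_0_iff_char_dvd assms(1))
  then show ?thesis by auto
qed

lemma red_simple: "red (simple i) = axis i 1"
  by (simp add: red_def axis_def vec_eq_iff)

lemma hvec_zero_iff: "hvec c = 0 \<longleftrightarrow> c = 0"
  by (auto simp: hvec_def vec_eq_iff split: sum.splits)

text \<open>For nondegeneracy, the space of a nonzero weight is at most the line of a root vector,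
  and bracketing with the opposite root vector gives a coroot, nonzero modulo 3 by
  \<open>red_nonzero\<close>.\<close>

lemma simply_laced_model:
  fixes R :: "('k::field, 'n, 'h::ab_group_add) cartan_data" and A :: "int^'n^'n"
  assumes char: "CHAR('k) = 3" and R: "realizes A R"
    and rk: "rank (reduced_matrix A :: 'k^'n^'n) = CARD('n)"
    and A: "\<And>i j. A $ i $ j = pair (simple i) (simple j)"
  obtains hm where "cartan_model (\<lambda>i. 0) R brk UNIV (\<lambda>i. 0) wt (\<lambda>i. evec (simple i)) (\<lambda>i. - evec (- simple i)) hm"
proof -
  obtain hc where hc: "\<And>v w. hc (v + w) = hc v + hc w" "\<And>c v. hc (hscale R c v) = c *s hc v"
    "\<And>v. hc v = 0 \<Longrightarrow> v = 0" "\<And>i. hc (coroot R i) = axis i 1"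
    "\<And>j v. root R j v = (\<Sum>i\<in>UNIV. hc v $ i * of_int (A $ i $ j))"
    using realizes_coords[OF R rk] by blast
  \<comment> \<open>All coordinates are even here, so an element of odd parity is 0 and the signed
    identities reduce to the ordinary ones.\<close>
  have par: "x = 0" if "x \<in> graded_part UNIV (\<lambda>i. 0) p" "p \<noteq> (0::bit)" for x :: "'k^('n + 'r)" and p
    using that by (auto simp: graded_part_def vec_eq_iff)
  have par0: "0 \<in> graded_part UNIV (\<lambda>i. 0) p" "x \<in> graded_part UNIV (\<lambda>i. 0) (0::bit)"
    for x :: "'k^('n + 'r)" and p :: bit
    by (auto simp: graded_part_def)
  have rt: "root R j v = hpair (hc v) (simple j)" for j v
    by (simp add: hc(5) hpair_def A)
  have wt_id: "wt = (\<lambda>v. v) \<circ> wt" by auto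
  have neg: "- x \<in> graded_part UNIV wt d" if "x \<in> graded_part UNIV wt d" for x :: "'k^('n + 'r)" and d
    using that by (simp add: graded_part_def)
  show ?thesis
  proof (rule that[of "\<lambda>v. hvec (hc v)"], unfold_locales)
    fix x y z :: "'k^('n + 'r)" and p q r :: bit and i j :: 'n and v w :: 'h and d d' and c :: 'k
    show "vec.subspace (UNIV :: ('k^('n + 'r)) set)" by simp
    show "brk x y \<in> graded_part UNIV (\<lambda>i. 0) (p + q)"
      if "x \<in> graded_part UNIV (\<lambda>i. 0) p" "y \<in> graded_part UNIV (\<lambda>i. 0) q"
      using par[OF that(1)] par[OF that(2)] par0 by (cases "p = 0"; cases "q = 0") auto
    show "brk x y \<in> graded_part UNIV wt (d + d')"
      if "x \<in> graded_part UNIV wt d" "y \<in> graded_part UNIV wt d'"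
      using brk_graded[of "\<lambda>v. v" x d y d'] that by (simp add: comp_def)
    show "brk x y \<in> UNIV" by simp
    show "brk x y + koszul_sign p q *s brk y x = 0"
      if "x \<in> graded_part UNIV (\<lambda>i. 0) p" "y \<in> graded_part UNIV (\<lambda>i. 0) q"
      using par[OF that(1)] par[OF that(2)] brk_anti[of x y] by (cases "p = 0"; cases "q = 0") auto
    show "brk x (brk y z) = brk (brk x y) z + koszul_sign p q *s brk y (brk x z)"
      if "x \<in> graded_part UNIV (\<lambda>i. 0) p" "y \<in> graded_part UNIV (\<lambda>i. 0) q" "z \<in> graded_part UNIV (\<lambda>i. 0) r"
      using par[OF that(1)] par[OF that(2)] brk_jacobi[of x y z] by (cases "p = 0"; cases "q = 0") auto
    show "brk x (brk x x) = 0" if "x \<in> graded_part UNIV (\<lambda>i. 0) (1::bit)"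
      using par[OF that] by simp
    show "(evec (simple i) :: 'k^('n + 'r)) \<in> graded_part UNIV (\<lambda>i. 0) (0::bit)"
      "(- evec (- simple i) :: 'k^('n + 'r)) \<in> graded_part UNIV (\<lambda>i. 0) (0::bit)"
      "hvec (hc v) \<in> graded_part UNIV (\<lambda>i. 0) (0::bit)"
      by (simp_all add: par0)
    show "(evec (simple i) :: 'k^('n + 'r)) \<in> graded_part UNIV wt (simple i)" by (rule evec_graded)
    show "(- evec (- simple i) :: 'k^('n + 'r)) \<in> graded_part UNIV wt (- simple i)" by (rule neg[OF evec_graded])
    show "hvec (hc v) \<in> graded_part UNIV wt 0" by (rule hvec_graded) simp
    show "hvec (hc (v + w)) = hvec (hc v) + hvec (hc w)" "hvec (hc (hscale R c v)) = c *s hvec (hc v)"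
      by (simp_all add: hc hvec_linear)
    show "v = 0" if "hvec (hc v) = 0" using that hc(3) by (simp add: hvec_zero_iff)
    show "brk (evec (simple i)) (- evec (- simple j)) = (if i = j then hvec (hc (coroot R i)) else 0)"
    proof (cases "i = j")
      case True
      then show ?thesis by (simp add: brk_ee root_pair_self hc(4) red_simple)
    next
      case False
      then show ?thesis using pair_simple_le[OF False] by (simp add: brk_ee)
    qed
    show "brk (hvec (hc v)) (evec (simple j)) = root R j v *s evec (simple j)"
      by (simp add: brk_he rt)
    show "brk (hvec (hc v)) (- evec (- simple j)) = - (root R j v *s - evec (- simple j))"
      by (simp add: brk_he rt hpair_linear)
    show "brk (hvec (hc v)) (hvec (hc w)) = 0" by (rule brk_hh)
  next
    fix T :: "('k^('n + 'r)) set"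
    assume T: "vec.subspace T" "\<And>x y. x \<in> T \<Longrightarrow> y \<in> T \<Longrightarrow> brk x y \<in> T"
      "\<And>i. evec (simple i) \<in> T" "\<And>i. - evec (- simple i) \<in> T" "\<And>v. hvec (hc v) \<in> T"
    have "hvec c \<in> T" for c
      unfolding hvec_linear(1,2) 
    proof -
      have "hvec (axis i 1) \<in> T" for i using T(5)[of "coroot R i"] by (simp add: hc(4))
      moreover have "hvec c = (\<Sum>i\<in>UNIV. c $ i *s hvec (axis i 1))"
      proof -
        have "hvec (axis i 1) = (axis (Inl i) 1 :: 'k^('n + 'r))" for i
          by (auto simp: hvec_def axis_def vec_eq_iff split: sum.splits)
        then show ?thesis by (simp add: hvec_expand)
      qed
      ultimately show ?thesis
        by (simp add: vec.subspace_sum[OF T(1)] vec.subspace_scale[OF T(1)])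
    qed
    moreover have "evec (- simple i) \<in> T" for i
      using vec.subspace_neg[OF T(1) T(4)[of i]] by simp
    ultimately show "UNIV \<subseteq> T" using evec_generated[OF T(1,2,3)] by blast
  next
    fix d :: "int^'n" and x :: "'k^('n + 'r)"
    assume d: "d \<noteq> 0" and x: "x \<in> graded_part UNIV wt d" "x \<noteq> 0"
    then obtain k where k: "x $ k \<noteq> 0" by (auto simp: vec_eq_iff)
    then have wk: "wt k = d" using x by (simp add: graded_part_def)
    then obtain r where r: "k = Inr r" using d by (cases k) (auto simp: wt_def)
    have dr: "d = rt r" using wk r by (simp add: wt_def)
    have "x = x $ k *s evec d"
    proof -
      have "x $ i = 0" if "i \<noteq> k" for i
      proof (rule ccontr)
        assume "x $ i \<noteq> 0"
        then have "wt i = d" using x by (simp add: graded_part_def)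
        then show False using that d r dr rt_inj by (cases i) (auto simp: wt_def inj_def)
      qed
      then show ?thesis by (auto simp: vec_eq_iff dr evec_rt r axis_def)
    qed
    then have "brk (evec (- d)) x = x $ k *s brk (evec (- d)) (evec d)" by (metis scale_right)
    also have "\<dots> = x $ k *s hvec (red d)"
      using rt_root[of r] by (simp add: dr[symmetric] brk_ee root_pair_self red_linear hvec_linear)
    finally have "brk (evec (- d)) x \<noteq> 0"
      using red_nonzero[OF char, of d] k rt_root[of r]
      by (simp add: hvec_zero_iff dr[symmetric] is_root_def)
    then show "\<exists>y\<in>graded_part UNIV wt (- d). brk y x \<noteq> 0" using evec_graded by blast
  qed
qed

end

section \<open>The Lie superalgebra attached to a root\<close>

locale simply_laced_root = simply_laced gram rt
  for gram :: "int^'n::finite^'n" and rt :: "'r::finite \<Rightarrow> int^'n" +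
  fixes \<theta> :: "int^'n"
  assumes theta_root [simp]: "is_root \<theta>"
begin

section \<open>The grading by the root and its \<open>sl_2\<close>\<close>

definition grade :: "'n + 'r \<Rightarrow> int" where
  "grade = (\<lambda>v. pair v \<theta>) \<circ> wt"

abbreviation layer :: "int \<Rightarrow> ('k::field^('n + 'r)) set" where
  "layer k \<equiv> graded_part UNIV grade k"

definition comp :: "int \<Rightarrow> 'k::field^('n + 'r) \<Rightarrow> 'k^('n + 'r)" where
  "comp k x = (\<chi> i. if grade i = k then x $ i else 0)"

text \<open>With this normalization \<open>brk ee ff = - hh\<close>, so it is \<open>ee\<close>,
  \<open>- ff\<close>, \<open>hh\<close> that satisfy the usual \<open>sl_2\<close>
  relations.\<close>

definition ee :: "'k::field^('n + 'r)" where "ee = evec \<theta>"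
definition ff :: "'k::field^('n + 'r)" where "ff = evec (- \<theta>)"
definition hh :: "'k::field^('n + 'r)" where "hh = hvec (red \<theta>)"

abbreviation D :: "'k::field^('n + 'r) \<Rightarrow> 'k^('n + 'r)" where "D x \<equiv> brk ee x"

lemma pair_theta [simp]: "pair \<theta> \<theta> = 2"
  by (simp add: root_pair_self)

lemma grade_bounds: "-2 \<le> grade i" "grade i \<le> 2"
  using root_pair_bounds(1,2)[OF rt_root theta_root] by (cases i; simp add: grade_def wt_def)+

lemma layer_trivial: "x \<in> layer k \<Longrightarrow> \<bar>k\<bar> > 2 \<Longrightarrow> x = 0"
proof -
  assume x: "x \<in> layer k" "\<bar>k\<bar> > 2"
  have "x $ i = 0" for i
  proof (rule ccontr)
    assume "x $ i \<noteq> 0"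
    then have "grade i = k" using x by (simp add: graded_part_def)
    then show False using grade_bounds[of i] x(2) by simp
  qed
  then show "x = 0" by (simp add: vec_eq_iff)
qed

lemma layer_subspace: "vec.subspace (layer k)"
  by (rule graded_part_subspace) simp

lemmas layer_closed = vec.subspace_add[OF layer_subspace] vec.subspace_diff[OF layer_subspace]
  vec.subspace_neg[OF layer_subspace] vec.subspace_scale[OF layer_subspace]
  vec.subspace_0[OF layer_subspace]

lemma brk_layer: "x \<in> layer j \<Longrightarrow> y \<in> layer k \<Longrightarrow> brk x y \<in> layer (j + k)"
  unfolding grade_def by (rule brk_graded) simp_all

lemma hvec_layer: "hvec c \<in> layer 0"
  by (auto simp: graded_part_def grade_def wt_def hvec_def split: sum.splits)

lemma evec_layer: "evec v \<in> layer (pair v \<theta>)"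
  using evec_graded[of v] by (auto simp: graded_part_def grade_def)

lemma ee_layer: "ee \<in> layer 2" and ff_layer: "ff \<in> layer (-2)" and hh_layer: "hh \<in> layer 0"
  using evec_layer[of \<theta>] evec_layer[of "- \<theta>"] hvec_layer[of "red \<theta>"]
  by (simp_all add: ee_def ff_def hh_def)

lemma D_layer: "x \<in> layer k \<Longrightarrow> D x \<in> layer (k + 2)"
  using brk_layer[OF ee_layer] by (simp add: add.commute)

lemma brk_ef: "brk ee ff = - hh" "brk ff ee = hh"
  by (simp_all add: ee_def ff_def hh_def brk_ee red_linear hvec_linear)

lemma brk_hvec: "brk (hvec c) x = (\<chi> i. hpair c (wt i) * x $ i)"
proof -
  have "x \<in> {x. brk (hvec c) x = (\<chi> i. hpair c (wt i) * x $ i)}"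
  proof (rule vec_induct)
    show "vec.subspace {x. brk (hvec c) x = (\<chi> i. hpair c (wt i) * x $ i)}"
      unfolding vec.subspace_def by (auto simp: add_right scale_right vec_eq_iff algebra_simps)
    show "hvec d \<in> {x. brk (hvec c) x = (\<chi> i. hpair c (wt i) * x $ i)}" for d
      unfolding mem_Collect_eq brk_hh
      by (auto simp: vec_eq_iff hvec_def wt_def hpair_linear split: sum.splits)
    show "evec v \<in> {x. brk (hvec c) x = (\<chi> i. hpair c (wt i) * x $ i)}" for v
    proof -
      have "hpair c v * evec v $ i = hpair c (wt i) * evec v $ i" for i
        using evec_graded[of v, where 'a='a] by (cases "evec v $ i = 0") (auto simp: graded_part_def)
      then have "hpair c v *s evec v = (\<chi> i. hpair c (wt i) * evec v $ i)"
        by (subst vec_eq_iff) simp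
      then show ?thesis by (simp only: mem_Collect_eq brk_he)
    qed
  qed
  then show ?thesis by simp
qed

lemma brk_hh_layer: "x \<in> layer k \<Longrightarrow> brk hh x = of_int k *s x"
  unfolding hh_def brk_hvec
  by (auto simp: vec_eq_iff hpair_red graded_part_def grade_def pair_sym[of \<theta>])

lemma brk_layer_hh: "x \<in> layer k \<Longrightarrow> brk x hh = - (of_int k *s x)"
  using brk_hh_layer brk_anti[of x hh] by simp

text \<open>A root pairing to 2 or -2 with \<theta> is \<theta> or its negative, and the Cartan part
  has degree 0; so the extreme degrees are lines.\<close>

lemma layer_line:
  assumes x: "x \<in> layer (pair v \<theta>)" and v: "v = \<theta> \<or> v = - \<theta>"
  obtains c where "x = c *s evec v"
proof -
  have rv: "is_root v" using v by auto
  obtain r where r: "v = rt r" using root_rt[OF rv] by blast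
  have "x $ i = 0" if "i \<noteq> Inr r" for i
  proof (rule ccontr)
    assume "x $ i \<noteq> 0"
    then have g: "grade i = pair v \<theta>" using x by (simp add: graded_part_def)
    then obtain r' where r': "i = Inr r'" using v by (cases i) (auto simp: grade_def wt_def)
    have "pair (rt r') \<theta> = 2 \<or> pair (rt r') \<theta> = -2" using g v by (auto simp: r' grade_def wt_def)
    then have "rt r' = v"
      using root_pair_bounds(3,4)[OF rt_root[of r'] theta_root] g v
      by (auto simp: r' grade_def wt_def)
    then show False using that r r' rt_inj by (auto simp: inj_def)
  qed
  then have "x = x $ Inr r *s evec v" by (auto simp: vec_eq_iff r evec_rt axis_def)
  then show ?thesis by (rule that)
qed

lemma layer_2: "x \<in> layer 2 \<Longrightarrow> \<exists>c. x = c *s ee"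
  using layer_line[of x \<theta>] by (auto simp: ee_def)

lemma layer_minus_2: "x \<in> layer (-2) \<Longrightarrow> \<exists>c. x = c *s ff"
  using layer_line[of x "- \<theta>"] by (auto simp: ff_def)

lemma comp_layer: "comp k x \<in> layer k"
  by (simp add: comp_def graded_part_def)

lemma comp_linear: "comp k (x + y) = comp k x + comp k y" "comp k (c *s x) = c *s comp k x"
  "comp k (- x) = - comp k x" "comp k (x - y) = comp k x - comp k y" "comp k 0 = 0"
  by (simp_all add: comp_def vec_eq_iff)

lemma comp_sum: "comp k (\<Sum>a\<in>A. u a) = (\<Sum>a\<in>A. comp k (u a))"
  by (induction A rule: infinite_finite_induct) (simp_all add: comp_linear)

lemma comp_of_layer: "x \<in> layer j \<Longrightarrow> comp k x = (if k = j then x else 0)"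
  by (auto simp: comp_def graded_part_def vec_eq_iff)

lemma comp_idem [simp]: "comp j (comp k x) = (if j = k then comp k x else 0)"
  by (rule comp_of_layer) (rule comp_layer)

lemma comp_trivial: "\<bar>k\<bar> > 2 \<Longrightarrow> comp k x = 0"
  using layer_trivial[OF comp_layer] .

lemma comp_expand: "x = (\<Sum>k\<in>{-2..2}. comp k x)"
proof -
  have "x $ i = (\<Sum>k\<in>{-2..2}. comp k x) $ i" for i
    using grade_bounds[of i] by (simp add: comp_def)
  then show ?thesis by (simp add: vec_eq_iff)
qed

lemma comp_brk:
  assumes y: "y \<in> layer j"
  shows "comp (j + k) (brk y x) = brk y (comp k x)"
proof -
  have "comp (j + k) (brk y x) = (\<Sum>l\<in>{-2..2}. comp (j + k) (brk y (comp l x)))"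
    using comp_expand[of x] by (metis (no_types) sum_right comp_sum)
  also have "\<dots> = (\<Sum>l\<in>{-2..2}. if l = k then brk y (comp k x) else 0)"
    using comp_of_layer[OF brk_layer[OF y comp_layer]] by (intro sum.cong refl) auto
  also have "\<dots> = brk y (comp k x)"
    using comp_trivial[of k x] by (cases "k \<in> {-2..2}") auto
  finally show ?thesis .
qed

lemma comp_D: "comp k (D x) = D (comp (k - 2) x)"
  using comp_brk[OF ee_layer, of "k - 2" x] by simp

lemma D_hh: "D hh = - (2 *s ee)"
  using brk_layer_hh[OF ee_layer] by simp

text \<open>Degree -3 is 0, so \<open>ff\<close> kills \<open>x\<close>, and
  \<open>brk ff ee = hh\<close> acts on \<open>x\<close> by -1. Thus \<open>D\<close> is injective
  in degree -1, with left inverse the bracket with \<open>- ff\<close>.\<close>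

lemma ff_D: "x \<in> layer (-1) \<Longrightarrow> brk ff (D x) = - x"
proof -
  assume x: "x \<in> layer (-1)"
  have "brk ff x = 0" using layer_trivial[OF brk_layer[OF ff_layer x]] by simp
  then show ?thesis using brk_jacobi[of ff ee x] brk_hh_layer[OF x] by (simp add: brk_ef)
qed

text \<open>The mirror image of \<open>ff_D\<close>; it shows that \<open>D\<close> maps degree -1
  onto degree 1.\<close>

lemma D_ff: "x \<in> layer 1 \<Longrightarrow> D (brk ff x) = - x"
proof -
  assume x: "x \<in> layer 1"
  have "brk ee x = 0" using layer_trivial[OF brk_layer[OF ee_layer x]] by simp
  then show ?thesis using brk_jacobi[of ee ff x] brk_hh_layer[OF x] by (simp add: brk_ef)
qed

lemma D_D: "x \<in> layer k \<Longrightarrow> k > -2 \<Longrightarrow> D (D x) = 0"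
  using layer_trivial[OF D_layer[OF D_layer]] by force

lemma D_D_D: "D (D (D x)) = 0"
proof -
  have "D (D (D x)) = (\<Sum>k\<in>{-2..2}. D (D (D (comp k x))))"
    using comp_expand[of x] by (metis (no_types) sum_right)
  also have "\<dots> = 0"
    by (intro sum.neutral ballI layer_trivial[OF D_layer[OF D_layer[OF D_layer[OF comp_layer]]]]) auto
  finally show ?thesis .
qed

lemma D_derivation: "D (brk x y) = brk (D x) y + brk x (D y)"
  by (rule brk_jacobi)

section \<open>Carrier, parity and bracket of the superalgebra\<close>

definition super_carrier :: "('k::field^('n + 'r)) set" where
  "super_carrier = {x. (\<forall>i. x $ i \<noteq> 0 \<longrightarrow> grade i = 0 \<or> grade i = -1) \<and> D (comp 0 x) = 0}"

definition super_parity :: "'n + 'r \<Rightarrow> bit" where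
  "super_parity i = (if grade i = -1 then 1 else 0)"

text \<open>Written through components so that it is bilinear on the whole vector space and not only
  on \<open>super_carrier\<close>.\<close>

definition sbrk :: "'k::field^('n + 'r) \<Rightarrow> 'k^('n + 'r) \<Rightarrow> 'k^('n + 'r)" where
  "sbrk x y = brk (comp 0 x) (comp 0 y) + brk (comp 0 x) (comp (-1) y) + brk (comp (-1) x) (comp 0 y) +
    (brk (D (comp (-1) x)) (comp (-1) y) - brk (comp (-1) x) (D (comp (-1) y)))"

definition even_part :: "('k::field^('n + 'r)) set" where
  "even_part = {x \<in> layer 0. D x = 0}"

lemma even_part_subspace: "vec.subspace even_part"
  unfolding vec.subspace_def even_part_def
  by (simp add: add_right scale_right layer_closed)

lemmas even_closed = vec.subspace_add[OF even_part_subspace] vec.subspace_diff[OF even_part_subspace]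
  vec.subspace_neg[OF even_part_subspace] vec.subspace_scale[OF even_part_subspace]

lemma even_layer: "x \<in> even_part \<Longrightarrow> x \<in> layer 0" and even_D: "x \<in> even_part \<Longrightarrow> D x = 0"
  by (simp_all add: even_part_def)

lemma super_carrier_expand: "x \<in> super_carrier \<Longrightarrow> x = comp 0 x + comp (-1) x"
  by (auto simp: super_carrier_def comp_def vec_eq_iff)

lemma super_carrier_iff: "x \<in> super_carrier \<longleftrightarrow> (\<exists>a b. a \<in> even_part \<and> b \<in> layer (-1) \<and> x = a + b)"
proof
  assume x: "x \<in> super_carrier"
  then have "comp 0 x \<in> even_part" using comp_layer by (auto simp: super_carrier_def even_part_def)
  then show "\<exists>a b. a \<in> even_part \<and> b \<in> layer (-1) \<and> x = a + b"
    using super_carrier_expand[OF x] comp_layer by blast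
next
  assume "\<exists>a b. a \<in> even_part \<and> b \<in> layer (-1) \<and> x = a + b"
  then obtain a b where ab: "a \<in> even_part" "b \<in> layer (-1)" "x = a + b" by blast
  have "comp 0 x = a" using ab comp_of_layer[of b "-1" 0] comp_of_layer[OF even_layer[OF ab(1)], of 0] by (simp add: comp_linear)
  moreover have "grade i = 0 \<or> grade i = -1" if "x $ i \<noteq> 0" for i
    using that ab(2,3) even_layer[OF ab(1)] by (cases "a $ i = 0") (simp_all add: graded_part_def)
  ultimately show "x \<in> super_carrier" using ab even_D by (simp add: super_carrier_def)
qed

lemma super_carrier_subspace: "vec.subspace (super_carrier :: ('k::field^('n + 'r)) set)"
  unfolding vec.subspace_def
proof (intro conjI ballI allI)
  show "0 \<in> super_carrier" by (simp add: super_carrier_def comp_linear)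
  fix x y :: "'k^('n + 'r)" assume x: "x \<in> super_carrier"
  show "c *s x \<in> super_carrier" for c
    using x by (auto simp: super_carrier_def comp_linear scale_right)
  assume y: "y \<in> super_carrier"
  show "x + y \<in> super_carrier"
  proof -
    have "grade i = 0 \<or> grade i = -1" if "(x + y) $ i \<noteq> 0" for i
    proof (rule ccontr)
      assume "\<not> ?thesis"
      then have "x $ i = 0" "y $ i = 0" using x y by (auto simp: super_carrier_def)
      then show False using that by simp
    qed
    then show ?thesis using x y by (simp add: super_carrier_def comp_linear add_right)
  qed
qed

lemma super_part_even: "graded_part super_carrier super_parity 0 = even_part"
proof
  show "graded_part super_carrier super_parity 0 \<subseteq> even_part"
  proof
    fix x assume x: "x \<in> graded_part super_carrier super_parity 0"
    then have "x \<in> layer 0"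
      by (auto simp: graded_part_def super_carrier_def super_parity_def split: if_splits)
    moreover from this have "comp 0 x = x" using comp_of_layer[of x 0 0] by simp
    ultimately show "x \<in> even_part" using x by (simp add: graded_part_def super_carrier_def even_part_def)
  qed
  show "even_part \<subseteq> graded_part super_carrier super_parity 0"
  proof
    fix x assume x: "x \<in> even_part"
    then have "x \<in> super_carrier" using super_carrier_iff layer_closed(5)[of "-1"] by fastforce
    then show "x \<in> graded_part super_carrier super_parity 0"
      using even_layer[OF x] by (auto simp: graded_part_def super_parity_def)
  qed
qed

lemma super_part_odd: "graded_part super_carrier super_parity 1 = layer (-1)"
proof
  show "graded_part super_carrier super_parity 1 \<subseteq> layer (-1)"
    by (auto simp: graded_part_def super_parity_def split: if_splits)
  show "layer (-1) \<subseteq> graded_part super_carrier super_parity 1"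
  proof
    fix x assume x: "x \<in> layer (-1)"
    then have "x \<in> super_carrier"
      using super_carrier_iff vec.subspace_0[OF even_part_subspace] by fastforce
    then show "x \<in> graded_part super_carrier super_parity 1"
      using x by (auto simp: graded_part_def super_parity_def)
  qed
qed

sublocale super: vec_bracket sbrk
  by unfold_locales
    (simp_all add: sbrk_def comp_linear add_left add_right scale_left scale_right
      vec.scale_right_distrib vec.scale_right_diff_distrib algebra_simps)

lemma comp_even [simp]: "x \<in> even_part \<Longrightarrow> comp 0 x = x" "x \<in> even_part \<Longrightarrow> comp (-1) x = 0"
  by (simp_all add: comp_of_layer[OF even_layer])

lemma comp_odd [simp]: "x \<in> layer (-1) \<Longrightarrow> comp (-1) x = x" "x \<in> layer (-1) \<Longrightarrow> comp 0 x = 0"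
  using comp_of_layer[of x "-1"] by simp_all

lemma sbrk_ee: "x \<in> even_part \<Longrightarrow> y \<in> even_part \<Longrightarrow> sbrk x y = brk x y"
  and sbrk_eo: "x \<in> even_part \<Longrightarrow> y \<in> layer (-1) \<Longrightarrow> sbrk x y = brk x y"
  and sbrk_oe: "x \<in> layer (-1) \<Longrightarrow> y \<in> even_part \<Longrightarrow> sbrk x y = brk x y"
  and sbrk_oo: "x \<in> layer (-1) \<Longrightarrow> y \<in> layer (-1) \<Longrightarrow> sbrk x y = brk (D x) y - brk x (D y)"
  by (simp_all add: sbrk_def)

lemma brk_even: "x \<in> even_part \<Longrightarrow> y \<in> even_part \<Longrightarrow> brk x y \<in> even_part"
  using brk_layer[of x 0 y 0] by (simp add: even_part_def D_derivation)

lemma brk_eo_odd: "x \<in> even_part \<Longrightarrow> y \<in> layer (-1) \<Longrightarrow> brk x y \<in> layer (-1)"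
  and brk_oe_odd: "x \<in> layer (-1) \<Longrightarrow> y \<in> even_part \<Longrightarrow> brk x y \<in> layer (-1)"
  using brk_layer[OF even_layer, of x y "-1"] brk_layer[OF _ even_layer, of x "-1" y] by simp_all

text \<open>\<open>D\<close> squares to 0 on degree -1, so it sends both \<open>brk (D x) y\<close>
  and \<open>brk x (D y)\<close> to \<open>brk (D x) (D y)\<close>, and their difference to
  0.\<close>

lemma sbrk_oo_even:
  assumes x: "x \<in> layer (-1)" and y: "y \<in> layer (-1)"
  shows "sbrk x y \<in> even_part"
proof -
  have "brk (D x) y \<in> layer 0" "brk x (D y) \<in> layer 0"
    using brk_layer[OF D_layer[OF x] y] brk_layer[OF x D_layer[OF y]] by simp_all
  then have "sbrk x y \<in> layer 0" using x y by (simp add: sbrk_oo layer_closed)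
  moreover have "D (sbrk x y) = 0"
    using D_D[OF x] D_D[OF y] D_derivation[of "D x" y] D_derivation[of x "D y"] x y
    by (simp add: sbrk_oo diff_right)
  ultimately show ?thesis by (simp add: even_part_def)
qed

lemmas sbrk_simps = sbrk_ee sbrk_eo sbrk_oe sbrk_oo brk_even brk_eo_odd brk_oe_odd

lemma sbrk_part:
  assumes "x \<in> graded_part super_carrier super_parity p" "y \<in> graded_part super_carrier super_parity q"
  shows "sbrk x y \<in> graded_part super_carrier super_parity (p + q)"
proof -
  have "p = 0 \<or> p = 1" "q = 0 \<or> q = 1" by (cases p; simp)(cases q; simp)
  then show ?thesis
    using assms
    by (elim disjE) (simp_all add: super_part_even super_part_odd sbrk_ee sbrk_eo sbrk_oe brk_even
        brk_eo_odd brk_oe_odd sbrk_oo_even)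
qed

lemma sbrk_carrier: "x \<in> super_carrier \<Longrightarrow> y \<in> super_carrier \<Longrightarrow> sbrk x y \<in> super_carrier"
proof -
  assume "x \<in> super_carrier" "y \<in> super_carrier"
  then obtain a b c d where abcd: "a \<in> even_part" "b \<in> layer (-1)" "x = a + b"
    "c \<in> even_part" "d \<in> layer (-1)" "y = c + d" unfolding super_carrier_iff by blast
  have "sbrk x y = (brk a c + sbrk b d) + (brk a d + brk b c)"
    using abcd by (simp add: super.add_left super.add_right sbrk_ee sbrk_eo sbrk_oe)
  moreover have "brk a c + sbrk b d \<in> even_part"
    using abcd by (intro even_closed(1) brk_even sbrk_oo_even)
  moreover have "brk a d + brk b c \<in> layer (-1)"
    using abcd by (intro layer_closed(1) brk_eo_odd brk_oe_odd)
  ultimately show ?thesis unfolding super_carrier_iff by blast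
qed

lemma sbrk_anti:
  assumes "x \<in> graded_part super_carrier super_parity p" "y \<in> graded_part super_carrier super_parity q"
  shows "sbrk x y + koszul_sign p q *s sbrk y x = 0"
  using assms brk_anti[of x y] brk_anti[of "D x" y] brk_anti[of x "D y"]
  by (cases p; cases q) (simp_all add: super_part_even super_part_odd sbrk_simps koszul_sign_def)

text \<open>For odd \<open>x, y, z\<close> the vector \<open>triple x y z\<close> is symmetric up to multiples of \<open>x\<close>, \<open>y\<close>
  and \<open>z\<close>, and each of these multiples occurs three times in the sum over all permutations.\<close>

definition triple :: "'k::field^('n + 'r) \<Rightarrow> 'k^('n + 'r) \<Rightarrow> 'k^('n + 'r) \<Rightarrow> 'k^('n + 'r)" where
  "triple x y z = brk (brk (D x) y) z"

section \<open>Permutations of three odd elements in characteristic 3\<close>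

lemma odd_brk:
  assumes "x \<in> layer (-1)" "y \<in> layer (-1)"
  obtains c where "brk x y = c *s ff"
  using layer_minus_2[of "brk x y"] brk_layer[OF assms] by auto

lemma D_brk_ff: "x \<in> layer (-1) \<Longrightarrow> brk (D x) ff = x"
  using ff_D[of x] brk_anti[of "D x" ff] by simp

text \<open>Brackets under \<open>brk\<close> of odd elements lie on the line of \<open>ff\<close>.
  Exchanging the last two arguments is the Jacobi identity for \<open>D x\<close>, with
  \<open>brk (D x) ff = x\<close>; exchanging the first two is the derivation rule for
  \<open>D\<close>, with \<open>D ff = - hh\<close> and \<open>hh\<close> acting by -1 on
  \<open>z\<close>.\<close>

lemma triple_swap:
  assumes x: "x \<in> layer (-1)" and y: "y \<in> layer (-1)" and z: "z \<in> layer (-1)"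
    and a: "brk x y = a *s ff" and b: "brk y z = b *s ff"
  shows "triple x y z - triple x z y = b *s x" "triple x y z - triple y x z = a *s z"
proof -
  have "brk (D x) (brk y z) = triple x y z + brk y (brk (D x) z)"
    unfolding triple_def by (rule brk_jacobi)
  moreover have "brk y (brk (D x) z) = - triple x z y"
    unfolding triple_def by (rule brk_anti)
  moreover have "brk (D x) (brk y z) = b *s x"
    using D_brk_ff[OF x] by (simp add: b scale_right)
  ultimately show "triple x y z - triple x z y = b *s x" by simp
  have "brk (D x) y + brk x (D y) = a *s D ff"
    using D_derivation[of x y] by (simp add: a scale_right)
  then have "brk (D x) y - brk (D y) x = - (a *s hh)"
    using brk_anti[of x "D y"] by (simp add: brk_ef)
  then have "triple x y z - triple y x z = brk (- (a *s hh)) z"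
    unfolding triple_def diff_left[symmetric] by simp
  then show "triple x y z - triple y x z = a *s z"
    using brk_hh_layer[OF z] by (simp add: scale_left)
qed

lemma sbrk_triple:
  assumes "x \<in> layer (-1)" "y \<in> layer (-1)"
  shows "brk (sbrk x y) z = triple x y z + triple y x z"
  using assms brk_anti[of x "D y"] by (simp add: sbrk_oo triple_def add_left)

lemma triple_sum:
  assumes three: "(3::'k::field) = 0"
    and x: "x \<in> layer (-1)" and y: "y \<in> layer (-1)" and z: "(z :: 'k^('n + 'r)) \<in> layer (-1)"
  shows "triple x y z + triple y x z + triple y z x + triple z y x + triple z x y + triple x z y = 0"
proof -
  obtain a where a: "brk x y = a *s ff" using odd_brk[OF x y] .
  obtain b where b: "brk y z = b *s ff" using odd_brk[OF y z] .
  obtain c where c: "brk x z = c *s ff" using odd_brk[OF x z] .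
  have a': "brk y x = - a *s ff" and b': "brk z y = - b *s ff" and c': "brk z x = - c *s ff"
    using a b c brk_anti[of y x] brk_anti[of z y] brk_anti[of z x] by simp_all
  have 1: "triple x z y = triple x y z - b *s x" using triple_swap(1)[OF x y z a b] by (simp add: algebra_simps)
  have 2: "triple y x z = triple x y z - a *s z" using triple_swap(2)[OF x y z a b] by (simp add: algebra_simps)
  have 3: "triple z x y = triple x z y - c *s y"
    using triple_swap(2)[OF x z y c b'] by (simp add: algebra_simps)
  have 4: "triple y z x = triple y x z - c *s y"
    using triple_swap(1)[OF y x z a' c] by (simp add: algebra_simps)
  have 5: "triple z y x = triple z x y - a *s z"
    using triple_swap(1)[OF z x y c' a] by (simp add: algebra_simps)
  have "triple x y z + triple y x z + triple y z x + triple z y x + triple z x y + triple x z y =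
    (3 * 2) *s triple x y z - (3 * b) *s x - (3 * a) *s z - (3 * c) *s y"
    unfolding 5 4 3 2 1 by (simp add: vec_eq_iff algebra_simps)
  also have "\<dots> = 0" by (simp add: three)
  finally show ?thesis .
qed

text \<open>An even argument is killed by \<open>D\<close>, and then the identity follows from the
  Jacobi identity of \<open>brk\<close> and the derivation rule. For three odd arguments it says
  that the sum of \<open>triple\<close> over all permutations vanishes; this is the case that uses
  \<open>3 = 0\<close>.\<close>

lemma sbrk_jacobi:
  fixes x y z :: "'k::field^('n + 'r)"
  assumes three: "(3::'k) = 0"
    and "x \<in> graded_part super_carrier super_parity p" "y \<in> graded_part super_carrier super_parity q"
      "z \<in> graded_part super_carrier super_parity r"
  shows "sbrk x (sbrk y z) = sbrk (sbrk x y) z + koszul_sign p q *s sbrk y (sbrk x z)"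
proof -
  consider "x \<in> even_part" "p = 0" | "x \<in> layer (-1)" "p = 1"
    using assms(2) super_part_even super_part_odd by (cases p) auto
  note px = this
  consider "y \<in> even_part" "q = 0" | "y \<in> layer (-1)" "q = 1"
    using assms(3) super_part_even super_part_odd by (cases q) auto
  note py = this
  consider "z \<in> even_part" "r = 0" | "z \<in> layer (-1)" "r = 1"
    using assms(4) super_part_even super_part_odd by (cases r) auto
  note pz = this
  note s = sbrk_ee sbrk_eo sbrk_oe brk_even brk_eo_odd brk_oe_odd koszul_sign_def sbrk_oo_even
  have J: "brk x (brk y z) = brk (brk x y) z + brk y (brk x z)" for x y z :: "'k^('n + 'r)"
    by (rule brk_jacobi)
  have d: "D (brk x y) = brk x (D y)" if "x \<in> even_part" for x y :: "'k^('n + 'r)"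
    using that by (simp add: D_derivation even_D)
  have d': "D (brk y x) = brk (D y) x" if "x \<in> even_part" for x y :: "'k^('n + 'r)"
    using that by (simp add: D_derivation even_D)
  show ?thesis
  proof (cases rule: px)
    case x: 1
    show ?thesis
    proof (cases rule: py)
      case y: 1
      show ?thesis by (cases rule: pz) (use x y in \<open>simp_all add: s J[of x y z]\<close>)
    next
      case y: 2
      show ?thesis
      proof (cases rule: pz)
        case z: 1
        show ?thesis using x y z by (simp add: s J[of x y z])
      next
        case z: 2
        have "sbrk x (sbrk y z) = brk x (brk (D y) z - brk y (D z))"
          using sbrk_ee[OF x(1) sbrk_oo_even[OF y(1) z(1)]] y z by (simp add: sbrk_oo)
        then show ?thesis
          using x y z J[of x "D y" z] J[of x y "D z"]
          by (simp add: sbrk_eo sbrk_oo brk_eo_odd koszul_sign_def d diff_right)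
      qed
    qed
  next
    case x: 2
    show ?thesis
    proof (cases rule: py)
      case y: 1
      show ?thesis
      proof (cases rule: pz)
        case z: 1
        show ?thesis using x y z by (simp add: s J[of x y z])
      next
        case z: 2
        have "brk (D x) (brk y z) - brk x (D (brk y z)) =
            (brk (D (brk x y)) z - brk (brk x y) (D z)) + brk y (brk (D x) z - brk x (D z))"
          using J[of "D x" y z] J[of x y "D z"] y by (simp add: d d' diff_right)
        moreover have "sbrk y (sbrk x z) = brk y (brk (D x) z - brk x (D z))"
          using sbrk_ee[OF y(1) sbrk_oo_even[OF x(1) z(1)]] x z by (simp add: sbrk_oo)
        ultimately show ?thesis
          using x y z by (simp add: sbrk_eo sbrk_oe sbrk_oo brk_eo_odd brk_oe_odd koszul_sign_def)
      qed
    next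
      case y: 2
      show ?thesis
      proof (cases rule: pz)
        case z: 1
        have "brk (D x) (brk y z) - brk x (D (brk y z)) =
            brk (brk (D x) y - brk x (D y)) z - (brk (D y) (brk x z) - brk y (D (brk x z)))"
          using J[of "D x" y z] J[of x "D y" z] brk_anti[of y "brk (D x) z"] brk_anti[of "D y" "brk x z"] z
          by (simp add: d' diff_left) 
        moreover have "sbrk (sbrk x y) z = brk (brk (D x) y - brk x (D y)) z"
          using sbrk_ee[OF sbrk_oo_even[OF x(1) y(1)] z(1)] x y by (simp add: sbrk_oo)
        ultimately show ?thesis
          using x y z by (simp add: sbrk_oe sbrk_oo brk_oe_odd koszul_sign_def)
      next
        case z: 2
        note o = x(1) y(1) z(1)
        have "brk x (sbrk y z) = - brk (sbrk y z) x" "brk y (sbrk x z) = - brk (sbrk x z) y"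
          by (rule brk_anti)+
        moreover have "brk (sbrk y z) x + brk (sbrk x y) z + brk (sbrk x z) y = 0"
          using triple_sum[OF three o] o by (simp add: sbrk_triple add_ac)
        moreover have "- a = b + c" if "a + b + c = 0" for a b c :: "'k^('n + 'r)"
          using that by (simp add: minus_unique add.assoc)
        ultimately have "brk x (sbrk y z) = brk (sbrk x y) z - brk y (sbrk x z)"
          by simp
        moreover have "sbrk x (sbrk y z) = brk x (sbrk y z)" "sbrk (sbrk x y) z = brk (sbrk x y) z"
          "sbrk y (sbrk x z) = brk y (sbrk x z)"
          using o by (simp_all add: sbrk_oe sbrk_eo sbrk_oo_even)
        ultimately show ?thesis using x y by (simp add: koszul_sign_def)
      qed
    qed
  qed
qed

lemma triple_linear:
  "triple (x + x') y z = triple x y z + triple x' y z" "triple x (y + y') z = triple x y z + triple x y' z"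
  "triple x y (z + z') = triple x y z + triple x y z'" "triple (c *s x) y z = c *s triple x y z"
  "triple x (c *s y) z = c *s triple x y z" "triple x y (c *s z) = c *s triple x y z"
  by (simp_all add: triple_def add_left add_right scale_left scale_right)

text \<open>\<open>triple_sum\<close> with a repeated argument removes the mixed terms, so the cubic
  form \<open>triple x x x\<close> is additive on degree -1 and it is enough to treat multiples of
  root vectors.\<close>

lemma triple_cube:
  assumes char: "CHAR('k::field) = 3" and x: "(x :: 'k^('n + 'r)) \<in> layer (-1)"
  shows "triple x x x = 0"
proof -
  have three: "(3::'k) = 0" using of_nat_CHAR[where 'a='k] by (simp add: char)
  have two: "(2::'k) \<noteq> 0"
  proof
    assume "(2::'k) = 0"
    then have "(3::'k) - 2 = 0" using three by simp
    then show False by simp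
  qed
  have root: "triple (evec v) (evec v) (evec v) = (0 :: 'k^('n + 'r))" if "is_root v" "pair v \<theta> = -1" for v
  proof -
    have "is_root (\<theta> + v)" using that root_sum_iff[of \<theta> v] by (simp add: pair_sym[of \<theta>])
    \<comment> \<open>\<open>D\<close> turns the root \<open>v\<close> into
      \<open>\<theta> + v\<close>, whose pairing with \<open>v\<close> is \<open>-1 + 2 = 1\<close>,
      so the next bracket vanishes.\<close>
    then have "brk (D (evec v)) (evec v) = (0 :: 'k^('n + 'r))"
      using that by (simp add: ee_def brk_ee pair_sym[of \<theta>] scale_left root_pair_self)
    then show ?thesis by (simp add: triple_def)
  qed
  have add: "triple (x + y) (x + y) (x + y) = triple x x x + triple y y y"
    if "x \<in> layer (-1)" "y \<in> layer (-1)" for x y :: "'k^('n + 'r)"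
  proof -
    have h: "triple x x y + triple x y x + triple y x x = 0"
      if "x \<in> layer (-1)" "y \<in> layer (-1)" for x y :: "'k^('n + 'r)"
    proof -
      \<comment> \<open>With \<open>x\<close> repeated, the six permutations give each of the three
        arrangements twice.\<close>
      have "2 *s (triple x x y + triple x y x + triple y x x) = 0"
        using triple_sum[OF three that(1) that(1) that(2)] by (simp add: vec_eq_iff algebra_simps)
      then show ?thesis using two unfolding vec.scale_eq_0_iff by blast
    qed
    have "triple (x + y) (x + y) (x + y) = triple x x x + triple y y y +
        (triple x x y + triple x y x + triple y x x) + (triple y y x + triple y x y + triple x y y)"
      by (simp add: triple_linear algebra_simps)
    then show ?thesis using h[OF that] h[OF that(2,1)] by simp
  qed
  let ?u = "\<lambda>r. x $ Inr r *s evec (rt r)"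
  have "hvec (\<chi> i. x $ Inl i) = 0"
    using x by (auto simp: vec_eq_iff hvec_def graded_part_def grade_def wt_def split: sum.splits)
  then have xs: "x = (\<Sum>r\<in>UNIV. ?u r)" using vec_expand[of x] by simp
  have u: "?u r \<in> layer (-1) \<and> triple (?u r) (?u r) (?u r) = 0" for r
  proof (cases "x $ Inr r = 0")
    case False
    then have "pair (rt r) \<theta> = -1" using x by (auto simp: graded_part_def grade_def wt_def)
    then show ?thesis
      using root[OF rt_root] evec_layer[of "rt r"] layer_closed(4)[of "evec (rt r)" "-1" "x $ Inr r"]
      by (simp add: triple_linear)
  qed (simp add: layer_closed triple_linear triple_def)
  have "(\<Sum>r\<in>A. ?u r) \<in> layer (-1) \<and> triple (\<Sum>r\<in>A. ?u r) (\<Sum>r\<in>A. ?u r) (\<Sum>r\<in>A. ?u r) = 0"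
    if "finite A" for A
    using that
  proof (induction A rule: finite_induct)
    case (insert r A)
    then show ?case using u[of r] add[of "?u r" "\<Sum>r\<in>A. ?u r"] layer_closed(1)[of "?u r" "-1"] by simp
  qed (simp add: layer_closed triple_def)
  from this[of UNIV] show ?thesis using xs by simp
qed

lemma sbrk_cube:
  assumes "CHAR('k::field) = 3" and "(x :: 'k^('n + 'r)) \<in> graded_part super_carrier super_parity 1"
  shows "sbrk x (sbrk x x) = 0"
proof -
  have x: "x \<in> layer (-1)" using assms(2) by (simp add: super_part_odd)
  have "brk (sbrk x x) x = 0"
    using sbrk_triple[OF x x, of x] triple_cube[OF assms(1) x] by simp
  then show ?thesis
    using sbrk_oe[OF x sbrk_oo_even[OF x x]] brk_anti[of x "sbrk x x"] by simp
qed

end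

text \<open>\<open>ext\<close> is a leaf of the Dynkin diagram, with \<open>p\<close> as its only
  neighbour. The map \<open>\<sigma>\<close> labels the remaining nodes by the index type of the
  smaller matrix, and \<open>q\<close> is the label of \<open>p\<close>, the node that becomes
  odd.\<close>

locale simply_laced_node = simply_laced_basis gram rt
  for gram :: "int^'n::finite^'n" and rt :: "'r::finite \<Rightarrow> int^'n" +
  fixes ext p :: 'n and \<sigma> :: "'l::finite \<Rightarrow> 'n" and q :: 'l
  assumes op: "ext \<noteq> p" and pair_op: "pair (simple ext) (simple p) = -1"
    and pair_o: "i \<noteq> ext \<Longrightarrow> i \<noteq> p \<Longrightarrow> pair (simple ext) (simple i) = 0"
    and sigma_inj: "inj \<sigma>" and sigma_range: "range \<sigma> = UNIV - {ext}" and sigma_q: "\<sigma> q = p"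
begin

sublocale simply_laced_root gram rt "simple ext"
  by unfold_locales simp

abbreviation "\<theta> \<equiv> simple ext"

lemma sigma_o [simp]: "\<sigma> l \<noteq> ext" "ext \<noteq> \<sigma> l"
  using sigma_range by auto

lemma sigma_p [simp]: "\<sigma> l = p \<longleftrightarrow> l = q"
  using sigma_inj sigma_q by (auto simp: inj_def)

lemma pair_p: "pair (simple p) \<theta> = -1"
  and pair_other: "i \<noteq> ext \<Longrightarrow> i \<noteq> p \<Longrightarrow> pair (simple i) \<theta> = 0"
  using pair_op pair_o[of i] pair_sym[of "simple p" \<theta>] pair_sym[of "simple i" \<theta>] by simp_all

lemma pair_sigma: "pair (simple (\<sigma> l)) \<theta> = (if l = q then -1 else 0)"
  using pair_other[of "\<sigma> l"] pair_p by (auto simp: sigma_q)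

lemma ex_sigma: "i \<noteq> ext \<Longrightarrow> \<exists>l. i = \<sigma> l"
  using sigma_range by blast

lemma pair_theta_eq:
  fixes v :: "int^'n"
  shows "pair v \<theta> = 2 * v $ ext - v $ p"
proof -
  have "pair v \<theta> = (\<Sum>i\<in>UNIV. v $ i * pair (simple i) \<theta>)" by (rule pair_expand)
  also have "\<dots> = (\<Sum>i\<in>{ext, p}. v $ i * pair (simple i) \<theta>)"
    using pair_other by (intro sum.mono_neutral_right) auto
  finally show ?thesis using op pair_p by simp
qed

text \<open>The bracket of two odd elements involves \<open>D\<close> once and so shifts the lattice
  weight by \<theta>. Weights become additive once the coordinate at \<open>ext\<close> is dropped:
  this sends \<theta> to 0 and keeps the other simple roots.\<close>

definition forget :: "int^'n \<Rightarrow> int^'l" where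
  "forget v = (\<chi> l. v $ \<sigma> l)"

lemma forget_simps: "forget (v + w) = forget v + forget w" "forget (- v) = - forget v"
  "forget (v - w) = forget v - forget w" "forget 0 = 0" "forget \<theta> = 0" "forget (simple (\<sigma> l)) = axis l 1"
  using sigma_inj by (auto simp: forget_def vec_eq_iff axis_def inj_def)

abbreviation "swt \<equiv> forget \<circ> wt"

text \<open>In degrees 0 and -1 the dropped coordinate can be recovered:
  \<open>2 * v $ ext - v $ p\<close> is 0 or -1, and the parity of \<open>v $ p\<close> decides
  which.\<close>

lemma swt_inj:
  assumes "forget v = forget w" "pair v \<theta> \<in> {0, -1}" "pair w \<theta> \<in> {0, -1}"
  shows "v = w"
proof -
  have s: "v $ i = w $ i" if "i \<noteq> ext" for i
    using assms(1) ex_sigma[OF that] by (auto simp: forget_def vec_eq_iff)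
  then have "v $ p = w $ p" using op by simp
  then have "v $ ext = w $ ext"
  proof -
    have "2 * v $ ext - v $ p = 0 \<or> 2 * v $ ext - v $ p = -1"
      "2 * w $ ext - w $ p = 0 \<or> 2 * w $ ext - w $ p = -1"
      using assms(2,3) unfolding pair_theta_eq by auto
    then show ?thesis using \<open>v $ p = w $ p\<close> by presburger
  qed
  then show ?thesis using s by (auto simp: vec_eq_iff) (metis)
qed

lemma sbrk_weight:
  assumes x: "x \<in> graded_part super_carrier swt d" and y: "y \<in> graded_part super_carrier swt d'"
  shows "sbrk x y \<in> graded_part super_carrier swt (d + d')"
proof -
  let ?G = "graded_part UNIV swt"
  have c: "comp k z \<in> ?G e" if "z \<in> ?G e" for z :: "'a^('n + 'r)" and e k
    using that by (auto simp: graded_part_def comp_def split: if_splits)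
  have b: "brk z w \<in> ?G (e + e')" if "z \<in> ?G e" "w \<in> ?G e'" for z w :: "'a^('n + 'r)" and e e'
    using brk_graded[of forget z e w e'] that by (simp add: forget_simps)
  have e: "ee \<in> ?G 0"
    using evec_graded[of \<theta>] by (auto simp: ee_def graded_part_def forget_simps)
  have D: "D z \<in> ?G e" if "z \<in> ?G e" for z :: "'a^('n + 'r)" and e
    using b[OF e that] by simp
  have s: "vec.subspace (?G e :: ('a^('n + 'r)) set)" for e by (rule graded_part_subspace) simp
  have xy: "x \<in> ?G d" "y \<in> ?G d'" using x y by (auto simp: graded_part_def)
  have "sbrk x y \<in> ?G (d + d')"
    unfolding sbrk_def by (intro vec.subspace_add[OF s] vec.subspace_diff[OF s] b c D xy)
  moreover have "sbrk x y \<in> super_carrier" using x y by (intro sbrk_carrier) (auto simp: graded_part_def)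
  ultimately show ?thesis by (simp add: graded_part_def)
qed

lemma evec_even: "pair v \<theta> = 0 \<Longrightarrow> evec v \<in> even_part"
proof (cases "is_root v")
  case True
  assume v: "pair v \<theta> = 0"
  have "D (evec v) = 0" using True v by (simp add: ee_def brk_ee pair_sym[of \<theta>])
  then show ?thesis using evec_layer[of v] v by (simp add: even_part_def)
qed (simp add: evec_nonroot vec.subspace_0[OF even_part_subspace])

lemma evec_odd: "pair v \<theta> = -1 \<Longrightarrow> evec v \<in> layer (-1)"
  using evec_layer[of v] by simp

lemma D_evec: "is_root v \<Longrightarrow> pair v \<theta> = -1 \<Longrightarrow> D (evec v) = eps \<theta> v *s evec (\<theta> + v)"
  by (simp add: ee_def brk_ee pair_sym[of \<theta>])

lemma root_theta_add: "is_root v \<Longrightarrow> pair v \<theta> = -1 \<Longrightarrow> is_root (\<theta> + v)"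
  using root_sum_iff[of \<theta> v] by (simp add: pair_sym[of \<theta>])

text \<open>Both halves of the bracket reach the vector of \<open>v + w + \<theta>\<close>, and
  since \<open>eps v \<theta> = - eps \<theta> v\<close> they add up instead of cancelling; the
  factor 2 is invertible in characteristic 3.\<close>

lemma sbrk_odd_roots:
  assumes v: "is_root v" "pair v \<theta> = -1" and w: "is_root w" "pair w \<theta> = -1" and vw: "pair v w = 0"
  shows "sbrk (evec v) (evec w) = (2 * eps \<theta> v * eps \<theta> w * eps v w) *s (evec (v + w + \<theta>) :: 'k::field^('n + 'r))"
proof -
  have s: "eps v \<theta> = (- eps \<theta> v :: 'k)" using v(2) eps_swap[of v \<theta>] by (simp add: pair_sym[of \<theta>])
  have 1: "brk (D (evec v)) (evec w) = (eps \<theta> v * (eps \<theta> w * eps v w)) *s (evec (v + w + \<theta>) :: 'k^('n + 'r))"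
    using v w vw root_theta_add[OF v]
    by (simp add: D_evec brk_ee scale_left pair_sym[of \<theta> w] add_ac)
  have 2: "brk (evec v) (D (evec w)) = - ((eps \<theta> v * (eps \<theta> w * eps v w)) *s (evec (v + w + \<theta>) :: 'k^('n + 'r)))"
    using v w vw root_theta_add[OF w]
    by (simp add: D_evec brk_ee scale_right s add_ac mult_ac vec.scale_minus_left)
  show ?thesis
    unfolding sbrk_oo[OF evec_odd[OF v(2)] evec_odd[OF w(2)]] 1 2 by (simp add: vec_eq_iff)
qed

text \<open>The root \<open>- v - \<theta>\<close> is the odd one whose weight is opposite to that
  of \<open>v\<close> after \<theta> is forgotten. The two halves of the bracket contribute the
  coroots of \<open>\<theta> + v\<close> and of \<open>v\<close> with equal sign, hence the sum
  \<open>v + v + \<theta>\<close>.\<close>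

lemma sbrk_odd_opposite:
  assumes v: "is_root v" "pair v \<theta> = -1"
  shows "sbrk (evec v) (evec (- v - \<theta>)) = - (eps \<theta> v *s (hvec (red (v + v + \<theta>)) :: 'k::field^('n + 'r)))"
proof -
  have r: "is_root (\<theta> + v)" by (rule root_theta_add[OF v])
  have w: "is_root (- v - \<theta>)" "pair (- v - \<theta>) \<theta> = -1"
    using r v root_neg[of "\<theta> + v"] by (simp_all add: algebra_simps)
  have "brk (D (evec v)) (evec (- v - \<theta>)) = eps \<theta> v *s brk (evec (\<theta> + v)) (evec (- (\<theta> + v)) :: 'k^('n + 'r))"
    using v by (simp add: D_evec scale_left algebra_simps)
  also have "\<dots> = - (eps \<theta> v *s hvec (red (\<theta> + v)))"
    using r by (simp add: brk_ee root_pair_self del: minus_add_distrib pair_bilinear(1,2))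
  finally have 1: "brk (D (evec v)) (evec (- v - \<theta>)) = - (eps \<theta> v *s (hvec (red (\<theta> + v)) :: 'k^('n + 'r)))" .
  have "eps \<theta> (- v - \<theta>) = (- eps \<theta> v :: 'k)"
    using eps_simps(2)[of \<theta> "- v" "- \<theta>"] by (simp add: eps_self)
  then have "D (evec (- v - \<theta>)) = - (eps \<theta> v *s (evec (- v) :: 'k^('n + 'r)))"
    unfolding D_evec[OF w] by simp
  then have 2: "brk (evec v) (D (evec (- v - \<theta>))) = eps \<theta> v *s (hvec (red v) :: 'k^('n + 'r))"
    using v by (simp add: scale_right brk_ee root_pair_self)
  show ?thesis
    unfolding sbrk_oo[OF evec_odd[OF v(2)] evec_odd[OF w(2)]] 1 2 red_linear hvec_linear
    by (simp add: vec_eq_iff algebra_simps)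
qed

text \<open>\<open>D\<close> does not kill the coroot of \<open>p\<close>; subtracting \<theta>
  turns its pairing with \<theta> into -3, which is 0 in the field.\<close>

definition coroot_lift :: "'l \<Rightarrow> int^'n" where
  "coroot_lift l = simple (\<sigma> l) - (if l = q then \<theta> else 0)"

definition egen :: "'l \<Rightarrow> 'k::field^('n + 'r)" where
  "egen l = evec (simple (\<sigma> l))"

text \<open>For \<open>q\<close> the factor \<open>eps\<close> cancels the one in
  \<open>sbrk_odd_opposite\<close>; for the other nodes the minus sign compensates that in the
  bracket of opposite root vectors.\<close>

definition fgen :: "'l \<Rightarrow> 'k::field^('n + 'r)" where
  "fgen l = (if l = q then eps \<theta> (simple p) *s evec (- simple p - \<theta>) else - evec (- simple (\<sigma> l)))"

text \<open>Otherwise \<open>\<theta> - v\<close> is positive, which forces \<open>v $ p = 0\<close>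
  and makes \<open>pair v \<theta> = 2 * v $ ext\<close> even.\<close>

lemma positive_sub_theta:
  assumes v: "positive v" "pair v \<theta> = 1"
  shows "positive (v - \<theta>)"
proof -
  have r: "is_root (v - \<theta>)" using v root_diff_iff[of v \<theta>] by (simp add: positive_def)
  have "positive (v - \<theta>) \<or> positive (\<theta> - v)" using positive_or_neg[OF r] by simp
  moreover have False if n: "positive (\<theta> - v)"
  proof -
    have "v $ p \<le> 0" using n op by (auto simp: positive_def axis_def dest: spec[of _ p])
    moreover have "v $ p \<ge> 0" using v by (simp add: positive_def)
    ultimately have "pair v \<theta> = 2 * v $ ext" by (simp add: pair_theta_eq)
    then show False using v(2) by presburger
  qed
  ultimately show ?thesis by blast
qed

lemma pair_low: "pair (- simple p - \<theta>) \<theta> = -1"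
  using pair_p by simp

lemma root_low: "is_root (- simple p - \<theta>)"
proof -
  have "- simple p - \<theta> = - (\<theta> + simple p)" by simp
  then show ?thesis using root_theta_add[OF simple_root pair_p] by (simp only: root_neg)
qed

text \<open>Root vectors are reached by induction on the height of a positive root \<open>v\<close>,
  treating \<open>v\<close> and \<open>- v\<close> together. Subtracting a simple root may leave the
  degrees 0 and -1; then \<theta> is subtracted as well, and the bracket of two odd elements, which
  adds \<theta>, makes up for it.\<close>

lemma generated:
  assumes char: "CHAR('k::field) = 3"
    and T: "vec.subspace T" "\<And>x y. x \<in> T \<Longrightarrow> y \<in> T \<Longrightarrow> sbrk x y \<in> T"
    and e: "\<And>l. egen l \<in> T" and f: "\<And>l. fgen l \<in> T"
    and h: "\<And>l. hvec (red (coroot_lift l)) \<in> T"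
  shows "super_carrier \<subseteq> (T :: ('k^('n + 'r)) set)"
proof -
  have three: "(3::'k) = 0" using of_nat_CHAR[where 'a='k] by (simp add: char)
  have two: "(2::'k) \<noteq> 0"
  proof
    assume "(2::'k) = 0"
    then have "(3::'k) - 2 = 0" using three by simp
    then show False by simp
  qed
  have unscale: "u \<in> T" if "c *s u \<in> T" "c \<noteq> 0" for c :: 'k and u
    using vec.subspace_scale[OF T(1) that(1), of "inverse c"] that(2) by simp
  have e': "evec (simple (\<sigma> l)) \<in> T" for l using e[of l] by (simp add: egen_def)
  have f': "evec (- simple (\<sigma> l)) \<in> T" if "l \<noteq> q" for l
    using f[of l] vec.subspace_neg[OF T(1), of "fgen l"] that by (simp add: fgen_def)
  have fp: "evec (- simple p - \<theta>) \<in> T"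
    using f[of q] unscale[of "eps \<theta> (simple p)"] by (simp add: fgen_def)
  have ep: "evec (simple p) \<in> T" using e'[of q] by (simp add: sigma_q)
  have add: "evec (v + w) \<in> T"
    if "is_root v" "is_root w" "pair v w = -1" "evec v \<in> T" "evec w \<in> T"
      "pair v \<theta> = 0 \<and> pair w \<theta> \<in> {0, -1}" for v w
  proof -
    have "sbrk (evec v) (evec w) = brk (evec v) (evec w :: 'k^('n + 'r))"
      using that(6) evec_even evec_odd sbrk_ee sbrk_eo by blast
    then have "sbrk (evec v) (evec w) = eps v w *s (evec (v + w) :: 'k^('n + 'r))"
      using that by (simp add: brk_ee)
    then show ?thesis using unscale[of "eps v w"] T(2)[OF that(4,5)] by simp
  qed
  have add': "evec (v + w + \<theta>) \<in> T"
    if "is_root v" "is_root w" "pair v w = 0" "evec v \<in> T" "evec w \<in> T" "pair v \<theta> = -1" "pair w \<theta> = -1" for v w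
    using sbrk_odd_roots[OF that(1,6,2,7,3), where 'k='k] T(2)[OF that(4,5)] two
      unscale[of "2 * eps \<theta> v * eps \<theta> w * eps v w" "evec (v + w + \<theta>)"] by simp
  note rp = root_low pair_low
  have ps: "pair (simple i) (simple i) = 2" for i by (simp add: root_pair_self)
  note pp = pair_p
  \<comment> \<open>The degree of \<open>- v\<close> is minus that of \<open>v\<close>, so the
    vector of \<open>- v\<close> belongs to the carrier when \<open>v\<close> has degree 0 or
    1.\<close>
  have main: "(pair v \<theta> \<in> {0, -1} \<longrightarrow> evec v \<in> T) \<and> (pair v \<theta> \<in> {0, 1} \<longrightarrow> evec (- v) \<in> T)"
    if "positive v" for v
    using that
  proof (induction rule: positive_induct)
    case (simple i)
    show ?case
    proof (cases "i = ext")
      case False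
      then obtain l where l: "i = \<sigma> l" using ex_sigma by blast
      show ?thesis using e'[of l] f'[of l] pair_sigma[of l] by (auto simp: l)
    qed simp
  next
    case (step v)
    have r: "is_root v" using step(1) by (simp add: positive_def)
    have IHA: "evec w \<in> T" if "positive w" "ht w < ht v" "pair w \<theta> \<in> {0, -1}" for w
      using step.IH that by blast
    have IHB: "evec (- w) \<in> T" if "positive w" "ht w < ht v" "pair w \<theta> \<in> {0, 1}" for w
      using step.IH that by blast
    obtain i where i: "pair v (simple i) = 1" "positive (v - simple i)"
      using positive_step[OF step(1,2)] by blast
    have rw: "is_root (v - simple i)" using i(2) by (simp add: positive_def)
    have hw: "ht (v - simple i) < ht v" by (simp add: ht_simps)
    have pw: "pair (simple i) (v - simple i) = -1" using i(1) by (simp add: pair_sym[of "simple i" v] ps)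
    have pw': "pair (v - simple i) (simple i) = -1" using pw by (simp only: pair_sym[of "v - simple i"])
    have pw2: "pair (- simple i) (- (v - simple i)) = -1"
      using pw by (simp only: pair_bilinear(3,4) minus_minus)
    have rw2: "is_root (- (v - simple i))" "is_root (- simple i)" using rw by (simp_all only: root_neg simple_root)
    have A: "evec v \<in> T" if g: "pair v \<theta> \<in> {0, -1}"
    proof -
      have "i \<noteq> ext" using g i(1) by auto
      then obtain l where l: "i = \<sigma> l" using ex_sigma by blast
      show ?thesis
      proof (cases "l = q")
        case False
        then have gs: "pair (simple i) \<theta> = 0" using pair_sigma[of l] by (simp add: l)
        then have gw: "pair (v - simple i) \<theta> \<in> {0, -1}" using g by simp
        have "evec (simple i) \<in> T" using e'[of l] by (simp add: l)
        from add[OF simple_root rw pw this IHA[OF i(2) hw gw]] gs gw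
        show ?thesis by simp
      next
        case True
        then have ip: "i = p" using l sigma_q by simp
        show ?thesis
        proof (cases "pair v \<theta> = -1")
          case True
          then have gw: "pair (v - simple i) \<theta> = 0" using pp by (simp add: ip)
          have "evec (simple i) \<in> T" using ep by (simp add: ip)
          from add[OF rw simple_root pw' IHA[OF i(2) hw] this] gw pp ip
          show ?thesis by simp
        next
          case False
          then have g0: "pair v \<theta> = 0" using g by simp
          then have gw: "pair (v - simple i) \<theta> = 1" using pp by (simp add: ip)
          \<comment> \<open>The root \<open>v - simple p\<close> has degree 1 and its vector is not
            in the carrier; lowering it by \<theta> gives an odd root \<open>u\<close> with
            \<open>v = simple p + u + \<theta>\<close>.\<close>
          define u where "u = v - simple i - \<theta>"
          have u: "positive u" unfolding u_def by (rule positive_sub_theta[OF i(2) gw])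
          have gu: "pair u \<theta> = -1" using gw by (simp add: u_def del: pair_bilinear(8))
          have pu: "pair (simple p) u = 0" using pw pp by (simp add: u_def ip)
          have ru: "is_root u" and hu: "ht u < ht v" using u by (simp_all add: positive_def u_def ht_simps)
          from add'[OF simple_root ru pu ep IHA[OF u hu] pp gu] gu
          show ?thesis by (simp add: u_def ip)
        qed
      qed
    qed
    have B: "evec (- v) \<in> T" if g: "pair v \<theta> \<in> {0, 1}"
    proof (cases "pair v \<theta> = 0")
      case True
      then have "i \<noteq> ext" using i(1) by auto
      then obtain l where l: "i = \<sigma> l" using ex_sigma by blast
      show ?thesis
      proof (cases "l = q")
        case False
        then have gs: "pair (simple i) \<theta> = 0" using pair_sigma[of l] by (simp add: l)
        then have gw: "pair (v - simple i) \<theta> = 0" using True by simp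
        have "evec (- simple i) \<in> T" using f'[OF False] by (simp add: l)
        from add[OF rw2(2,1) pw2 this IHB[OF i(2) hw]] gs gw
        show ?thesis by simp
      next
        case lq: True
        then have ip: "i = p" using l sigma_q by simp
        have gw: "pair (v - simple i) \<theta> = 1" using pp True by (simp add: ip)
        \<comment> \<open>The odd roots \<open>- simple p - \<theta>\<close> and
          \<open>- (v - simple p)\<close> are orthogonal, and with \<theta> added their sum is
          \<open>- v\<close>.\<close>
        have "pair (- simple p - \<theta>) (- (v - simple i)) = 0"
          using pw gw by (simp add: ip pair_sym[of \<theta>])
        from add'[OF rp(1) rw2(1) this fp IHB[OF i(2) hw] rp(2)] gw
        show ?thesis by (simp add: ip)
      qed
    next
      case False
      then have g1: "pair v \<theta> = 1" using g by simp
      \<comment> \<open>For \<open>v\<close> of degree 1 the simple root found for \<open>v\<close>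
        may be \<theta> itself. The descent is therefore made from \<open>v - \<theta>\<close>,
        which is positive of degree -1.\<close>
      define w where "w = v - \<theta>"
      have w: "positive w" unfolding w_def by (rule positive_sub_theta[OF step(1) g1])
      have gw: "pair w \<theta> = -1" using g1 by (simp add: w_def)
      show ?thesis
      proof (cases "w = simple p")
        case True
        then have "- v = - simple p - \<theta>" by (simp add: w_def algebra_simps)
        then show ?thesis using fp by simp
      next
        case False
        have "w \<noteq> simple j" for j
        proof
          assume j: "w = simple j"
          then have "j \<noteq> ext" "j \<noteq> p" using gw False by auto
          then show False using gw pair_other[of j] by (simp add: j)
        qed
        then obtain j where j: "pair w (simple j) = 1" "positive (w - simple j)"
          using positive_step[OF w] by blast
        have "j \<noteq> ext" using j(1) gw by auto
        then obtain l where l: "j = \<sigma> l" using ex_sigma by blast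
        have rj: "is_root (w - simple j)" using j(2) by (simp add: positive_def)
        show ?thesis
        proof (cases "l = q")
          case False
          have gj: "pair (simple j) \<theta> = 0" using pair_sigma[of l] False by (simp add: l)
          have pj: "pair v (simple j) = 1" using j(1) gj by (simp add: w_def pair_sym[of \<theta>])
          have rv: "is_root (v - simple j)" using root_diff_iff[OF r, of "simple j"] pj by simp
          have "(v - simple j) $ k \<ge> 0" for k
            using j(2) unfolding positive_def w_def
            by (cases "k = ext") (auto simp: axis_def dest: spec[of _ k])
          then have pos: "positive (v - simple j)" using rv by (simp add: positive_def)
          have gv: "pair (v - simple j) \<theta> = 1" using gj g1 by simp
          have "pair (- simple j) (- (v - simple j)) = -1"
            using pj pair_sym[of "simple j" v] ps[of j] by simp
          moreover have "is_root (- simple j)" "is_root (- (v - simple j))"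
            using rv by (simp_all only: root_neg simple_root)
          moreover have "evec (- simple j) \<in> T" using f'[OF False] by (simp add: l)
          moreover have "evec (- (v - simple j)) \<in> T"
            using IHB[OF pos] gv by (simp add: ht_simps)
          ultimately have "evec (- simple j + - (v - simple j)) \<in> T"
            using add[of "- simple j" "- (v - simple j)"] gj gv by (simp del: minus_diff_eq)
          then show ?thesis by simp
        next
          case True
          then have jp: "j = p" using l sigma_q by simp
          have gj: "pair (w - simple j) \<theta> = 0" using gw pp by (simp add: jp)
          \<comment> \<open>Here \<open>- v\<close> splits as \<open>- (w - simple p)\<close>, of
            degree 0, plus the odd root \<open>- simple p - \<theta>\<close>.\<close>
          have "pair (- (w - simple j)) (- simple p - \<theta>) = -1"
            using j(1) gj ps[of p] by (simp add: jp)
          moreover have "is_root (- (w - simple j))" using rj by (simp only: root_neg)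
          moreover have "ht (w - simple j) < ht v" by (simp add: ht_simps w_def)
          moreover from this have "evec (- (w - simple j)) \<in> T" using IHB[OF j(2)] gj by simp
          moreover have "pair (- (w - simple j)) \<theta> = 0" using gj by (simp only: pair_bilinear(3) minus_zero)
          ultimately have "evec (- (w - simple j) + (- simple p - \<theta>)) \<in> T"
            using add[OF _ rp(1) _ _ fp] rp(2) by blast
          then show ?thesis by (simp add: jp w_def)
        qed
      qed
    qed
    show ?case using A B by blast
  qed
  have roots: "evec v \<in> T" if "is_root v" "pair v \<theta> \<in> {0, -1}" for v
    using positive_or_neg[OF that(1)] main[of v] main[of "- v"] that(2) by auto
  show ?thesis
  proof
    fix x :: "'k^('n + 'r)" assume x: "x \<in> super_carrier"
    define c :: "'k^'n" where "c = (\<chi> i. x $ Inl i)"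
    let ?u = "\<lambda>r. x $ Inr r *s evec (rt r) :: 'k^('n + 'r)"
    have xs: "x = hvec c + (\<Sum>r\<in>UNIV. ?u r)" unfolding c_def by (rule vec_expand)
    have g: "pair (rt r) \<theta> \<in> {0, -1}" if "x $ Inr r \<noteq> 0" for r
      using x that by (auto simp: super_carrier_def grade_def wt_def)
    have u: "?u r \<in> T" for r
      using roots[OF rt_root g, of r] vec.subspace_scale[OF T(1)] vec.subspace_0[OF T(1)]
      by (cases "x $ Inr r = 0") auto
    have Du: "D (comp 0 (?u r)) = 0" for r
    proof (cases "pair (rt r) \<theta> = 0")
      case True
      then show ?thesis
        by (simp add: comp_linear scale_right comp_even(1)[OF evec_even] even_D[OF evec_even])
    next
      case False
      then show ?thesis by (simp add: comp_linear comp_of_layer[OF evec_layer])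
    qed
    have "D (comp 0 x) = D (comp 0 (hvec c)) + (\<Sum>r\<in>UNIV. D (comp 0 (?u r)))"
      by (subst xs) (simp only: comp_linear comp_sum add_right sum_right)
    then have "D (hvec c) = 0"
      using x Du comp_of_layer[OF hvec_layer[of c], of 0] by (simp add: super_carrier_def)
    moreover have "ee \<noteq> (0 :: 'k^('n + 'r))"
    proof -
      obtain r where r: "\<theta> = rt r" using root_rt[OF simple_root] by blast
      have "ee = (axis (Inr r) 1 :: 'k^('n + 'r))" unfolding ee_def unfolding r by (rule evec_rt)
      then have "ee $ Inr r = (1 :: 'k)" by (simp add: axis_def)
      then show ?thesis by auto
    qed
    ultimately have hc: "hpair c \<theta> = 0" by (simp add: ee_def brk_eh)
    \<comment> \<open>On the Cartan part the kernel of \<open>D\<close> is one linear condition,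
      which involves \<open>c $ ext\<close> and \<open>c $ p\<close> alone since \<open>ext\<close>
      is a leaf; modulo 3 it reads \<open>c $ p = - c $ ext\<close>.\<close>
    have "hpair c \<theta> = (\<Sum>i\<in>{ext, p}. c $ i * of_int (pair (simple i) \<theta>))"
      unfolding hpair_def using pair_other by (intro sum.mono_neutral_right) auto
    then have "2 * c $ ext - c $ p = 0" using hc op pp ps[of ext] by (simp add: mult.commute)
    then have cp: "c $ p = - c $ ext" 
    proof -
      have "c $ p + c $ ext = 3 * c $ ext" using \<open>2 * c $ ext - c $ p = 0\<close> by (simp add: algebra_simps)
      then show ?thesis by (simp add: three eq_neg_iff_add_eq_0)
    qed
    \<comment> \<open>Only the lift at \<open>q\<close> contributes to the coordinate at
      \<open>ext\<close>, namely \<open>- c $ p\<close>, so the condition just found is what makes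
      the expansion correct there.\<close>
    have "c = (\<Sum>l\<in>UNIV. c $ \<sigma> l *s red (coroot_lift l))"
    proof (rule vec_eq_iff[THEN iffD2], rule allI)
      fix i
      show "c $ i = (\<Sum>l\<in>UNIV. c $ \<sigma> l *s red (coroot_lift l)) $ i"
      proof (cases "i = ext")
        case True
        have "(\<Sum>l\<in>UNIV. c $ \<sigma> l *s red (coroot_lift l)) $ i = (\<Sum>l\<in>UNIV. if l = q then - c $ p else 0)"
          unfolding sum_component vector_smult_component
          by (intro sum.cong refl) (auto simp: True coroot_lift_def red_def axis_def sigma_q)
        then show ?thesis using cp True by simp
      next
        case False
        then obtain k where k: "i = \<sigma> k" using ex_sigma by blast
        have "(\<Sum>l\<in>UNIV. c $ \<sigma> l *s red (coroot_lift l)) $ i = (\<Sum>l\<in>UNIV. if l = k then c $ \<sigma> k else 0)"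
          unfolding sum_component vector_smult_component
          using sigma_inj by (intro sum.cong refl) (auto simp: k coroot_lift_def red_def axis_def inj_def)
        then show ?thesis by (simp add: k)
      qed
    qed
    then have "hvec c = (\<Sum>l\<in>UNIV. c $ \<sigma> l *s hvec (red (coroot_lift l)))"
      by (metis (no_types, lifting) hvec_linear(2) hvec_sum sum.cong)
    then have "hvec c \<in> T"
      by (simp add: vec.subspace_sum[OF T(1)] vec.subspace_scale[OF T(1)] h)
    then show "x \<in> T"
      by (subst xs) (intro vec.subspace_add[OF T(1)] vec.subspace_sum[OF T(1)] u)
  qed
qed

end

section \<open>Nondegeneracy, and the model for the diagram without its leaf\<close>

context simply_laced_node
begin

lemma even_carrier: "x \<in> even_part \<Longrightarrow> x \<in> super_carrier"
  and odd_carrier: "x \<in> layer (-1) \<Longrightarrow> x \<in> super_carrier"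
  using super_part_even super_part_odd by (auto simp: graded_part_def)

lemma evec_swt:
  "(evec v :: 'k::field^('n + 'r)) \<in> super_carrier \<Longrightarrow> (evec v :: 'k^('n + 'r)) \<in> graded_part super_carrier swt (forget v)"
  using evec_graded[of v, where 'a='k] by (auto simp: graded_part_def)

lemma evec_carrier: "pair v \<theta> \<in> {0, -1} \<Longrightarrow> evec v \<in> super_carrier"
  using even_carrier[OF evec_even] odd_carrier[OF evec_odd] by blast

lemma pair_lift_theta: "pair (coroot_lift l) \<theta> = (if l = q then -3 else 0)"
  using pair_sigma[of l] by (simp add: coroot_lift_def)

text \<open>A nonzero weight of the superalgebra determines the root, so \<open>x\<close> is a
  multiple of a root vector. The partner is \<open>- v\<close> for an even root and
  \<open>- v - \<theta>\<close> for an odd one, and the bracket is a Cartan element that survives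
  reduction modulo 3.\<close>

lemma node_nondegenerate:
  assumes char: "CHAR('k::field) = 3" and d: "d \<noteq> 0"
    and x: "(x :: 'k^('n + 'r)) \<in> graded_part super_carrier swt d" "x \<noteq> 0"
  shows "\<exists>y\<in>graded_part super_carrier swt (- d). sbrk y x \<noteq> 0"
proof -
  obtain k where k: "x $ k \<noteq> 0" using x(2) by (auto simp: vec_eq_iff)
  have fk: "forget (wt k) = d" using x(1) k by (simp add: graded_part_def)
  then obtain r where r: "k = Inr r" using d by (cases k) (auto simp: wt_def forget_simps)
  define v where "v = rt r"
  have v: "is_root v" "forget v = d" using fk r by (simp_all add: v_def wt_def)
  have gr: "grade i \<in> {0, -1}" if "x $ i \<noteq> 0" for i
    using x(1) that by (auto simp: graded_part_def super_carrier_def)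
  have pv: "pair v \<theta> \<in> {0, -1}" using gr[OF k] by (simp add: r grade_def wt_def v_def)
  have "x $ i = 0" if "i \<noteq> k" for i
  proof (rule ccontr)
    assume i: "x $ i \<noteq> 0"
    then have "forget (wt i) = forget v" using x(1) v(2) by (simp add: graded_part_def)
    then have "wt i = v" using swt_inj gr[OF i] pv by (simp add: grade_def)
    then show False using that root_nonzero[OF v(1)] rt_inj by (cases i) (auto simp: wt_def v_def r inj_def)
  qed
  then have xe: "x = x $ k *s evec v" by (auto simp: vec_eq_iff r v_def evec_rt axis_def)
  show ?thesis
  proof (cases "pair v \<theta> = 0")
    case True
    have e: "evec v \<in> even_part" "evec (- v) \<in> even_part" using True by (simp_all add: evec_even)
    have "sbrk (evec (- v)) x = x $ k *s (hvec (red v) :: 'k^('n + 'r))"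
      using xe super.scale_right[of "evec (- v)" "x $ k" "evec v"]
        sbrk_ee[OF evec_even[of "- v"] evec_even[OF True], where 'a='k] True v(1)
      by (simp add: brk_ee root_pair_self red_linear hvec_linear)
    moreover have "red v \<noteq> (0 :: 'k^'n)" using v(1) by (intro red_nonzero[OF char]) (simp add: is_root_def)
    ultimately have "sbrk (evec (- v)) x \<noteq> 0" using k by (simp add: hvec_zero_iff)
    moreover have "evec (- v) \<in> graded_part super_carrier swt (- d)"
      using evec_swt[OF even_carrier[OF evec_even[of "- v"]]] True v(2) by (simp add: forget_simps)
    ultimately show ?thesis by blast
  next
    case False
    then have pv: "pair v \<theta> = -1" using pv by simp
    define w where "w = - v - \<theta>"
    have vw: "v = - w - \<theta>" by (simp add: w_def)
    have w: "is_root w" "pair w \<theta> = -1"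
    proof -
      have "w = - (\<theta> + v)" by (simp add: w_def)
      then show "is_root w" using root_theta_add[OF v(1) pv] by (simp only: root_neg)
      show "pair w \<theta> = -1" using pv by (simp add: w_def)
    qed
    have "sbrk (evec w) x = - (x $ k *s (eps \<theta> w *s (hvec (red (w + w + \<theta>)) :: 'k^('n + 'r))))"
      using xe super.scale_right[of "evec w" "x $ k" "evec v"] sbrk_odd_opposite[OF w, where 'k='k]
      unfolding vw[symmetric] by simp
    moreover have "red (w + w + \<theta>) \<noteq> (0 :: 'k^'n)"
    proof (rule red_nonzero[OF char])
      \<comment> \<open>The value is \<open>4 - 2 + 1 = 3\<close>: divisible by 3 but not by 9,
        which is what \<open>red_nonzero\<close> asks for.\<close>
      have "m (w + w + \<theta>) (w + w + \<theta>) = 4 * m w w + 2 * pair w \<theta> + m \<theta> \<theta>"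
        unfolding m_bilinear pair_def by simp
      also have "\<dots> = 3" using w theta_root unfolding is_root_def by simp
      finally show "\<not> 9 dvd m (w + w + \<theta>) (w + w + \<theta>)" by simp
    qed
    ultimately have "sbrk (evec w) x \<noteq> 0" using k by (simp add: hvec_zero_iff)
    moreover have "evec w \<in> graded_part super_carrier swt (- d)"
      using evec_swt[OF odd_carrier[OF evec_odd[OF w(2)]]] v(2) by (simp add: w_def forget_simps)
    ultimately show ?thesis by blast
  qed
qed

text \<open>The matrix is compared with the pairings of the lifted coroots modulo 3, as its entries
  act through the field: a diagonal entry 0 at the odd node stands for \<open>2 + 1\<close>.\<close>

lemma node_model:
  fixes R :: "('k::field, 'l, 'h::ab_group_add) cartan_data" and A :: "int^'l^'l"
  assumes char: "CHAR('k) = 3" and R: "realizes A R"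
    and rk: "rank (reduced_matrix A :: 'k^'l^'l) = CARD('l)"
    and A: "\<And>i j. 3 dvd A $ i $ j - pair (coroot_lift i) (simple (\<sigma> j))"
  obtains hm where "cartan_model (\<lambda>l. if l = q then 1 else 0) R sbrk super_carrier super_parity swt egen fgen hm"
proof -
  have three: "(3::'k) = 0" using of_nat_CHAR[where 'a='k] by (simp add: char)
  have cong: "of_int a = (of_int b :: 'k)" if "3 dvd a - b" for a b
    using that of_int_eq_0_iff_char_dvd[of "a - b", where 'a='k] by (simp add: char)
  obtain hc where hc: "\<And>v w. hc (v + w) = hc v + hc w" "\<And>c v. hc (hscale R c v) = c *s hc v"
    "\<And>v. hc v = 0 \<Longrightarrow> v = 0" "\<And>i. hc (coroot R i) = axis i 1"
    "\<And>j v. root R j v = (\<Sum>i\<in>UNIV. hc v $ i * of_int (A $ i $ j))"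
    using realizes_coords[OF R rk] by blast
  \<comment> \<open>The Cartan space is sent to the span of the lifted coroots, which lies in the
    kernel of \<open>D\<close>.\<close>
  define hs :: "'h \<Rightarrow> 'k^'n" where "hs v = (\<Sum>l\<in>UNIV. hc v $ l *s red (coroot_lift l))" for v
  have hs_add: "hs (v + w) = hs v + hs w" for v w
    by (simp add: hs_def hc vec.scale_left_distrib sum.distrib)
  have hs_scale: "hs (hscale R c v) = c *s hs v" for c v
    by (simp add: hs_def hc vec.scale_sum_right)
  have hs_coroot: "hs (coroot R l) = red (coroot_lift l)" for l
  proof -
    have "hs (coroot R l) = (\<Sum>l'\<in>UNIV. if l = l' then red (coroot_lift l') else 0)"
      unfolding hs_def hc by (intro sum.cong refl) (simp add: axis_def)
    then show ?thesis by simp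
  qed
  have hpair_hs: "hpair (hs v) w = (\<Sum>l\<in>UNIV. hc v $ l * of_int (pair (coroot_lift l) w))" for v w
  proof -
    have "hpair (\<Sum>l\<in>L. hc v $ l *s red (coroot_lift l)) w =
        (\<Sum>l\<in>L. hc v $ l * of_int (pair (coroot_lift l) w))" if "finite L" for L
      using that by (induction L rule: finite_induct) (simp_all add: hpair_linear hpair_red, simp add: hpair_def)
    then show ?thesis by (simp add: hs_def)
  qed
  have hs_theta: "hpair (hs v) \<theta> = 0" for v
    by (simp add: hpair_hs pair_lift_theta three if_distrib cong: if_cong)
  have hs_root: "hpair (hs v) (simple (\<sigma> j)) = root R j v" for v j
    unfolding hpair_hs hc(5) by (intro sum.cong refl arg_cong2[where f = "(*)"] cong[symmetric] A)
  have hs_even: "hvec (hs v) \<in> even_part" for v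
    using hs_theta[of v] hvec_layer by (simp add: even_part_def ee_def brk_eh)
  have hs_inj: "v = 0" if "hs v = 0" for v
  proof -
    have "hs v $ \<sigma> k = hc v $ k" for k
    proof -
      have "hs v $ \<sigma> k = (\<Sum>l\<in>UNIV. if l = k then hc v $ l else 0)"
        unfolding hs_def sum_component vector_smult_component
        using sigma_inj by (intro sum.cong refl) (auto simp: coroot_lift_def red_def axis_def inj_def)
      then show ?thesis by simp
    qed
    then have "hc v = 0" using that by (auto simp: vec_eq_iff)
    then show ?thesis by (rule hc(3))
  qed
  have esig: "(evec (simple (\<sigma> l)) :: 'k^('n + 'r)) \<in> even_part" "(evec (- simple (\<sigma> l)) :: 'k^('n + 'r)) \<in> even_part" if "l \<noteq> q" for l
    using that pair_sigma[of l] by (simp_all add: evec_even)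
  have odd: "(evec (simple p) :: 'k^('n + 'r)) \<in> layer (-1)" "(evec (- simple p - \<theta>) :: 'k^('n + 'r)) \<in> layer (-1)"
    using evec_odd[OF pair_p] evec_odd[OF pair_low] by blast+
  have hw: "hvec c \<in> graded_part super_carrier swt 0" if "hvec c \<in> even_part" for c :: "'k^'n"
    using even_carrier[OF that] hvec_graded[of 0 c]
    by (auto simp: graded_part_def forget_simps)
  show ?thesis
  proof (rule that[of "\<lambda>v. hvec (hs v)"], unfold_locales)
    fix x y z :: "'k^('n + 'r)" and a b c :: bit and i j :: 'l and v w :: 'h and d d' and s :: 'k
    show "vec.subspace (super_carrier :: ('k^('n + 'r)) set)" by (rule super_carrier_subspace)
    show "sbrk x y \<in> graded_part super_carrier super_parity (a + b)"
      if "x \<in> graded_part super_carrier super_parity a" "y \<in> graded_part super_carrier super_parity b"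
      using that by (rule sbrk_part)
    show "sbrk x y \<in> graded_part super_carrier swt (d + d')"
      if "x \<in> graded_part super_carrier swt d" "y \<in> graded_part super_carrier swt d'"
      using that by (rule sbrk_weight)
    show "sbrk x y \<in> super_carrier" if "x \<in> super_carrier" "y \<in> super_carrier"
      using that by (rule sbrk_carrier)
    show "sbrk x y + koszul_sign a b *s sbrk y x = 0"
      if "x \<in> graded_part super_carrier super_parity a" "y \<in> graded_part super_carrier super_parity b"
      using that by (rule sbrk_anti)
    show "sbrk x (sbrk y z) = sbrk (sbrk x y) z + koszul_sign a b *s sbrk y (sbrk x z)"
      if "x \<in> graded_part super_carrier super_parity a" "y \<in> graded_part super_carrier super_parity b"
        "z \<in> graded_part super_carrier super_parity c"
      using sbrk_jacobi[OF three that] .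
    show "sbrk x (sbrk x x) = 0" if "x \<in> graded_part super_carrier super_parity 1"
      using sbrk_cube[OF char that] .
    show "(egen i :: 'k^('n + 'r)) \<in> graded_part super_carrier super_parity (if i = q then 1 else 0)"
      using esig(1)[of i] odd(1) by (simp add: super_part_even super_part_odd egen_def sigma_q)
    show "(fgen i :: 'k^('n + 'r)) \<in> graded_part super_carrier super_parity (if i = q then 1 else 0)"
      using even_closed(3)[OF esig(2)[of i]] layer_closed(4)[OF odd(2)]
      by (simp add: super_part_even super_part_odd fgen_def)
    show "(egen i :: 'k^('n + 'r)) \<in> graded_part super_carrier swt (axis i 1)"
      using evec_swt[OF evec_carrier, of "simple (\<sigma> i)", where 'k='k] pair_sigma[of i] by (simp add: egen_def forget_simps)
    show "(fgen i :: 'k^('n + 'r)) \<in> graded_part super_carrier swt (- axis i 1)"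
    proof -
      have s: "vec.subspace (graded_part super_carrier swt (- axis i 1) :: ('k^('n + 'r)) set)"
        by (rule graded_part_subspace[OF super_carrier_subspace])
      show ?thesis
      proof (cases "i = q")
        case True
        have "forget (- simple p - \<theta>) = - axis i 1"
          using forget_simps(6)[of q] by (simp add: forget_simps sigma_q True)
        then show ?thesis
          using vec.subspace_scale[OF s] evec_swt[OF evec_carrier, of "- simple p - \<theta>", where 'k='k] pair_low
          by (simp add: fgen_def True)
      next
        case False
        then show ?thesis
          using vec.subspace_neg[OF s] evec_swt[OF evec_carrier, of "- simple (\<sigma> i)", where 'k='k] pair_sigma[of i]
          by (simp add: fgen_def forget_simps)
      qed
    qed
    show "hvec (hs v) \<in> graded_part super_carrier super_parity 0"
      using hs_even by (simp add: super_part_even)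
    show "hvec (hs v) \<in> graded_part super_carrier swt 0" by (rule hw[OF hs_even])
    show "hvec (hs (v + w)) = hvec (hs v) + hvec (hs w)" "hvec (hs (hscale R s v)) = s *s hvec (hs v)"
      by (simp_all add: hs_add hs_scale hvec_linear)
    show "v = 0" if "hvec (hs v) = 0" using that hs_inj by (simp add: hvec_zero_iff)
    show "sbrk (hvec (hs v)) (egen j) = root R j v *s egen j"
    proof -
      have "sbrk (hvec (hs v)) (egen j) = brk (hvec (hs v)) (egen j)"
        using sbrk_ee[OF hs_even esig(1)[of j]] sbrk_eo[OF hs_even odd(1)]
        by (cases "j = q") (simp_all add: egen_def sigma_q)
      then show ?thesis by (simp add: egen_def brk_he hs_root)
    qed
    show "sbrk (hvec (hs v)) (fgen j) = - (root R j v *s fgen j)"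
    proof (cases "j = q")
      case True
      have "sbrk (hvec (hs v)) (fgen j) = eps \<theta> (simple p) *s brk (hvec (hs v)) (evec (- simple p - \<theta>))"
        by (simp add: fgen_def True super.scale_right sbrk_eo[OF hs_even odd(2)])
      then show ?thesis
        using hs_root[of v q] hs_theta[of v]
        by (simp add: brk_he fgen_def True hpair_linear sigma_q mult.commute)
    next
      case False
      then have "sbrk (hvec (hs v)) (fgen j) = - brk (hvec (hs v)) (evec (- simple (\<sigma> j)))"
        by (simp add: fgen_def sbrk_ee[OF hs_even esig(2)])
      then show ?thesis using False by (simp add: brk_he fgen_def hpair_linear hs_root)
    qed
    show "sbrk (hvec (hs v)) (hvec (hs w)) = 0"
      by (simp add: sbrk_ee[OF hs_even hs_even] brk_hh)
    show "sbrk (egen i) (fgen j) = (if i = j then hvec (hs (coroot R i)) else 0)"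
    proof (cases "i = q")
      case i: True
      show ?thesis
      proof (cases "j = q")
        case j: True
        have "sbrk (evec (simple p)) (evec (- simple p - \<theta>)) =
            - (eps \<theta> (simple p) *s (hvec (red (simple p + simple p + \<theta>)) :: 'k^('n + 'r)))"
          by (rule sbrk_odd_opposite[OF simple_root pair_p])
        then have "sbrk (egen i) (fgen j) = - (hvec (red (simple p + simple p + \<theta>)) :: 'k^('n + 'r))"
          by (simp add: i j egen_def fgen_def sigma_q super.scale_right)
        \<comment> \<open>Modulo 3, \<open>- (2p + \<theta>)\<close> equals
          \<open>p - \<theta>\<close>, the lifted coroot of the odd node.\<close>
        also have "\<dots> = hvec (red (simple p - \<theta>))"
        proof -
          have "red (simple p - \<theta>) + red (simple p + simple p + \<theta>) = (0 :: 'k^'n)"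
          proof -
            have "s - t + (s + s + t) = 0" for s t :: 'k
            proof -
              have "s - t + (s + s + t) = 3 * s" by (simp add: algebra_simps)
              then show ?thesis by (simp add: three)
            qed
            then show ?thesis unfolding red_linear by (simp only: vec_eq_iff vector_add_component vector_minus_component zero_index simp_thms)
          qed
          then show ?thesis
            by (metis hvec_linear(1,3) add.commute neg_eq_iff_add_eq_0)
        qed
        finally show ?thesis by (simp add: i j hs_coroot coroot_lift_def sigma_q)
      next
        case j: False
        have "pair (simple p) (simple (\<sigma> j)) \<le> 0" using j by (intro pair_simple_le) (metis sigma_p)
        then have "brk (evec (simple p)) (evec (- simple (\<sigma> j))) = (0 :: 'k^('n + 'r))"
          by (simp add: brk_ee)
        then show ?thesis
          using j by (simp add: i egen_def fgen_def sigma_q sbrk_oe[OF odd(1) esig(2)])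
      qed
    next
      case i: False
      show ?thesis
      proof (cases "j = q")
        case j: True
        have "pair (simple (\<sigma> i)) (simple p) \<le> 0" using i by (intro pair_simple_le) simp
        moreover have "pair (simple (\<sigma> i)) \<theta> = 0" using pair_sigma[of i] i by simp
        ultimately have "brk (evec (simple (\<sigma> i))) (evec (- simple p - \<theta>)) = (0 :: 'k^('n + 'r))"
          using root_low by (simp add: brk_ee)
        then show ?thesis
          using i by (simp add: j egen_def fgen_def super.scale_right sbrk_eo[OF esig(1) odd(2)])
      next
        case j: False
        have "sbrk (egen i) (fgen j) = - (brk (evec (simple (\<sigma> i))) (evec (- simple (\<sigma> j))) :: 'k^('n + 'r))"
          using i j by (simp add: egen_def fgen_def sbrk_ee[OF esig(1) esig(2)])
        also have "\<dots> = (if i = j then hvec (hs (coroot R i)) else 0)"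
        proof (cases "i = j")
          case True
          then show ?thesis
            using i by (simp add: brk_ee root_pair_self hs_coroot coroot_lift_def)
        next
          case False
          then have "\<sigma> i \<noteq> \<sigma> j" using sigma_inj by (auto simp: inj_def)
          then have "pair (simple (\<sigma> i)) (simple (\<sigma> j)) \<le> 0" by (rule pair_simple_le)
          then show ?thesis using False by (simp add: brk_ee)
        qed
        finally show ?thesis .
      qed
    qed
  next
    fix T :: "('k^('n + 'r)) set"
    assume T: "vec.subspace T" "\<And>x y. x \<in> T \<Longrightarrow> y \<in> T \<Longrightarrow> sbrk x y \<in> T"
      "\<And>i. egen i \<in> T" "\<And>i. fgen i \<in> T" "\<And>v. hvec (hs v) \<in> T"
    have "hvec (red (coroot_lift l)) \<in> T" for l using T(5)[of "coroot R l"] by (simp add: hs_coroot)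
    then show "super_carrier \<subseteq> T"
      using T(2-4) by (intro generated[OF char T(1)])
  next
    fix d :: "int^'l" and x :: "'k^('n + 'r)"
    assume "d \<noteq> 0" "x \<in> graded_part super_carrier swt d" "x \<noteq> 0"
    then show "\<exists>y\<in>graded_part super_carrier swt (- d). sbrk y x \<noteq> 0"
      by (rule node_nondegenerate[OF char])
  qed
qed

end

section \<open>Semisimplification\<close>

context simply_laced_root
begin

section \<open>Kernels and images of \<open>D\<close>, and lowest components\<close>

lemma ee_axis: "rt r = \<theta> \<Longrightarrow> ee = axis (Inr r) 1"
  using evec_rt[of r] by (simp add: ee_def)

lemma ee_nonzero: "ee \<noteq> (0 :: 'k::field^('n + 'r))"
proof -
  obtain r where "rt r = \<theta>" using root_rt[OF theta_root] by metis
  then have "ee $ Inr r = (1 :: 'k)" by (simp add: ee_axis axis_def)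
  then show ?thesis by auto
qed

lemma char_3:
  assumes "CHAR('k::field) = 3"
  shows "(3::'k) = 0" "(2::'k) = -1" "(2::'k) \<noteq> 0"
proof -
  show three: "(3::'k) = 0" using of_nat_CHAR[where 'a='k] by (simp add: assms)
  have "(2::'k) + 1 = 0" using three by simp
  then show "(2::'k) = -1" by (simp only: eq_neg_iff_add_eq_0)
  show "(2::'k) \<noteq> 0"
  proof
    assume "(2::'k) = 0"
    then have "(3::'k) - 2 = 0" using three by simp
    then show False by simp
  qed
qed

lemma D_hh_3: "CHAR('k::field) = 3 \<Longrightarrow> D hh = (ee :: 'k^('n + 'r))"
  by (simp add: D_hh char_3(2))

text \<open>The vectors defining morphisms from the blocks may have components in higher degrees,
  which turn out negligible. Such bounds allow the lowest component of a bracket to be computed from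
  the lowest components of the factors.\<close>

definition bounded_below :: "int \<Rightarrow> 'k::field^('n + 'r) \<Rightarrow> bool" where
  "bounded_below j x \<longleftrightarrow> (\<forall>k<j. comp k x = 0)"

lemma comp_brk_lowest:
  assumes x: "bounded_below j x" and y: "bounded_below k y"
  shows "comp (j + k) (brk x y) = brk (comp j x) (comp k y)"
proof -
  have "brk x y = (\<Sum>l\<in>{-2..2}. brk (comp l x) y)"
    using comp_expand[of x] by (metis (no_types) sum_left)
  then have "comp (j + k) (brk x y) = (\<Sum>l\<in>{-2..2}. comp (j + k) (brk (comp l x) y))"
    by (simp only: comp_sum)
  also have "\<dots> = (\<Sum>l\<in>{-2..2}. if l = j then brk (comp j x) (comp k y) else 0)"
  proof (intro sum.cong refl)
    fix l
    have "comp (j + k) (brk (comp l x) y) = brk (comp l x) (comp (j + k - l) y)"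
      using comp_brk[OF comp_layer[of l x], of "j + k - l" y] by simp
    moreover have "comp l x = 0" if "l < j" using x that by (simp add: bounded_below_def)
    moreover have "comp (j + k - l) y = 0" if "l > j" using y that by (simp add: bounded_below_def)
    ultimately show "comp (j + k) (brk (comp l x) y) = (if l = j then brk (comp j x) (comp k y) else 0)"
      by (cases l j rule: linorder_cases) simp_all
  qed
  also have "\<dots> = brk (comp j x) (comp k y)"
    using comp_trivial[of j x] by (cases "j \<in> {-2..2}") auto
  finally show ?thesis .
qed

text \<open>In characteristic 3 the chain \<open>ff\<close>, \<open>- hh\<close>,
  \<open>- ee\<close> under \<open>D\<close> has length three: this is the block \<open>J_3\<close>,
  and \<open>D\<close> applied twice to its head is not 0.\<close>

lemma comp_minus_2:
  assumes "CHAR('k::field) = 3" and "D (D (comp (-2) b)) = (0 :: 'k^('n + 'r))"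
  shows "comp (-2) b = 0"
proof -
  obtain c where c: "comp (-2) b = c *s ff" using layer_minus_2[OF comp_layer] by blast
  have "- (c *s ee) = (0 :: 'k^('n + 'r))"
    using assms(2) D_hh_3[OF assms(1)] by (simp add: c scale_right brk_ef)
  then have "c = 0" using ee_nonzero[where 'k='k] by (simp add: vec.scale_eq_0_iff)
  then show ?thesis by (simp add: c)
qed

text \<open>\<open>D\<close> is homogeneous, so its kernel contains the components of its elements;
  it is injective in degree -1 by \<open>ff_D\<close> and in degree -2 by the block of length
  three.\<close>

lemma D_kernel:
  assumes char: "CHAR('k::field) = 3" and a: "D a = (0 :: 'k^('n + 'r))"
  shows "D (comp k a) = 0" "bounded_below 0 a"
proof -
  show D: "D (comp k a) = 0" for k using comp_D[of "k + 2" a] a by (simp add: comp_linear)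
  have "comp (-1) a = 0" using ff_D[OF comp_layer[of "-1" a]] D[of "-1"] by simp
  moreover have "comp (-2) a = 0" using D[of "-2"] by (intro comp_minus_2[OF char]) simp
  moreover have "k = -1 \<or> k = -2 \<or> \<bar>k\<bar> > 2" if "k < 0" for k :: int using that by linarith
  ultimately show "bounded_below 0 a" using comp_trivial unfolding bounded_below_def by blast
qed

lemma DD_kernel:
  assumes char: "CHAR('k::field) = 3" and b: "D (D b) = (0 :: 'k^('n + 'r))"
  shows "bounded_below (-1) b"
proof -
  have "D (D (comp (-2) b)) = 0" using comp_D[of 2 "D b"] comp_D[of 0 b] b by (simp add: comp_linear)
  then have "comp (-2) b = 0" by (rule comp_minus_2[OF char])
  moreover have "k = -2 \<or> \<bar>k\<bar> > 2" if "k < -1" for k :: int using that by linarith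
  ultimately show ?thesis using comp_trivial unfolding bounded_below_def by blast
qed

lemma D_bounded: "bounded_below j b \<Longrightarrow> bounded_below (j + 2) (D b)"
  by (simp add: bounded_below_def comp_D)

text \<open>Degree 1 is reached from degree -1 by \<open>D_ff\<close>, and degree 2 from
  \<open>hh\<close>.\<close>

lemma high_in_image:
  assumes char: "CHAR('k::field) = 3"
  obtains b where "comp 1 a + comp 2 a = D (b :: 'k^('n + 'r))"
proof -
  obtain c where c: "comp 2 a = c *s ee" using layer_2[OF comp_layer] by blast
  have "comp 1 a + comp 2 a = D (- brk ff (comp 1 a) + c *s hh)"
    using D_ff[OF comp_layer[of 1 a]] D_hh_3[OF char] by (simp add: c diff_right scale_right)
  then show ?thesis by (rule that)
qed

lemma comp_split: "x = comp (-2) x + comp (-1) x + comp 0 x + (comp 1 x + comp 2 x)"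
proof -
  have e: "{-2..2::int} = {-2, -1, 0, 1, 2}" by auto
  show ?thesis using comp_expand[of x] by (simp add: e add_ac)
qed

text \<open>Degree 2 is the line through \<open>ee\<close>, so \<open>kap x\<close> is the coefficient of \<open>D (comp 0 x)\<close> there, and
  subtracting \<open>kap x *s hh\<close> projects degree 0 onto the kernel of \<open>D\<close>, as \<open>D hh = ee\<close>.\<close>

definition kap :: "'k::field^('n + 'r) \<Rightarrow> 'k" where
  "kap x = D (comp 0 x) $ Inr (SOME r. rt r = \<theta>)"

definition proj0 :: "'k::field^('n + 'r) \<Rightarrow> 'k^('n + 'r)" where
  "proj0 x = comp 0 x - kap x *s hh"

lemma D_comp_0: "D (comp 0 x) = kap x *s ee"
proof -
  obtain r where r: "rt r = \<theta>" using root_rt[OF theta_root] by metis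
  then have s: "rt (SOME r. rt r = \<theta>) = \<theta>" by (rule someI)
  obtain c where c: "D (comp 0 x) = c *s ee" using layer_2[of "D (comp 0 x)"] D_layer[OF comp_layer[of 0 x]] by auto
  have "kap x = c * ee $ Inr (SOME r. rt r = \<theta>)" by (simp add: kap_def c)
  then have "kap x = c" unfolding ee_axis[OF s] by (simp add: axis_def)
  then show ?thesis using c by simp
qed

lemma proj0_linear: "proj0 (x + y) = proj0 x + proj0 y" "proj0 (c *s x) = c *s proj0 x"
proof -
  have "kap (x + y) = kap x + kap y" "kap (c *s x) = c * kap x"
    by (simp_all add: kap_def comp_linear add_right scale_right)
  then show "proj0 (x + y) = proj0 x + proj0 y" "proj0 (c *s x) = c *s proj0 x"
    by (simp_all add: proj0_def comp_linear vec.scale_left_distrib vec.scale_right_diff_distrib)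
qed

text \<open>The degree 0 part of an image of \<open>D\<close> comes from degree -2 and is a multiple
  of \<open>hh\<close>, which is what \<open>proj0\<close> removes. Hence each coordinate of
  \<open>proj0\<close> is a morphism to \<open>J1\<close>.\<close>

lemma proj0_D:
  assumes "CHAR('k::field) = 3"
  shows "proj0 (D y) = (0 :: 'k^('n + 'r))"
proof -
  obtain c where c: "comp (-2) y = c *s ff" using layer_minus_2[OF comp_layer] by blast
  then have 1: "comp 0 (D y) = - (c *s hh)" by (simp add: comp_D scale_right brk_ef)
  then have "- (c *s ee) = kap (D y) *s (ee :: 'k^('n + 'r))"
    using D_comp_0[of "D y"] D_hh_3[OF assms] by (simp add: scale_right)
  then have "(kap (D y) + c) *s (ee :: 'k^('n + 'r)) = 0"
    by (metis vec.scale_left_distrib ab_left_minus)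
  then have "kap (D y) + c = 0"
    using ee_nonzero[where 'k='k] unfolding vec.scale_eq_0_iff by blast
  then have "kap (D y) = - c" by (simp only: eq_neg_iff_add_eq_0)
  then show ?thesis by (simp add: proj0_def 1)
qed

lemma proj0_kernel: "D a = 0 \<Longrightarrow> CHAR('k::field) = 3 \<Longrightarrow> proj0 a = comp 0 (a :: 'k^('n + 'r))"
  using D_comp_0[of a] D_kernel(1)[of a 0] ee_nonzero[where 'k='k]
  by (simp add: proj0_def vec.scale_eq_0_iff)

end

text \<open>The semisimplification is formed on the abstract algebra \<open>V\<close>, while the
  computations live on coordinate vectors. The isomorphism \<open>v\<close> is kept as data, and
  \<open>e0\<close> is the element whose adjoint action becomes \<open>D\<close>.\<close>

locale sl_iso = simply_laced_root gram rt \<theta> + V: super_nonassoc_algebra V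
  for gram :: "int^'n::finite^'n" and rt :: "'r::finite \<Rightarrow> int^'n" and \<theta>
    and V :: "('k::field, 'v, 'z) superalgebra_scheme" +
  fixes v :: "'v \<Rightarrow> 'k^('n + 'r)" and e0 :: 'v
  assumes char: "CHAR('k) = 3"
    and v_add: "x \<in> carrier V \<Longrightarrow> y \<in> carrier V \<Longrightarrow> v (x \<oplus>\<^bsub>V\<^esub> y) = v x + v y"
    and v_scale: "x \<in> carrier V \<Longrightarrow> v (c \<odot>\<^bsub>V\<^esub> x) = c *s v x"
    and v_mult: "x \<in> carrier V \<Longrightarrow> y \<in> carrier V \<Longrightarrow> v (x \<otimes>\<^bsub>V\<^esub> y) = brk (v x) (v y)"
    and v_bij: "bij_betw v (carrier V) UNIV"
    and e0: "e0 \<in> carrier V" and v_e0: "v e0 = ee"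
begin

section \<open>Transport to coordinates and a basis\<close>

definition w :: "'k^('n + 'r) \<Rightarrow> 'v" where
  "w y = inv_into (carrier V) v y"

abbreviation d :: "'v \<Rightarrow> 'v" where
  "d x \<equiv> e0 \<otimes>\<^bsub>V\<^esub> x"

lemma w_closed [simp]: "w y \<in> carrier V" and v_w [simp]: "v (w y) = y"
  using v_bij unfolding w_def bij_betw_def by (simp_all add: inv_into_into f_inv_into_f)

lemma w_v: "x \<in> carrier V \<Longrightarrow> w (v x) = x"
  using v_bij unfolding w_def bij_betw_def by (simp add: inv_into_f_f)

lemma w_eqI: "x \<in> carrier V \<Longrightarrow> v x = y \<Longrightarrow> w y = x"
  using w_v by auto

lemma w_inj: "w a = w b \<longleftrightarrow> a = b"
  using v_w by metis

lemma w_add: "w a \<oplus>\<^bsub>V\<^esub> w b = w (a + b)"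
  by (rule w_eqI[symmetric]) (simp_all add: v_add)

lemma w_scale: "c \<odot>\<^bsub>V\<^esub> w a = w (c *s a)"
  by (rule w_eqI[symmetric]) (simp_all add: v_scale)

lemma w_mult: "w a \<otimes>\<^bsub>V\<^esub> w b = w (brk a b)"
  by (rule w_eqI[symmetric]) (simp_all add: v_mult)

lemma w_zero: "\<zero>\<^bsub>V\<^esub> = w 0"
  using w_scale[of 0 0] V.scale_zero_left[OF w_closed[of 0]] by simp

lemma w_minus: "\<ominus>\<^bsub>V\<^esub> w a = w (- a)"
  using w_scale[of "-1" a] V.scale_minus_one[OF w_closed[of a]] by simp

lemma e0_w: "e0 = w ee"
  by (rule w_eqI[symmetric]) (simp_all add: e0 v_e0)

lemma d_w: "d (w a) = w (D a)"
  by (simp add: e0_w w_mult)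

lemma carrier_w: "carrier V = range w"
proof
  show "carrier V \<subseteq> range w" using w_v by (metis rangeI subsetI)
qed auto

lemma d_lin: "d \<in> lin_maps V V"
  unfolding lin_maps_def by (auto simp: carrier_w d_w w_add w_scale add_right scale_right)

lemma v_zero: "v \<zero>\<^bsub>V\<^esub> = 0"
  by (simp add: w_zero)

lemma v_finsum: "finite B \<Longrightarrow> g \<in> B \<rightarrow> carrier V \<Longrightarrow> v (\<Oplus>\<^bsub>V\<^esub>b\<in>B. g b) = (\<Sum>b\<in>B. v (g b))"
proof (induction B rule: finite_induct)
  case empty
  then show ?case by (simp add: v_zero)
next
  case (insert b B)
  then show ?case by (simp add: v_add V.M.finsum_insert V.M.finsum_closed)
qed

text \<open>\<open>alpha3_rep\<close> asks for a finite basis, and the trace formulas for the blocks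
  are proved relative to one.\<close>

definition std_basis :: "'v set" where
  "std_basis = range (\<lambda>i. w (axis i 1))"

lemma axis_sum: "(\<Sum>i\<in>UNIV. c i *s axis i 1) = ((\<chi> i. c i) :: 'k^'j::finite)"
proof (rule vec_eq_iff[THEN iffD2], rule allI)
  fix j
  have "(\<Sum>i\<in>UNIV. c i *s axis i 1) $ j = (\<Sum>i\<in>UNIV. if i = j then c i else 0)"
    unfolding sum_component by (intro sum.cong refl) (auto simp: axis_def)
  then show "(\<Sum>i\<in>UNIV. c i *s axis i 1) $ j = (\<chi> i. c i) $ j" by simp
qed

lemma expansion_iff:
  assumes x: "x \<in> carrier V"
  shows "expansion V std_basis x c \<longleftrightarrow> c \<in> extensional std_basis \<and> (\<forall>i. c (w (axis i 1)) = v x $ i)"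
proof -
  have inj: "inj (\<lambda>i. w (axis i 1))"
    by (rule injI) (metis w_inj axis_eq_axis zero_neq_one)
  have cl: "(\<Oplus>\<^bsub>V\<^esub>b\<in>std_basis. c b \<odot>\<^bsub>V\<^esub> b) \<in> carrier V"
    by (rule V.M.finsum_closed) (auto simp: std_basis_def)
  have "v (\<Oplus>\<^bsub>V\<^esub>b\<in>std_basis. c b \<odot>\<^bsub>V\<^esub> b) = (\<Sum>b\<in>std_basis. v (c b \<odot>\<^bsub>V\<^esub> b))"
    by (rule v_finsum) (auto simp: std_basis_def)
  also have "\<dots> = (\<Sum>i\<in>UNIV. c (w (axis i 1)) *s axis i 1)"
    unfolding std_basis_def by (simp add: sum.reindex[OF inj] v_scale)
  also have "\<dots> = (\<chi> i. c (w (axis i 1)))" by (rule axis_sum)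
  finally have s: "v (\<Oplus>\<^bsub>V\<^esub>b\<in>std_basis. c b \<odot>\<^bsub>V\<^esub> b) = (\<chi> i. c (w (axis i 1)))" .
  have "x = y \<longleftrightarrow> v x = v y" if "y \<in> carrier V" for y
    using w_v[OF x] w_v[OF that] by metis
  from this[OF cl] have "x = (\<Oplus>\<^bsub>V\<^esub>b\<in>std_basis. c b \<odot>\<^bsub>V\<^esub> b) \<longleftrightarrow> v x = (\<chi> i. c (w (axis i 1)))"
    unfolding s .
  then show ?thesis
    unfolding expansion_def by (auto simp: PiE_def vec_eq_iff)
qed

lemma std_basis: "fin_basis V std_basis"
  unfolding fin_basis_def
proof (intro conjI ballI)
  show "finite std_basis" "std_basis \<subseteq> carrier V" by (auto simp: std_basis_def)
  fix x assume x: "x \<in> carrier V"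
  define c where "c = (\<lambda>b\<in>std_basis. v x $ (SOME i. b = w (axis i 1)))"
  have s: "(SOME i'. w (axis i 1) = w (axis i' 1)) = i" for i
    by (rule some_equality) (simp_all add: w_inj axis_eq_axis)
  show "\<exists>!c. expansion V std_basis x c"
  proof (rule ex1I[of _ c])
    show "expansion V std_basis x c"
      unfolding expansion_iff[OF x] by (auto simp: c_def std_basis_def s)
    show "c' = c" if e: "expansion V std_basis x c'" for c'
    proof (rule extensionalityI[of _ std_basis])
      show "c' \<in> extensional std_basis" using that by (simp add: expansion_iff[OF x])
      show "c \<in> extensional std_basis" by (simp add: c_def)
      show "c' b = c b" if b: "b \<in> std_basis" for b
      proof -
        obtain i where i: "b = w (axis i 1)" using b by (auto simp: std_basis_def)
        have "c' b = v x $ i" using e by (simp add: expansion_iff[OF x] i)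
        then show ?thesis using b by (simp add: c_def i s)
      qed
    qed
  qed
qed

lemma alpha3: "alpha3_lie_algebra V d"
proof -
  have mod: "module scalars V" by (rule V.module_axioms)
  have z: "brk x x = 0" for x :: "'k^('n + 'r)"
  proof -
    have "2 *s brk x x = brk x x + brk x x" by (simp add: vec_eq_iff)
    also have "\<dots> = 0" using brk_anti[of x x] by (metis add.right_inverse)
    finally have "2 *s brk x x = 0" .
    then show ?thesis using char_3(3)[OF char] unfolding vec.scale_eq_0_iff by blast
  qed
  have J: "x \<otimes>\<^bsub>V\<^esub> (y \<otimes>\<^bsub>V\<^esub> z) = x \<otimes>\<^bsub>V\<^esub> y \<otimes>\<^bsub>V\<^esub> z \<oplus>\<^bsub>V\<^esub> y \<otimes>\<^bsub>V\<^esub> (x \<otimes>\<^bsub>V\<^esub> z)"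
    if "x \<in> carrier V" "y \<in> carrier V" "z \<in> carrier V" for x y z
  proof -
    have "w a \<otimes>\<^bsub>V\<^esub> (w b \<otimes>\<^bsub>V\<^esub> w c) = w a \<otimes>\<^bsub>V\<^esub> w b \<otimes>\<^bsub>V\<^esub> w c \<oplus>\<^bsub>V\<^esub> w b \<otimes>\<^bsub>V\<^esub> (w a \<otimes>\<^bsub>V\<^esub> w c)" for a b c
      unfolding w_mult w_add brk_jacobi[of a b c] ..
    from this[of "v x" "v y" "v z"] show ?thesis
      unfolding w_v[OF that(1)] w_v[OF that(2)] w_v[OF that(3)] .
  qed
  have lin: "(\<lambda>y. x \<otimes>\<^bsub>V\<^esub> y) \<in> lin_maps V V" "(\<lambda>y. y \<otimes>\<^bsub>V\<^esub> x) \<in> lin_maps V V" if "x \<in> carrier V" for x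
    using that by (auto simp: lin_maps_def V.mult_add_left V.mult_add_right V.mult_smult_left V.mult_smult_right)
  have sq: "x \<otimes>\<^bsub>V\<^esub> x = \<zero>\<^bsub>V\<^esub>" if "x \<in> carrier V" for x
    using w_mult[of "v x" "v x"] w_v[OF that] by (simp add: z w_zero)
  have ddd: "d (d (d x)) = \<zero>\<^bsub>V\<^esub>" if "x \<in> carrier V" for x
    using d_w[of "v x"] w_v[OF that] by (simp add: d_w D_D_D w_zero)
  have "alpha3_rep V d"
    unfolding alpha3_rep_def using mod std_basis d_lin ddd by blast
  then show ?thesis
    unfolding alpha3_lie_algebra_def
  proof (intro conjI ballI)
    fix x y z assume x: "x \<in> carrier V" and y: "y \<in> carrier V" and z: "z \<in> carrier V"
    show "(\<lambda>y. x \<otimes>\<^bsub>V\<^esub> y) \<in> lin_maps V V" "(\<lambda>y. y \<otimes>\<^bsub>V\<^esub> x) \<in> lin_maps V V" by (rule lin[OF x])+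
    show "x \<otimes>\<^bsub>V\<^esub> x = \<zero>\<^bsub>V\<^esub>" by (rule sq[OF x])
    show "x \<otimes>\<^bsub>V\<^esub> (y \<otimes>\<^bsub>V\<^esub> z) = x \<otimes>\<^bsub>V\<^esub> y \<otimes>\<^bsub>V\<^esub> z \<oplus>\<^bsub>V\<^esub> y \<otimes>\<^bsub>V\<^esub> (x \<otimes>\<^bsub>V\<^esub> z)" by (rule J[OF x y z])
    show "d (x \<otimes>\<^bsub>V\<^esub> y) = d x \<otimes>\<^bsub>V\<^esub> y \<oplus>\<^bsub>V\<^esub> x \<otimes>\<^bsub>V\<^esub> d y" by (rule J[OF e0 x y])
  qed
qed

section \<open>Morphisms from the blocks\<close>

abbreviation H :: "('k, ('k \<Rightarrow> 'v) \<times> ('k \<times> 'k \<Rightarrow> 'v)) superalgebra" where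
  "H \<equiv> hom_superalgebra V d"

definition even_hom :: "'k^('n + 'r) \<Rightarrow> 'k \<Rightarrow> 'v" where
  "even_hom a = (\<lambda>t. w (t *s a))"

definition odd_hom :: "'k^('n + 'r) \<Rightarrow> 'k \<times> 'k \<Rightarrow> 'v" where
  "odd_hom b = (\<lambda>t. w (fst t *s b + snd t *s D b))"

text \<open>A morphism from \<open>J1\<close> is determined by its value at 1, which
  \<open>D\<close> must kill. In \<open>rep_homs_odd\<close> a morphism from \<open>J2\<close> is
  likewise determined by its value at \<open>(1, 0)\<close>, which \<open>D\<close> must kill in two
  steps.\<close>

lemma rep_homs_even: "rep_homs J1 J1_t V d = even_hom ` {a. D a = 0}"
proof
  show "even_hom ` {a. D a = 0} \<subseteq> rep_homs J1 J1_t V d"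
    by (auto simp: even_hom_def rep_homs_def lin_maps_def J1_t_def w_add w_scale d_w scale_right
        vec.scale_left_distrib)
  show "rep_homs J1 J1_t V d \<subseteq> even_hom ` {a. D a = 0}"
  proof
    fix u assume u: "u \<in> rep_homs J1 J1_t V d"
    then have ul: "u \<in> lin_maps J1 V" and u1: "u 1 \<in> carrier V" by (auto simp: rep_homs_def lin_maps_def)
    have "d (u 1) = u 0" using u by (auto simp: rep_homs_def J1_t_def dest: bspec[of _ _ 1])
    also have "\<dots> = \<zero>\<^bsub>V\<^esub>" using lin_maps_J1[OF ul, of 0] u1 by simp
    finally have "D (v (u 1)) = 0" using v_mult[OF e0 u1] by (simp add: v_e0 v_zero)
    moreover have "u = even_hom (v (u 1))"
    proof
      fix t
      show "u t = even_hom (v (u 1)) t"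
        using lin_maps_J1[OF ul, of t] w_scale[of t "v (u 1)"] by (simp add: even_hom_def w_v[OF u1])
    qed
    ultimately show "u \<in> even_hom ` {a. D a = 0}" by blast
  qed
qed

lemma rep_homs_odd: "rep_homs J2 J2_t V d = odd_hom ` {b. D (D b) = 0}"
proof
  show "odd_hom ` {b. D (D b) = 0} \<subseteq> rep_homs J2 J2_t V d"
    by (auto simp: odd_hom_def rep_homs_def lin_maps_def J2_t_def w_add w_scale d_w scale_right add_right
        w_inj vec.scale_left_distrib vec.scale_right_distrib add_ac)
  show "rep_homs J2 J2_t V d \<subseteq> odd_hom ` {b. D (D b) = 0}"
  proof
    fix u assume u: "u \<in> rep_homs J2 J2_t V d"
    then have ul: "u \<in> lin_maps J2 V" and uc: "u t \<in> carrier V" for t by (auto simp: rep_homs_def lin_maps_def)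
    have 1: "u (0, 1) = d (u (1, 0))" using u by (auto simp: rep_homs_def J2_t_def dest: bspec[of _ _ "(1, 0)"])
    have "d (u (0, 1)) = u (0, 0)" using u by (auto simp: rep_homs_def J2_t_def dest: bspec[of _ _ "(0, 1)"])
    also have "\<dots> = \<zero>\<^bsub>V\<^esub>" using lin_maps_J2[OF ul, of "(0, 0)"] uc by simp
    finally have "D (D (v (u (1, 0)))) = 0"
      unfolding 1 using v_mult[OF e0 uc] v_mult[OF e0, of "d (u (1, 0))"] e0 uc[of "(1, 0)"]
      by (simp add: v_e0 v_zero)
    moreover have "u = odd_hom (v (u (1, 0)))"
    proof
      fix t
      have "u (0, 1) = w (D (v (u (1, 0))))" unfolding 1 using w_v[OF uc[of "(1, 0)"]] d_w by metis
      then have "u t = fst t \<odot>\<^bsub>V\<^esub> w (v (u (1, 0))) \<oplus>\<^bsub>V\<^esub> snd t \<odot>\<^bsub>V\<^esub> w (D (v (u (1, 0))))"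
        using lin_maps_J2[OF ul, of t] w_v[OF uc[of "(1, 0)"]] by simp
      then show "u t = odd_hom (v (u (1, 0))) t" by (simp add: odd_hom_def w_scale w_add)
    qed
    ultimately show "u \<in> odd_hom ` {b. D (D b) = 0}" by blast
  qed
qed

lemma even_hom_inj: "even_hom a = even_hom a' \<longleftrightarrow> a = a'"
  unfolding even_hom_def by (metis vec.scale_one w_inj)

lemma odd_hom_inj: "odd_hom b = odd_hom b' \<longleftrightarrow> b = b'"
proof
  assume "odd_hom b = odd_hom b'"
  then have "odd_hom b (1, 0) = odd_hom b' (1, 0)" by simp
  then show "b = b'" by (simp add: odd_hom_def w_inj)
qed simp

abbreviation hom_pair :: "'k^('n + 'r) \<Rightarrow> 'k^('n + 'r) \<Rightarrow> ('k \<Rightarrow> 'v) \<times> ('k \<times> 'k \<Rightarrow> 'v)" where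
  "hom_pair a b \<equiv> (even_hom a, odd_hom b)"

lemma H_carrier: "carrier H = {hom_pair a b | a b. D a = 0 \<and> D (D b) = 0}"
  by (auto simp: hom_superalgebra_def rep_homs_even rep_homs_odd)

lemma H_cases:
  assumes "x \<in> carrier H"
  obtains a b where "x = hom_pair a b" "D a = 0" "D (D b) = 0"
  using assms unfolding H_carrier by blast

lemma H_mem: "hom_pair a b \<in> carrier H \<longleftrightarrow> D a = 0 \<and> D (D b) = 0"
  unfolding H_carrier using even_hom_inj odd_hom_inj by auto

lemma zero_homs: "(\<lambda>a. \<zero>\<^bsub>V\<^esub>) = even_hom 0" "(\<lambda>a. \<zero>\<^bsub>V\<^esub>) = odd_hom 0"
  by (simp_all add: even_hom_def odd_hom_def w_zero)

lemma H_part: "part H 0 = {hom_pair a 0 | a. D a = 0}" "part H 1 = {hom_pair 0 b | b. D (D b) = 0}"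
  by (auto simp: hom_superalgebra_def rep_homs_even rep_homs_odd zero_homs)

lemma H_ops:
  "hom_pair a b \<oplus>\<^bsub>H\<^esub> hom_pair a' b' = hom_pair (a + a') (b + b')"
  "c \<odot>\<^bsub>H\<^esub> hom_pair a b = hom_pair (c *s a) (c *s b)"
  "\<zero>\<^bsub>H\<^esub> = hom_pair 0 0"
  by (auto simp: hom_superalgebra_def even_hom_def odd_hom_def w_add w_scale w_zero add_right scale_right
      vec.scale_right_distrib add_ac mult.commute)

lemma H_mult:
  assumes "D a = 0" "D a' = 0" "D (D b) = 0" "D (D b') = 0"
  shows "hom_pair a b \<otimes>\<^bsub>H\<^esub> hom_pair a' b' =
    hom_pair (brk a a' + (- brk b (D b') + brk (D b) b')) (brk a b' + brk b a')"
proof -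
  have 1: "D (brk a b' + brk b a') = brk a (D b') + brk (D b) a'"
    using assms(1,2) D_derivation[of a b'] D_derivation[of b a'] by (simp add: add_right)
  have 2: "brk (t *s a) a' + t *s (- brk b (D b') + brk (D b) b') =
      t *s (brk a a' + (- brk b (D b') + brk (D b) b'))" for t
    by (simp only: scale_left vec.scale_right_distrib)
  have 3: "brk a (s *s b' + t *s D b') + brk (s *s b + t *s D b) a' =
      s *s (brk a b' + brk b a') + t *s D (brk a b' + brk b a')" for s t
    unfolding 1 by (simp add: add_right add_left scale_right scale_left vec.scale_right_distrib add_ac)
  show ?thesis
    using 2 3
    by (simp add: hom_superalgebra_def even_hom_def odd_hom_def w_mult w_minus w_scale w_add fun_eq_iff)
qed

lemma D_mult:
  assumes "D a = 0" "D a' = 0" "D (D b) = 0" "D (D b') = 0"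
  shows "D (brk a a' + (- brk b (D b') + brk (D b) b')) = 0" "D (D (brk a b' + brk b a')) = 0"
  using assms D_derivation[of a a'] D_derivation[of b "D b'"] D_derivation[of "D b" b']
    D_derivation[of a b'] D_derivation[of b a'] D_derivation[of a "D b'"] D_derivation[of "D b" a']
  by (simp_all add: add_right diff_right)

lemma H_super: "super_nonassoc_algebra H"
proof -
  have ab: "abelian_group H"
  proof (rule abelian_groupI)
    fix x assume "x \<in> carrier H"
    then obtain a b where ab: "x = hom_pair a b" "D a = 0" "D (D b) = 0" by (rule H_cases)
    then show "\<exists>y\<in>carrier H. y \<oplus>\<^bsub>H\<^esub> x = \<zero>\<^bsub>H\<^esub>"
      by (intro bexI[of _ "hom_pair (- a) (- b)"]) (simp_all add: H_ops H_mem)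
  qed (auto elim!: H_cases simp: H_mem H_ops add_right add_ac)
  have mod: "module scalars H"
    by (rule moduleI)
      (use ab in \<open>auto intro: cring_from_type_algebra elim!: H_cases simp: H_mem H_ops scale_right
        vec.scale_left_distrib vec.scale_right_distrib\<close>)
  have cl: "x \<otimes>\<^bsub>H\<^esub> y \<in> carrier H" if "x \<in> carrier H" "y \<in> carrier H" for x y
    using that by (elim H_cases) (simp only: H_mult H_mem D_mult simp_thms)
  have bil: "(x \<oplus>\<^bsub>H\<^esub> y) \<otimes>\<^bsub>H\<^esub> z = x \<otimes>\<^bsub>H\<^esub> z \<oplus>\<^bsub>H\<^esub> y \<otimes>\<^bsub>H\<^esub> z"
    "z \<otimes>\<^bsub>H\<^esub> (x \<oplus>\<^bsub>H\<^esub> y) = z \<otimes>\<^bsub>H\<^esub> x \<oplus>\<^bsub>H\<^esub> z \<otimes>\<^bsub>H\<^esub> y"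
    "(c \<odot>\<^bsub>H\<^esub> x) \<otimes>\<^bsub>H\<^esub> y = c \<odot>\<^bsub>H\<^esub> (x \<otimes>\<^bsub>H\<^esub> y)" "x \<otimes>\<^bsub>H\<^esub> (c \<odot>\<^bsub>H\<^esub> y) = c \<odot>\<^bsub>H\<^esub> (x \<otimes>\<^bsub>H\<^esub> y)"
    if xyz: "x \<in> carrier H" "y \<in> carrier H" "z \<in> carrier H" for x y z c
  proof -
    obtain a b where x: "x = hom_pair a b" "D a = 0" "D (D b) = 0" using xyz(1) by (rule H_cases)
    obtain a' b' where y: "y = hom_pair a' b'" "D a' = 0" "D (D b') = 0" using xyz(2) by (rule H_cases)
    obtain a'' b'' where z: "z = hom_pair a'' b''" "D a'' = 0" "D (D b'') = 0" using xyz(3) by (rule H_cases)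
    note s = H_mult H_ops add_left add_right scale_left scale_right vec.scale_right_distrib
      even_hom_inj odd_hom_inj
    show "(x \<oplus>\<^bsub>H\<^esub> y) \<otimes>\<^bsub>H\<^esub> z = x \<otimes>\<^bsub>H\<^esub> z \<oplus>\<^bsub>H\<^esub> y \<otimes>\<^bsub>H\<^esub> z"
      "z \<otimes>\<^bsub>H\<^esub> (x \<oplus>\<^bsub>H\<^esub> y) = z \<otimes>\<^bsub>H\<^esub> x \<oplus>\<^bsub>H\<^esub> z \<otimes>\<^bsub>H\<^esub> y"
      "(c \<odot>\<^bsub>H\<^esub> x) \<otimes>\<^bsub>H\<^esub> y = c \<odot>\<^bsub>H\<^esub> (x \<otimes>\<^bsub>H\<^esub> y)" "x \<otimes>\<^bsub>H\<^esub> (c \<odot>\<^bsub>H\<^esub> y) = c \<odot>\<^bsub>H\<^esub> (x \<otimes>\<^bsub>H\<^esub> y)"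
      using x y z by (simp_all add: s)
  qed
  have pt: "part H p \<subseteq> carrier H" for p
    using H_part by (cases p) (auto simp: H_mem)
  show ?thesis
    unfolding super_nonassoc_algebra_def nonassoc_algebra_def
      nonassoc_algebra_axioms_def super_nonassoc_algebra_axioms_def
    using mod cl bil pt by auto
qed

text \<open>The trace of \<open>u \<circ> f\<close> is \<open>f (u 1)\<close>, so \<open>a\<close>
  is negligible when every functional vanishing on the image of \<open>D\<close> vanishes at it. The
  coordinates of \<open>proj0\<close> are such functionals, and what \<open>comp 0 a = 0\<close>
  leaves of \<open>a\<close> lies in the image of \<open>D\<close>.\<close>

lemma negligible_even:
  assumes a: "D a = 0"
  shows "even_hom a \<in> negligible_homs J1 J1_t V d \<longleftrightarrow> comp 0 a = 0"
proof -
  have mod: "module scalars V" by (rule V.module_axioms)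
  have u: "even_hom a \<in> rep_homs J1 J1_t V d" using a by (auto simp: rep_homs_even)
  have u1: "even_hom a 1 = w a" by (simp add: even_hom_def)
  have tr: "endo_trace V (even_hom a \<circ> f) = f (w a)" if "f \<in> rep_homs V d J1 J1_t" for f
    using trace_J1[OF mod std_basis, of "even_hom a" f] u that by (simp add: rep_homs_def u1)
  show ?thesis
  proof
    assume n: "even_hom a \<in> negligible_homs J1 J1_t V d"
    have "proj0 a $ i = 0" for i
    proof -
      have f: "(\<lambda>x. proj0 (v x) $ i) \<in> rep_homs V d J1 J1_t"
        unfolding rep_homs_def lin_maps_def
        using e0 by (auto simp: v_add v_scale proj0_linear v_mult v_e0 proj0_D[OF char] J1_t_def)
      then show ?thesis using n tr[OF f] by (auto simp: negligible_homs_def)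
    qed
    then have "proj0 a = 0" by (simp add: vec_eq_iff)
    then show "comp 0 a = 0" using proj0_kernel[OF a char] by simp
  next
    assume z: "comp 0 a = 0"
    have "comp (-2) a = 0" "comp (-1) a = 0"
      using D_kernel(2)[OF char a] by (simp_all add: bounded_below_def)
    then have "a = comp 1 a + comp 2 a" using comp_split[of a] z by simp
    then obtain b where b: "a = D b" using high_in_image[OF char, of a] by metis
    have "f (w a) = 0" if f: "f \<in> rep_homs V d J1 J1_t" for f
    proof -
      have "f (d (w b)) = J1_t (f (w b))" using f by (simp add: rep_homs_def)
      then show ?thesis by (simp add: d_w b J1_t_def)
    qed
    then show "even_hom a \<in> negligible_homs J1 J1_t V d"
      using u tr by (simp add: negligible_homs_def)
  qed
qed

text \<open>The trace is twice the first coordinate of \<open>f\<close> at \<open>b\<close>. Testing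
  against suitable \<open>f\<close> isolates \<open>comp (-1) b\<close>; conversely, without that
  component \<open>b\<close> is the sum of an element of the kernel and one of the image of
  \<open>D\<close>, and the first coordinate of any \<open>f\<close> vanishes on both.\<close>

lemma negligible_odd:
  assumes b: "D (D b) = 0"
  shows "odd_hom b \<in> negligible_homs J2 J2_t V d \<longleftrightarrow> comp (-1) b = 0"
proof -
  have mod: "module scalars V" by (rule V.module_axioms)
  have u: "odd_hom b \<in> rep_homs J2 J2_t V d" using b by (auto simp: rep_homs_odd)
  have u1: "odd_hom b (1, 0) = w b" "odd_hom b (0, 1) = d (w b)" by (simp_all add: odd_hom_def d_w)
  have fd: "f (d x) = (0, fst (f x))" if "f \<in> rep_homs V d J2 J2_t" "x \<in> carrier V" for f x
    using that by (simp add: rep_homs_def J2_t_def)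
  have tr: "endo_trace V (odd_hom b \<circ> f) = 2 * fst (f (w b))" if "f \<in> rep_homs V d J2 J2_t" for f
    using trace_J2[OF mod std_basis, of "odd_hom b" f] u that fd[OF that w_closed[of b]]
    by (simp add: rep_homs_def u1)
  show ?thesis
  proof
    assume n: "odd_hom b \<in> negligible_homs J2 J2_t V d"
    have "comp (-1) b $ i = 0" for i
    proof -
      \<comment> \<open>The second coordinate is dictated by compatibility with \<open>D\<close>:
        the bracket with \<open>- ff\<close> undoes \<open>D\<close> on degree -1, so at
        \<open>D x\<close> it returns the first coordinate at \<open>x\<close>.\<close>
      have f: "(\<lambda>x. (comp (-1) (v x) $ i, - brk ff (comp 1 (v x)) $ i)) \<in> rep_homs V d J2 J2_t"
        unfolding rep_homs_def lin_maps_def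
        using e0
        by (auto simp: ff_D[OF comp_layer] v_add v_scale comp_linear v_mult v_e0 J2_t_def add_right scale_right comp_D comp_trivial)
      then have "2 * comp (-1) b $ i = 0" using n tr[OF f] by (auto simp: negligible_homs_def)
      then show ?thesis using char_3(3)[OF char] by simp
    qed
    then show "comp (-1) b = 0" by (simp add: vec_eq_iff)
  next
    assume z: "comp (-1) b = 0"
    have "comp (-2) b = 0" using DD_kernel[OF char b] by (simp add: bounded_below_def)
    then have bs: "b = comp 0 b + (comp 1 b + comp 2 b)" using comp_split[of b] z by simp
    obtain c where c: "comp 1 b + comp 2 b = D c" using high_in_image[OF char] .
    define y where "y = comp 0 b - kap b *s hh"
    have y: "D y = 0" by (simp add: y_def diff_right scale_right D_comp_0 D_hh_3[OF char])
    \<comment> \<open>The term with \<open>ff\<close> restores the \<open>kap b *s hh\<close> that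
      \<open>y\<close> lacks, since \<open>D ff = - hh\<close>.\<close>
    have "b = y + D (c - kap b *s ff)"
      using bs c by (simp add: y_def diff_right scale_right brk_ef)
    then have wb: "w b = w y \<oplus>\<^bsub>V\<^esub> d (w (c - kap b *s ff))" by (simp add: d_w w_add)
    have "fst (f (w b)) = 0" if f: "f \<in> rep_homs V d J2 J2_t" for f
    proof -
      have add: "f (x \<oplus>\<^bsub>V\<^esub> x') = (fst (f x) + fst (f x'), snd (f x) + snd (f x'))"
        if "x \<in> carrier V" "x' \<in> carrier V" for x x'
        using f that by (simp add: rep_homs_def lin_maps_def)
      have "(0, fst (f (w y))) = f (w 0)" using fd[OF f w_closed[of y]] by (simp add: d_w y)
      also have "f (w 0) = (0, 0)"
      proof -
        have "f (w 0) = f (w 0 \<oplus>\<^bsub>V\<^esub> w 0)" using w_add[of 0 0] by (simp only: add_0_left)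
        also have "\<dots> = (fst (f (w 0)) + fst (f (w 0)), snd (f (w 0)) + snd (f (w 0)))"
          by (rule add[OF w_closed w_closed])
        finally have "fst (f (w 0)) = fst (f (w 0)) + fst (f (w 0))" "snd (f (w 0)) = snd (f (w 0)) + snd (f (w 0))"
          by (metis fst_conv, metis snd_conv)
        then show ?thesis by (simp only: prod_eq_iff add_cancel_right_right fst_conv snd_conv simp_thms)
      qed
      finally have 1: "fst (f (w y)) = 0" by simp
      have "fst (f (d (w (c - kap b *s ff)))) = 0" using fd[OF f w_closed] by simp
      then show ?thesis unfolding wb using 1 e0 by (subst add) simp_all
    qed
    then show "odd_hom b \<in> negligible_homs J2 J2_t V d"
      using u tr by (simp add: negligible_homs_def)
  qed
qed

section \<open>Comparison with the superalgebra of the root\<close>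

definition to_super :: "('k \<Rightarrow> 'v) \<times> ('k \<times> 'k \<Rightarrow> 'v) \<Rightarrow> 'k^('n + 'r)" where
  "to_super u = comp 0 (v (fst u 1)) + comp (-1) (v (snd u (1, 0)))"

lemma to_super_pair: "to_super (hom_pair a b) = comp 0 a + comp (-1) b"
  by (simp add: to_super_def even_hom_def odd_hom_def)

lemma comp_0_even: "D a = 0 \<Longrightarrow> comp 0 a \<in> even_part" for a :: "'k^('n + 'r)"
  using D_kernel(1)[OF char, of a 0] comp_layer[of 0 a] by (simp add: even_part_def)

text \<open>The even and odd vectors are bounded below by 0 and -1, and \<open>to_super\<close>
  reads off their lowest components, so \<open>comp_brk_lowest\<close> computes each term. For two
  odd morphisms \<open>D\<close> raises one bound to 1, and the lowest degree of the bracket is 0,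
  as it should be.\<close>

lemma to_super_mult:
  assumes a: "D a = 0" "D a' = 0" and b: "D (D b) = 0" "D (D b') = 0"
  shows "to_super (hom_pair a b \<otimes>\<^bsub>H\<^esub> hom_pair a' b') = sbrk (to_super (hom_pair a b)) (to_super (hom_pair a' b'))"
proof -
  note lo = D_kernel(2)[OF char a(1)] D_kernel(2)[OF char a(2)] DD_kernel[OF char b(1)] DD_kernel[OF char b(2)]
  note lD = D_bounded[OF lo(3)] D_bounded[OF lo(4)]
  have 1: "comp 0 (brk a a') = brk (comp 0 a) (comp 0 a')" using comp_brk_lowest[OF lo(1,2)] by simp
  have 2: "comp (-1) (brk a b') = brk (comp 0 a) (comp (-1) b')" using comp_brk_lowest[OF lo(1,4)] by simp
  have 3: "comp (-1) (brk b a') = brk (comp (-1) b) (comp 0 a')" using comp_brk_lowest[OF lo(3,2)] by simp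
  have 4: "comp 0 (brk b (D b')) = brk (comp (-1) b) (D (comp (-1) b'))"
    using comp_brk_lowest[OF lo(3) lD(2)] by (simp add: comp_D)
  have 5: "comp 0 (brk (D b) b') = brk (D (comp (-1) b)) (comp (-1) b')"
    using comp_brk_lowest[OF lD(1) lo(4)] by (simp add: comp_D)
  note e = comp_0_even[OF a(1)] comp_0_even[OF a(2)]
  show ?thesis
    unfolding H_mult[OF a b] to_super_pair super.add_left super.add_right
      sbrk_ee[OF e] sbrk_eo[OF e(1) comp_layer] sbrk_oe[OF comp_layer e(2)] sbrk_oo[OF comp_layer comp_layer]
    by (simp add: comp_linear 1 2 3 4 5 algebra_simps)
qed

theorem semisimplification_iso:
  "superalgebra_iso (semisimplification V d) (vec_superalgebra super_carrier sbrk super_parity)"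
proof -
  let ?M = "vec_superalgebra super_carrier sbrk super_parity :: ('k, 'k^('n + 'r)) superalgebra"
  have M: "super_nonassoc_algebra ?M"
    by (rule super.vec_super[OF super_carrier_subspace sbrk_carrier])
  then have M': "nonassoc_algebra ?M" by (simp add: super_nonassoc_algebra_def)
  have in_super: "to_super (hom_pair a b) \<in> super_carrier" if "D a = 0" for a b :: "'k^('n + 'r)"
    unfolding to_super_pair super_carrier_iff using comp_0_even[OF that] comp_layer by blast
  have lin: "to_super \<in> lin_maps H ?M"
    unfolding lin_maps_def using in_super
    by (auto elim!: H_cases simp: H_ops to_super_pair comp_linear vec.scale_right_distrib add_ac)
  have mult: "to_super (x \<otimes>\<^bsub>H\<^esub> y) = to_super x \<otimes>\<^bsub>?M\<^esub> to_super y" if "x \<in> carrier H" "y \<in> carrier H" for x y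
    using that by (elim H_cases) (simp only: to_super_mult vec_superalgebra_simps)
  have zero: "comp 0 a + comp (-1) b = 0 \<longleftrightarrow> comp 0 a = 0 \<and> comp (-1) b = 0" for a b :: "'k^('n + 'r)"
  proof
    assume h: "comp 0 a + comp (-1) b = 0"
    have "comp 0 (comp 0 a + comp (-1) b) = comp 0 a" "comp (-1) (comp 0 a + comp (-1) b) = comp (-1) b"
      by (simp_all add: comp_linear)
    then show "comp 0 a = 0 \<and> comp (-1) b = 0" unfolding h by (simp add: comp_linear)
  qed simp
  have ker: "negligible_homs J1 J1_t V d \<times> negligible_homs J2 J2_t V d =
      {x \<in> carrier H. to_super x = \<zero>\<^bsub>?M\<^esub>}"
  proof -
    have "negligible_homs J1 J1_t V d = even_hom ` {a. D a = 0 \<and> comp 0 a = 0}"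
      using negligible_even rep_homs_even by (auto simp: negligible_homs_def)
    moreover have "negligible_homs J2 J2_t V d = odd_hom ` {b. D (D b) = 0 \<and> comp (-1) b = 0}"
      using negligible_odd rep_homs_odd by (auto simp: negligible_homs_def)
    ultimately show ?thesis by (auto simp: H_carrier to_super_pair zero)
  qed
  have surj: "carrier ?M \<subseteq> to_super ` carrier H"
  proof
    fix x assume "x \<in> carrier ?M"
    then have x: "x \<in> super_carrier" by simp
    have "D (comp 0 x) = 0" "D (D (comp (-1) x)) = 0"
      using x D_D[OF comp_layer, of "-1" x] by (simp_all add: super_carrier_def)
    moreover have "x = to_super (hom_pair (comp 0 x) (comp (-1) x))"
      using super_carrier_expand[OF x] by (simp add: to_super_pair)
    ultimately show "x \<in> to_super ` carrier H" unfolding H_carrier by blast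
  qed
  have parts: "to_super ` part H p = part ?M p" for p
  proof (cases "p = 0")
    case True
    have "to_super ` part H 0 = even_part"
    proof
      show "to_super ` part H 0 \<subseteq> even_part"
        by (auto simp: H_part to_super_pair comp_linear comp_0_even)
      show "even_part \<subseteq> to_super ` part H 0"
      proof
        fix x :: "'k^('n + 'r)" assume x: "x \<in> even_part"
        then have "x = to_super (hom_pair x 0)" by (simp add: to_super_pair comp_linear)
        then show "x \<in> to_super ` part H 0" using even_D[OF x] unfolding H_part by blast
      qed
    qed
    then show ?thesis by (simp add: True super_part_even)
  next
    case False
    then have p: "p = 1" by simp
    have "to_super ` part H 1 = layer (-1)"
    proof
      show "to_super ` part H 1 \<subseteq> layer (-1)"
        by (auto simp: H_part to_super_pair comp_linear comp_layer)
      show "layer (-1) \<subseteq> to_super ` part H 1"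
      proof
        fix x :: "'k^('n + 'r)" assume x: "x \<in> layer (-1)"
        then have "x = to_super (hom_pair 0 x)" by (simp add: to_super_pair comp_linear)
        moreover have "D (D x) = 0" using D_D[OF x] by simp
        ultimately show "x \<in> to_super ` part H 1" unfolding H_part by blast
      qed
    qed
    then show ?thesis by (simp add: p super_part_odd)
  qed
  show ?thesis
    using quotient_iso[OF H_super M' lin mult ker surj parts]
    unfolding superalgebra_iso_def semisimplification_def by (metis (no_types, lifting))
qed

end

section \<open>The lattice of type \<open>E\<^sub>8\<close>\<close>

lemma exhaust_7: "x = 1 \<or> x = 2 \<or> x = 3 \<or> x = 4 \<or> x = 5 \<or> x = 6 \<or> x = 7" for x :: 7
proof (induct x)
  case (of_int z)
  then have "0 \<le> z" "z < 7" by simp_all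
  then have "z = 0 \<or> z = 1 \<or> z = 2 \<or> z = 3 \<or> z = 4 \<or> z = 5 \<or> z = 6" by arith
  then show ?case by auto
qed

lemma exhaust_8: "x = 1 \<or> x = 2 \<or> x = 3 \<or> x = 4 \<or> x = 5 \<or> x = 6 \<or> x = 7 \<or> x = 8" for x :: 8
proof (induct x)
  case (of_int z)
  then have "0 \<le> z" "z < 8" by simp_all
  then have "z = 0 \<or> z = 1 \<or> z = 2 \<or> z = 3 \<or> z = 4 \<or> z = 5 \<or> z = 6 \<or> z = 7" by arith
  then show ?case by auto
qed

lemma UNIV_7: "UNIV = {1, 2, 3, 4, 5, 6, 7 :: 7}"
  using exhaust_7 by auto

lemma UNIV_8: "UNIV = {1, 2, 3, 4, 5, 6, 7, 8 :: 8}"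
  using exhaust_8 by auto

lemma forall_7: "(\<forall>i::7. P i) \<longleftrightarrow> P 1 \<and> P 2 \<and> P 3 \<and> P 4 \<and> P 5 \<and> P 6 \<and> P 7"
  using exhaust_7 by metis

lemma forall_8: "(\<forall>i::8. P i) \<longleftrightarrow> P 1 \<and> P 2 \<and> P 3 \<and> P 4 \<and> P 5 \<and> P 6 \<and> P 7 \<and> P 8"
  using exhaust_8 by metis

lemma sum_7: "sum f (UNIV :: 7 set) = f 1 + f 2 + f 3 + f 4 + f 5 + f 6 + f 7"
  unfolding UNIV_7 by (simp add: ac_simps)

lemma sum_8: "sum f (UNIV :: 8 set) = f 1 + f 2 + f 3 + f 4 + f 5 + f 6 + f 7 + f 8"
  unfolding UNIV_8 by (simp add: ac_simps)

lemma vector_7: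
  fixes a1 a2 a3 a4 a5 a6 a7 :: "'a::zero"
  defines "v \<equiv> (vector [a1, a2, a3, a4, a5, a6, a7] :: 'a^7)"
  shows "v $ 1 = a1" "v $ 2 = a2" "v $ 3 = a3" "v $ 4 = a4" "v $ 5 = a5" "v $ 6 = a6" "v $ 7 = a7"
  unfolding v_def vector_def by simp_all

lemma vector_8:
  fixes a1 a2 a3 a4 a5 a6 a7 a8 :: "'a::zero"
  defines "v \<equiv> (vector [a1, a2, a3, a4, a5, a6, a7, a8] :: 'a^8)"
  shows "v $ 1 = a1" "v $ 2 = a2" "v $ 3 = a3" "v $ 4 = a4" "v $ 5 = a5" "v $ 6 = a6" "v $ 7 = a7" "v $ 8 = a8"
  unfolding v_def vector_def by simp_all

text \<open>One half of the Cartan matrix: ones on the diagonal and each edge of the diagram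
  oriented once, so that adding the transpose gives \<open>cartan_e8\<close>.\<close>

definition gram_e8 :: "int^8^8" where
  "gram_e8 = vector
    [vector [1, 0, -1, 0, 0, 0, 0, 0],
     vector [0, 1, 0, -1, 0, 0, 0, 0],
     vector [0, 0, 1, -1, 0, 0, 0, 0],
     vector [0, 0, 0, 1, -1, 0, 0, 0],
     vector [0, 0, 0, 0, 1, -1, 0, 0],
     vector [0, 0, 0, 0, 0, 1, -1, 0],
     vector [0, 0, 0, 0, 0, 0, 1, -1],
     vector [0, 0, 0, 0, 0, 0, 0, 1]]"

text \<open>The sum of squares obtained by completing squares from the ends of the Dynkin diagram
  towards its branch node.\<close>

lemma gram_e8_squares:
  "120 * (\<Sum>i\<in>UNIV. \<Sum>j\<in>UNIV. gram_e8 $ i $ j * v $ i * v $ j) =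
    30 * (2 * v $ 1 - v $ 3)\<^sup>2 + 10 * (3 * v $ 3 - 2 * v $ 4)\<^sup>2 + 30 * (2 * v $ 2 - v $ 4)\<^sup>2 +
    30 * (2 * v $ 8 - v $ 7)\<^sup>2 + 10 * (3 * v $ 7 - 2 * v $ 6)\<^sup>2 + 5 * (4 * v $ 6 - 3 * v $ 5)\<^sup>2 +
    3 * (5 * v $ 5 - 4 * v $ 4)\<^sup>2 + 2 * (v $ 4)\<^sup>2"
  by (simp add: gram_e8_def sum_8 vector_8) (simp add: power2_eq_square algebra_simps)

interpretation e8: even_lattice gram_e8
proof
  fix v :: "int^8" assume "v \<noteq> 0"
  show "(\<Sum>i\<in>UNIV. \<Sum>j\<in>UNIV. gram_e8 $ i $ j * v $ i * v $ j) > 0"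
  proof (rule ccontr)
    let ?q = "\<Sum>i\<in>UNIV. \<Sum>j\<in>UNIV. gram_e8 $ i $ j * v $ i * v $ j"
    assume "\<not> ?q > 0"
    then have le: "120 * ?q \<le> 0" by simp
    have nn: "(2 * v $ 1 - v $ 3)\<^sup>2 \<ge> 0" "(3 * v $ 3 - 2 * v $ 4)\<^sup>2 \<ge> 0" "(2 * v $ 2 - v $ 4)\<^sup>2 \<ge> 0"
      "(2 * v $ 8 - v $ 7)\<^sup>2 \<ge> 0" "(3 * v $ 7 - 2 * v $ 6)\<^sup>2 \<ge> 0" "(4 * v $ 6 - 3 * v $ 5)\<^sup>2 \<ge> 0"
      "(5 * v $ 5 - 4 * v $ 4)\<^sup>2 \<ge> 0" "(v $ 4)\<^sup>2 \<ge> 0" by simp_all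
    have "(2 * v $ 1 - v $ 3)\<^sup>2 = 0" "(3 * v $ 3 - 2 * v $ 4)\<^sup>2 = 0" "(2 * v $ 2 - v $ 4)\<^sup>2 = 0"
      "(2 * v $ 8 - v $ 7)\<^sup>2 = 0" "(3 * v $ 7 - 2 * v $ 6)\<^sup>2 = 0" "(4 * v $ 6 - 3 * v $ 5)\<^sup>2 = 0"
      "(5 * v $ 5 - 4 * v $ 4)\<^sup>2 = 0" "(v $ 4)\<^sup>2 = 0"
      using le nn unfolding gram_e8_squares by linarith+
    then have "v = 0" by (simp add: vec_eq_iff forall_8)
    then show False using \<open>v \<noteq> 0\<close> by simp
  qed
qed

lemma gram_e8_diag: "gram_e8 $ i $ i = 1"
proof -
  have "\<forall>i. gram_e8 $ i $ i = 1" unfolding forall_8 by (simp add: gram_e8_def vector_8)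
  then show ?thesis by simp
qed

lemma gram_e8_sum: "gram_e8 $ i $ j + gram_e8 $ j $ i = cartan_e8 $ i $ j"
proof -
  have "\<forall>i j. gram_e8 $ i $ j + gram_e8 $ j $ i = cartan_e8 $ i $ j"
    unfolding forall_8 by (simp add: gram_e8_def cartan_e8_def vector_8)
  then show ?thesis by simp
qed

lemma cartan_e8_off: "i \<noteq> j \<Longrightarrow> cartan_e8 $ i $ j \<le> 0"
proof -
  have "\<forall>i j. i \<noteq> j \<longrightarrow> cartan_e8 $ i $ j \<le> 0"
    unfolding forall_8 by (simp add: cartan_e8_def vector_8)
  then show "i \<noteq> j \<Longrightarrow> cartan_e8 $ i $ j \<le> 0" by simp
qed

lemma e8_simple_root: "e8.is_root (axis i 1)"
proof -
  have "(\<Sum>i'\<in>UNIV. \<Sum>j\<in>UNIV. gram_e8 $ i' $ j * axis i 1 $ i' * axis i 1 $ j) =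
      (\<Sum>i'\<in>UNIV. \<Sum>j\<in>UNIV. if i = j then (if i = i' then gram_e8 $ i' $ j else 0) else 0)"
    by (intro sum.cong refl) (simp add: axis_def)
  then show ?thesis by (simp add: e8.is_root_def e8.m_def gram_e8_diag)
qed

text \<open>An index type for the roots obtained without listing them; its finiteness comes from the
  injectivity of reduction modulo 3 on roots.\<close>

typedef e8_root = "{v. e8.is_root v}"
  using e8_simple_root by blast

instance e8_root :: finite
proof
  have "finite (Rep_e8_root ` UNIV)"
    by (rule finite_subset[OF _ e8.finite_roots]) (use Rep_e8_root in auto)
  then show "finite (UNIV :: e8_root set)"
    by (rule finite_imageD) (simp add: inj_on_def Rep_e8_root_inject)
qed

definition node_e8 :: "7 \<Rightarrow> 8" where
  "node_e8 i = (vector [2, 3, 4, 5, 6, 7, 8] :: 8^7) $ i"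

lemma node_e8_simps [simp]: "node_e8 1 = 2" "node_e8 2 = 3" "node_e8 3 = 4" "node_e8 4 = 5"
  "node_e8 5 = 6" "node_e8 6 = 7" "node_e8 7 = 8"
  by (simp_all add: node_e8_def vector_7)

lemma node_e8_inj: "inj node_e8"
proof -
  have "\<forall>i j. node_e8 i = node_e8 j \<longrightarrow> i = j" unfolding forall_7 by simp
  then show ?thesis by (simp add: inj_def)
qed

lemma node_e8_range: "range node_e8 = UNIV - {1}"
  unfolding UNIV_7 UNIV_8 by (auto simp: insert_Diff_if)

interpretation e8: simply_laced_basis gram_e8 Rep_e8_root
proof
  show "inj Rep_e8_root" by (simp add: inj_def Rep_e8_root_inject)
  show "range Rep_e8_root = {v. e8.is_root v}"
    using type_definition.Rep_range[OF type_definition_e8_root] .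
  show "gram_e8 $ i $ i = 1" for i by (rule gram_e8_diag)
  show "gram_e8 $ i $ j + gram_e8 $ j $ i \<le> 0" if "i \<noteq> j" for i j
    using cartan_e8_off[OF that] by (simp add: gram_e8_sum)
qed

lemma e8_pair_simple: "e8.pair (axis i 1) (axis j 1) = cartan_e8 $ i $ j"
  by (simp add: e8.pair_simple gram_e8_sum)

interpretation e8: simply_laced_node gram_e8 Rep_e8_root 1 3 node_e8 2
proof
  show "(1::8) \<noteq> 3" by simp
  show "e8.pair (axis 1 1) (axis 3 1) = -1" by (simp add: e8_pair_simple cartan_e8_def vector_8)
  have "\<forall>i. i \<noteq> 1 \<longrightarrow> i \<noteq> 3 \<longrightarrow> cartan_e8 $ 1 $ i = 0"
    unfolding forall_8 by (simp add: cartan_e8_def vector_8)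
  then show "e8.pair (axis 1 1) (axis i 1) = 0" if "i \<noteq> 1" "i \<noteq> 3" for i
    using that by (simp add: e8_pair_simple)
  show "inj node_e8" by (rule node_e8_inj)
  show "range node_e8 = UNIV - {1}" by (rule node_e8_range)
  show "node_e8 2 = 3" by simp
qed

text \<open>The second matrix comes from the first by subtracting the row of node 1 from that of
  node 3 and deleting node 1; the entry \<open>2 + 1 = 3\<close> so produced is congruent to
  0.\<close>

lemma cartan_g86_lift: "3 dvd cartan_g86 $ i $ j - e8.pair (e8.coroot_lift i) (axis (node_e8 j) 1)"
proof -
  have p: "e8.pair (e8.coroot_lift i) (axis k 1) = cartan_e8 $ node_e8 i $ k - (if i = 2 then cartan_e8 $ 1 $ k else 0)"
    for i k by (simp add: e8.coroot_lift_def e8_pair_simple)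
  have "\<forall>i j. 3 dvd cartan_g86 $ i $ j - (cartan_e8 $ node_e8 i $ node_e8 j - (if i = 2 then cartan_e8 $ 1 $ node_e8 j else 0))"
    unfolding forall_7 by (simp add: cartan_g86_def cartan_e8_def vector_7 vector_8)
  then show ?thesis by (simp add: p)
qed

section \<open>Ranks of the two matrices\<close>

lemma rank_cartan_e8: "rank (reduced_matrix cartan_e8 :: 'k::field^8^8) = 8"
proof -
  have "rank (reduced_matrix cartan_e8 :: 'k^8^8) = CARD(8)"
  proof (rule full_rank)
    fix x :: "'k^8" assume "reduced_matrix cartan_e8 *v x = 0"
    then have y: "(reduced_matrix cartan_e8 *v x) $ i = 0" for i by simp
    let ?y = "\<lambda>i. (reduced_matrix cartan_e8 *v x) $ i"
    \<comment> \<open>The coefficients here and below are the rows of the inverse matrix, which is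
      integral because the determinant is 1.\<close>
    have "x $ 1 = (4) * ?y 1 + (5) * ?y 2 + (7) * ?y 3 + (10) * ?y 4 + (8) * ?y 5 + (6) * ?y 6 + (4) * ?y 7 + (2) * ?y 8"
      by (simp add: matrix_vector_mult_def reduced_matrix_def cartan_e8_def sum_8 vector_8 algebra_simps)
    then have x1: "x $ 1 = 0" by (simp only: y mult_zero_right add_0_left)
    have "x $ 2 = (5) * ?y 1 + (8) * ?y 2 + (10) * ?y 3 + (15) * ?y 4 + (12) * ?y 5 + (9) * ?y 6 + (6) * ?y 7 + (3) * ?y 8"
      by (simp add: matrix_vector_mult_def reduced_matrix_def cartan_e8_def sum_8 vector_8 algebra_simps)
    then have x2: "x $ 2 = 0" by (simp only: y mult_zero_right add_0_left)
    have "x $ 3 = (7) * ?y 1 + (10) * ?y 2 + (14) * ?y 3 + (20) * ?y 4 + (16) * ?y 5 + (12) * ?y 6 + (8) * ?y 7 + (4) * ?y 8"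
      by (simp add: matrix_vector_mult_def reduced_matrix_def cartan_e8_def sum_8 vector_8 algebra_simps)
    then have x3: "x $ 3 = 0" by (simp only: y mult_zero_right add_0_left)
    have "x $ 4 = (10) * ?y 1 + (15) * ?y 2 + (20) * ?y 3 + (30) * ?y 4 + (24) * ?y 5 + (18) * ?y 6 + (12) * ?y 7 + (6) * ?y 8"
      by (simp add: matrix_vector_mult_def reduced_matrix_def cartan_e8_def sum_8 vector_8 algebra_simps)
    then have x4: "x $ 4 = 0" by (simp only: y mult_zero_right add_0_left)
    have "x $ 5 = (8) * ?y 1 + (12) * ?y 2 + (16) * ?y 3 + (24) * ?y 4 + (20) * ?y 5 + (15) * ?y 6 + (10) * ?y 7 + (5) * ?y 8"
      by (simp add: matrix_vector_mult_def reduced_matrix_def cartan_e8_def sum_8 vector_8 algebra_simps)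
    then have x5: "x $ 5 = 0" by (simp only: y mult_zero_right add_0_left)
    have "x $ 6 = (6) * ?y 1 + (9) * ?y 2 + (12) * ?y 3 + (18) * ?y 4 + (15) * ?y 5 + (12) * ?y 6 + (8) * ?y 7 + (4) * ?y 8"
      by (simp add: matrix_vector_mult_def reduced_matrix_def cartan_e8_def sum_8 vector_8 algebra_simps)
    then have x6: "x $ 6 = 0" by (simp only: y mult_zero_right add_0_left)
    have "x $ 7 = (4) * ?y 1 + (6) * ?y 2 + (8) * ?y 3 + (12) * ?y 4 + (10) * ?y 5 + (8) * ?y 6 + (6) * ?y 7 + (3) * ?y 8"
      by (simp add: matrix_vector_mult_def reduced_matrix_def cartan_e8_def sum_8 vector_8 algebra_simps)
    then have x7: "x $ 7 = 0" by (simp only: y mult_zero_right add_0_left)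
    have "x $ 8 = (2) * ?y 1 + (3) * ?y 2 + (4) * ?y 3 + (6) * ?y 4 + (5) * ?y 5 + (4) * ?y 6 + (3) * ?y 7 + (2) * ?y 8"
      by (simp add: matrix_vector_mult_def reduced_matrix_def cartan_e8_def sum_8 vector_8 algebra_simps)
    then have x8: "x $ 8 = 0" by (simp only: y mult_zero_right add_0_left)
    show "x = 0" using x1 x2 x3 x4 x5 x6 x7 x8 by (simp add: vec_eq_iff forall_8)
  qed
  then show ?thesis by simp
qed

lemma rank_cartan_g86:
  assumes "CHAR('k::field) = 3"
  shows "rank (reduced_matrix cartan_g86 :: 'k^7^7) = 7"
proof -
  have ten: "(10::'k) \<noteq> 0"
    using of_int_eq_0_iff_char_dvd[of 10, where 'a='k] assms by simp
  have "rank (reduced_matrix cartan_g86 :: 'k^7^7) = CARD(7)"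
  proof (rule full_rank)
    fix x :: "'k^7" assume "reduced_matrix cartan_g86 *v x = 0"
    then have y: "(reduced_matrix cartan_g86 *v x) $ i = 0" for i by simp
    let ?y = "\<lambda>i. (reduced_matrix cartan_g86 *v x) $ i"
    \<comment> \<open>The coefficients here and below are the rows of the adjugate matrix; the
      determinant is -10, which is nonzero modulo 3.\<close>
    have "- (10 * x $ 1) = (-5) * ?y 1 + (5) * ?y 2"
      by (simp add: matrix_vector_mult_def reduced_matrix_def cartan_g86_def sum_7 vector_7 algebra_simps)
    then have "- (10 * x $ 1) = 0" by (simp only: y mult_zero_right add_0_left)
    then have x1: "x $ 1 = 0" using ten by simp
    have "- (10 * x $ 2) = (5) * ?y 1 + (7) * ?y 2 + (10) * ?y 3 + (8) * ?y 4 + (6) * ?y 5 + (4) * ?y 6 + (2) * ?y 7"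
      by (simp add: matrix_vector_mult_def reduced_matrix_def cartan_g86_def sum_7 vector_7 algebra_simps)
    then have "- (10 * x $ 2) = 0" by (simp only: y mult_zero_right add_0_left)
    then have x2: "x $ 2 = 0" using ten by simp
    have "- (10 * x $ 3) = (10) * ?y 2"
      by (simp add: matrix_vector_mult_def reduced_matrix_def cartan_g86_def sum_7 vector_7 algebra_simps)
    then have "- (10 * x $ 3) = 0" by (simp only: y mult_zero_right add_0_left)
    then have x3: "x $ 3 = 0" using ten by simp
    have "- (10 * x $ 4) = (8) * ?y 2 + (-8) * ?y 4 + (-6) * ?y 5 + (-4) * ?y 6 + (-2) * ?y 7"
      by (simp add: matrix_vector_mult_def reduced_matrix_def cartan_g86_def sum_7 vector_7 algebra_simps)
    then have "- (10 * x $ 4) = 0" by (simp only: y mult_zero_right add_0_left)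
    then have x4: "x $ 4 = 0" using ten by simp
    have "- (10 * x $ 5) = (6) * ?y 2 + (-6) * ?y 4 + (-12) * ?y 5 + (-8) * ?y 6 + (-4) * ?y 7"
      by (simp add: matrix_vector_mult_def reduced_matrix_def cartan_g86_def sum_7 vector_7 algebra_simps)
    then have "- (10 * x $ 5) = 0" by (simp only: y mult_zero_right add_0_left)
    then have x5: "x $ 5 = 0" using ten by simp
    have "- (10 * x $ 6) = (4) * ?y 2 + (-4) * ?y 4 + (-8) * ?y 5 + (-12) * ?y 6 + (-6) * ?y 7"
      by (simp add: matrix_vector_mult_def reduced_matrix_def cartan_g86_def sum_7 vector_7 algebra_simps)
    then have "- (10 * x $ 6) = 0" by (simp only: y mult_zero_right add_0_left)
    then have x6: "x $ 6 = 0" using ten by simp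
    have "- (10 * x $ 7) = (2) * ?y 2 + (-2) * ?y 4 + (-4) * ?y 5 + (-6) * ?y 6 + (-8) * ?y 7"
      by (simp add: matrix_vector_mult_def reduced_matrix_def cartan_g86_def sum_7 vector_7 algebra_simps)
    then have "- (10 * x $ 7) = 0" by (simp only: y mult_zero_right add_0_left)
    then have x7: "x $ 7 = 0" using ten by simp
    show "x = 0" using x1 x2 x3 x4 x5 x6 x7 by (simp add: vec_eq_iff forall_7)
  qed
  then show ?thesis by simp
qed

section \<open>The semisimplification of \<open>\<ee>\<^sub>8\<close>\<close>

lemma superalgebra_iso_sym:
  assumes L: "super_nonassoc_algebra L" and iso: "superalgebra_iso L M"
  shows "superalgebra_iso M L"
proof -
  interpret L: super_nonassoc_algebra L by fact
  obtain u where u: "u \<in> lin_maps L M" "bij_betw u (carrier L) (carrier M)"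
    "\<And>x y. x \<in> carrier L \<Longrightarrow> y \<in> carrier L \<Longrightarrow> u (x \<otimes>\<^bsub>L\<^esub> y) = u x \<otimes>\<^bsub>M\<^esub> u y"
    "\<And>p. u ` part L p = part M p"
    using iso by (auto simp: superalgebra_iso_def)
  define g where "g = inv_into (carrier L) u"
  have gu: "g (u x) = x" if "x \<in> carrier L" for x
    using u(2) that by (simp add: g_def bij_betw_def inv_into_f_f)
  have M: "carrier M = u ` carrier L" using u(2) by (simp add: bij_betw_def)
  have add: "u x \<oplus>\<^bsub>M\<^esub> u y = u (x \<oplus>\<^bsub>L\<^esub> y)" if "x \<in> carrier L" "y \<in> carrier L" for x y
    using u(1) that by (simp add: lin_maps_def)
  have scale: "c \<odot>\<^bsub>M\<^esub> u x = u (c \<odot>\<^bsub>L\<^esub> x)" if "x \<in> carrier L" for c x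
    using u(1) that by (simp add: lin_maps_def)
  have "g \<in> lin_maps M L"
    unfolding lin_maps_def M by (auto simp: gu add scale)
  moreover have "bij_betw g (carrier M) (carrier L)"
    using u(2) by (simp add: g_def bij_betw_inv_into)
  moreover have "\<forall>x\<in>carrier M. \<forall>y\<in>carrier M. g (x \<otimes>\<^bsub>M\<^esub> y) = g x \<otimes>\<^bsub>L\<^esub> g y"
    unfolding M by (auto simp: gu u(3)[symmetric])
  moreover have "\<forall>p. g ` part M p = part L p"
  proof
    fix p
    have "g ` part M p = (\<lambda>x. g (u x)) ` part L p" by (simp add: u(4)[symmetric] image_image)
    also have "\<dots> = part L p" using gu L.part_closed[of p] by (auto simp: subset_iff image_iff)
    finally show "g ` part M p = part L p" .
  qed
  ultimately show ?thesis unfolding superalgebra_iso_def by blast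
qed

lemma superalgebra_iso_trans:
  assumes "superalgebra_iso L M" "superalgebra_iso M N"
  shows "superalgebra_iso L N"
proof -
  obtain u where u: "u \<in> lin_maps L M" "bij_betw u (carrier L) (carrier M)"
    "\<forall>x\<in>carrier L. \<forall>y\<in>carrier L. u (x \<otimes>\<^bsub>L\<^esub> y) = u x \<otimes>\<^bsub>M\<^esub> u y" "\<forall>p. u ` part L p = part M p"
    using assms(1) by (auto simp: superalgebra_iso_def)
  obtain g where g: "g \<in> lin_maps M N" "bij_betw g (carrier M) (carrier N)"
    "\<forall>x\<in>carrier M. \<forall>y\<in>carrier M. g (x \<otimes>\<^bsub>M\<^esub> y) = g x \<otimes>\<^bsub>N\<^esub> g y" "\<forall>p. g ` part M p = part N p"
    using assms(2) by (auto simp: superalgebra_iso_def)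
  have "u x \<in> carrier M" if "x \<in> carrier L" for x using u(1) that by (auto simp: lin_maps_def)
  then have "\<forall>x\<in>carrier L. \<forall>y\<in>carrier L. (g \<circ> u) (x \<otimes>\<^bsub>L\<^esub> y) = (g \<circ> u) x \<otimes>\<^bsub>N\<^esub> (g \<circ> u) y"
    using u(3) g(3) by simp
  moreover have "\<forall>p. (g \<circ> u) ` part L p = part N p"
    by (simp add: u(4)[rule_format, symmetric] g(4)[rule_format, symmetric] image_image)
  ultimately show ?thesis
    unfolding superalgebra_iso_def using lin_maps_comp[OF u(1) g(1)] bij_betw_trans[OF u(2) g(2)] by blast
qed

theorem corollary4p6p3:
  fixes R_e8 :: "('k::alg_closed_field, 8, 'h1::ab_group_add) cartan_data"
    and R_g86 :: "('k, 7, 'h2::ab_group_add) cartan_data"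
  assumes "CHAR('k) = 3"
    and "realizes cartan_e8 R_e8"
    and "realizes cartan_g86 R_g86"
  defines "e8 \<equiv> contragredient parity_e8 R_e8"
    and "e1 \<equiv> contragredient_e parity_e8 R_e8 1"
    and "g86 \<equiv> contragredient parity_g86 R_g86"
  shows "alpha3_lie_algebra e8 (\<lambda>x. e1 \<otimes>\<^bsub>e8\<^esub> x) \<and>
    superalgebra_iso (semisimplification e8 (\<lambda>x. e1 \<otimes>\<^bsub>e8\<^esub> x)) g86"
proof -
  have pe: "parity_e8 = (\<lambda>i. 0)" by (rule ext) (simp add: parity_e8_def)
  have pg: "parity_g86 = (\<lambda>i. if i = 2 then 1 else 0)" by (rule ext) (simp add: parity_g86_def)
  obtain hm where hm: "cartan_model parity_e8 R_e8 e8.brk UNIV (\<lambda>i. 0) e8.wt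
      (\<lambda>i. e8.evec (axis i 1)) (\<lambda>i. - e8.evec (- axis i 1)) hm"
    unfolding pe
    by (rule e8.simply_laced_model[OF assms(1,2)]) (simp_all add: rank_cartan_e8 e8_pair_simple)
  obtain v where v: "v \<in> lin_maps e8 (vec_superalgebra UNIV e8.brk (\<lambda>i. 0))"
    "\<And>x y. x \<in> carrier e8 \<Longrightarrow> y \<in> carrier e8 \<Longrightarrow> v (x \<otimes>\<^bsub>e8\<^esub> y) = e8.brk (v x) (v y)"
    "bij_betw v (carrier e8) UNIV" "e1 \<in> carrier e8" "v e1 = e8.evec (axis 1 1)"
    "super_nonassoc_algebra e8"
    using cartan_model.model_iso[OF hm] unfolding e8_def e1_def by metis
  \<comment> \<open>The derivation belongs to the presented algebra itself, so the comparison starts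
    there: \<open>v\<close> carries it to coordinates and sends \<open>e1\<close> to
    \<open>ee\<close>.\<close>
  interpret s: sl_iso gram_e8 Rep_e8_root "axis 1 1" e8 v e1
  proof (intro sl_iso.intro sl_iso_axioms.intro v(6) e8.simply_laced_root_axioms assms(1))
  qed (use v in \<open>auto simp: lin_maps_def e8.ee_def\<close>)
  obtain hm' where hm': "cartan_model parity_g86 R_g86 e8.sbrk e8.super_carrier e8.super_parity
      (e8.forget \<circ> e8.wt) e8.egen e8.fgen hm'"
    unfolding pg
    by (rule e8.node_model[OF assms(1,3)]) (simp_all add: rank_cartan_g86[OF assms(1)] cartan_g86_lift)
  have g86: "superalgebra_iso g86 (vec_superalgebra e8.super_carrier e8.sbrk e8.super_parity)"
    "super_nonassoc_algebra g86"
    using cartan_model.model_iso[OF hm'] unfolding g86_def superalgebra_iso_def vec_superalgebra_simps by metis+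
  show ?thesis
    using s.alpha3 superalgebra_iso_trans[OF s.semisimplification_iso superalgebra_iso_sym[OF g86(2,1)]]
    by blast
qed

end
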